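(* For $n\in\mathbb{Z}\setminus\{0\}$ let \[ \mathscr{J}_n=\frac{1}{\pi n}\Bigl(1+\int_0^\infty \frac{2y^3}{(y^2+\pi^2n^2)\sinh^2 y}\,dy\Bigr), \] and let $\mathscr{J}_0=0$. Let $1<p<\infty$, let $(a_n)_{n\in\mathbb{Z}}\in\ell^p(\mathbb{Z})$, and define $\mathscr{J}a_n=\sum_{m\in\mathbb{Z}}\mathscr{J}_m a_{n-m}$. Then \[ \Bigl(\sum_{n\in\mathbb{Z}}|\mathscr{J} a_n|^p\Bigr)^{1/p} \le \cot\Bigl(\frac{\pi}{2p^*}\Bigr)\Bigl(\sum_{n\in\mathbb{Z}}|a_n|^p\Bigr)^{1/p}, \] where $p^*=\max(p,p/(p-1))$. The constant $\cot(\pi/(2p^* ))$ in this inequality is best possible; consequently the operator norm of $\mathscr{J}$ on $\ell^p(\mathbb{Z})$ equals $\cot(\pi/(2p^* ))$.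
   Context: $\ell^p(\mathbb{Z})$ is the space of doubly infinite real sequences with finite norm $(\sum_n|a_n|^p)^{1/p}$. The series defining $\mathscr{J}a_n$ converges absolutely for $(a_n)\in\ell^p$ since $|\mathscr{J}_m|\le C/|m|$. *)

theory Defs
  imports "HOL-Analysis.Analysis"
begin

text \<open>Kernel coefficients J_n; J_0 = 0. The integral is the (improper, absolutely
convergent, nonnegative integrand) integral over [0, infinity).\<close>
definition Jcoef :: "int \<Rightarrow> real" where
  "Jcoef n = (if n = 0 then 0 else
     (1 / (pi * real_of_int n)) *
       (1 + integral {0..} (\<lambda>y::real. 2 * y ^ 3 /
              ((y ^ 2 + pi ^ 2 * (real_of_int n) ^ 2) * (sinh y) ^ 2))))"

definition in_lp :: "real \<Rightarrow> (int \<Rightarrow> real) \<Rightarrow> bool" where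
  "in_lp p a \<longleftrightarrow> (\<lambda>n. \<bar>a n\<bar> powr p) summable_on UNIV"

definition lp_norm :: "real \<Rightarrow> (int \<Rightarrow> real) \<Rightarrow> real" where
  "lp_norm p a = (\<Sum>\<^sub>\<infinity>n. \<bar>a n\<bar> powr p) powr (1 / p)"

definition Jop :: "(int \<Rightarrow> real) \<Rightarrow> int \<Rightarrow> real" where
  "Jop a n = (\<Sum>\<^sub>\<infinity>m. Jcoef m * a (n - m))"

definition pstar :: "real \<Rightarrow> real" where
  "pstar p = max p (p / (p - 1))"

end

theory Submission
  imports Defs "HOL-Complex_Analysis.Complex_Analysis" "HOL-Real_Asymp.Real_Asymp"
begin

text \<open>The Poisson kernels of the integer points sum to the harmonic function \<open>h = Im hol\<close> on the
  upper half-plane. For finitely supported \<open>a\<close> and \<open>b\<close> let \<open>u\<close>, \<open>v\<close> be the quotients by \<open>h\<close> of the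
  Poisson sums with coefficients \<open>a\<close>, \<open>b\<close>; the horizontal integrals of \<open>2 y h (u\<^sub>x v\<^sub>y - u\<^sub>y v\<^sub>x)\<close>,
  computed by residues, integrate in \<open>y\<close> to the pairing \<open>\<Sum> a\<^sub>m b\<^sub>n J\<^bsub>n-m\<^esub>\<close>. For \<open>p \<le> 2\<close> let \<open>F\<close> be the
  partial Legendre transform of the (smoothed) subharmonic function of Pichorides,
  \<open>Re ((\<bar>x\<bar> + i s)\<^sup>p)\<close>. Its Hessian satisfies \<open>F\<^sub>1\<^sub>1 F\<^sub>2\<^sub>2 - F\<^sub>1\<^sub>2\<^sup>2 \<ge> 1\<close>, whence
  \<open>\<Delta> (h F(u, v)) \<ge> 2 h (u\<^sub>x v\<^sub>y - u\<^sub>y v\<^sub>x)\<close>; integrated against \<open>y\<close> this bounds the pairing by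
  \<open>\<Sum> F(a\<^sub>n, b\<^sub>n)\<close>, and homogenizing Pichorides' inequality gives the constant. The case \<open>p \<ge> 2\<close> is dual.
  Sharpness comes from truncations of \<open>\<bar>n\<bar> powr (- 1 / p)\<close>, odd against even, together with
  \<open>J\<^sub>n \<ge> 1 / (\<pi> n)\<close> and the partial fraction expansion of the tangent.\<close>

text \<open>Dividing by \<open>h\<close> turns the half-plane into a discrete boundary problem: when
  \<open>z\<close> descends vertically to an integer \<open>n\<close>, the Poisson sum and
  \<open>h\<close> are dominated by the same kernel, so \<open>u\<close> and \<open>v\<close> tend
  to \<open>a n\<close> and \<open>b n\<close>. Since \<open>h\<close>, \<open>h u\<close>,
  \<open>h v\<close> are harmonic, the Laplacian of \<open>h F(u, v)\<close> keeps only the Hessian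
  of \<open>F\<close>. The Hessian condition is subharmonicity seen through the Legendre transform.
  If \<open>F(x, y)\<close> is the maximum over \<open>s\<close> of \<open>y s + Phi(x, s)\<close>
  with \<open>Phi_ss < 0\<close>, then \<open>F_yy = - 1 / Phi_ss\<close> and the determinant of the
  Hessian of \<open>F\<close> is \<open>- Phi_xx / Phi_ss\<close>; it is at least 1 exactly when
  \<open>Phi_xx + Phi_ss >= 0\<close>. The kernel comes out in closed form because
  \<open>1 / h\<close> is a trigonometric polynomial of degree one on each horizontal line. In the
  resulting function of the height the part free of exponentials integrates to
  \<open>1 / (pi n)\<close>, and the rest gives the \<open>sinh\<close> integral. The weight
  \<open>y\<close> is the limit of Green functions of intervals, so the mass of
  \<open>h F(u, v)\<close> at the bottom is what bounds the pairing, and the mass at the top must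
  vanish.\<close>

section \<open>Partial fractions of the cotangent and the tangent\<close>

text \<open>Differentiate both sides of \<open>Gamma z * Gamma (1 - z) = pi / sin (pi * z)\<close>
  and divide by the common value.\<close>

lemma Digamma_reflection_complex:
  fixes z :: complex
  assumes "z \<notin> \<int>"
  shows "Digamma (1 - z) - Digamma z = of_real pi * cot (of_real pi * z)"
proof -
  have z: "z \<notin> \<int>\<^sub>\<le>\<^sub>0" "1 - z \<notin> \<int>\<^sub>\<le>\<^sub>0"
    using assms nonpos_Ints_Int Ints_diff[OF Ints_1, of "1 - z"] by auto
  have s: "sin (of_real pi * z) \<noteq> 0"
    using assms by (auto simp: sin_eq_0 mult.commute)
  have 1: "((\<lambda>z. Gamma z * Gamma (1 - z)) has_field_derivative
      Gamma z * Gamma (1 - z) * (Digamma z - Digamma (1 - z))) (at z)"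
    using z by (auto intro!: derivative_eq_intros simp: algebra_simps)
  have 2: "((\<lambda>z. of_real pi / sin (of_real pi * z)) has_field_derivative
      - (of_real pi * of_real pi * cos (of_real pi * z) / (sin (of_real pi * z))\<^sup>2)) (at z)"
    using s by (auto intro!: derivative_eq_intros simp: power2_eq_square field_simps)
  have "of_real pi / sin (of_real pi * z) * (Digamma z - Digamma (1 - z)) =
      - (of_real pi * of_real pi * cos (of_real pi * z) / (sin (of_real pi * z))\<^sup>2)"
    using DERIV_unique[OF 1[unfolded Gamma_reflection_complex] 2] .
  moreover have "B - A = P * (c / s)" if "P / s * (A - B) = - (P * P * c / s\<^sup>2)" "P \<noteq> 0" "s \<noteq> 0" for A B P c s :: complex
  proof -
    have "B - A = - (s / P) * (P / s * (A - B))" using that(2,3) by simp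
    also have "\<dots> = - (s / P) * - (P * P * c / s\<^sup>2)" unfolding that(1) ..
    also have "\<dots> = P * (c / s)" using that(2,3) by (simp add: power2_eq_square)
    finally show ?thesis .
  qed
  ultimately show ?thesis using s unfolding cot_def by simp
qed

text \<open>The series of \<open>Digamma\<close> at \<open>1 - z\<close> and at \<open>z\<close>
  share their harmonic terms, which cancel in the reflection formula. Pairing the pole
  \<open>- k\<close> with the pole \<open>1 + k\<close> makes the series converge.\<close>

lemma cot_pi_sums_complex:
  fixes z :: complex
  assumes "z \<notin> \<int>"
  shows "(\<lambda>k. inverse (z + of_nat k) - inverse (1 - z + of_nat k)) sums (of_real pi * cot (of_real pi * z))"
proof -
  have "z \<noteq> 0" "1 - z \<noteq> 0" using assms by auto
  hence "(\<lambda>k. inverse (of_nat (Suc k)) - inverse (1 - z + of_nat k)) sums (Digamma (1 - z) + euler_mascheroni)"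
    "(\<lambda>k. inverse (of_nat (Suc k)) - inverse (z + of_nat k)) sums (Digamma z + euler_mascheroni)"
    by (simp_all add: Digamma_def summable_sums summable_Digamma del: of_nat_Suc)
  from sums_diff[OF this] show ?thesis
    using Digamma_reflection_complex[OF assms] by (simp add: algebra_simps)
qed

lemma cot_pi_sums_real:
  fixes x :: real
  assumes "x \<notin> \<int>"
  shows "(\<lambda>k. inverse (x + of_nat k) - inverse (1 - x + of_nat k)) sums (pi * cot (pi * x))"
proof -
  have "complex_of_real x \<notin> \<int>" using assms by (metis Re_complex_of_real complex_is_Int_iff Ints_cases Ints_of_int)
  from cot_pi_sums_complex[OF this]
  have "(\<lambda>k. complex_of_real (inverse (x + of_nat k) - inverse (1 - x + of_nat k))) sums of_real (pi * cot (pi * x))"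
    by (simp add: cot_of_real[symmetric] flip: of_real_mult)
  thus ?thesis by (simp only: sums_of_real_iff)
qed

text \<open>The cotangent series at \<open>(1 - g) / 2\<close>, the complement of the angle of the
  tangent. The terms are the integrals of
  \<open>2 * (t powr (2 * k - g) - t powr (2 * k + g))\<close> over \<open>[0, 1]\<close>, which is
  how the series enters the sharpness argument.\<close>

lemma tan_partial_fractions:
  fixes g :: real
  assumes "0 < g" "g < 1"
  shows "(\<lambda>k. 2 / (2 * real k + 1 - g) - 2 / (2 * real k + 1 + g)) sums (pi * tan (pi * g / 2))"
proof -
  define x where "x = (1 - g) / 2"
  have x01: "0 < x" "x < 1" using assms by (auto simp: x_def)
  hence "x \<notin> \<int>" by (auto elim!: Ints_cases)
  from cot_pi_sums_real[OF this]
  have "(\<lambda>k. inverse (x + of_nat k) - inverse (1 - x + of_nat k)) sums (pi * cot (pi * x))" .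
  moreover have "pi * x = pi / 2 - pi * g / 2" by (simp add: x_def field_simps)
  hence "cot (pi * x) = tan (pi * g / 2)" using tan_cot'[of "pi * x"] by simp
  moreover have "inverse (x + of_nat k) - inverse (1 - x + of_nat k) = 2 / (2 * real k + 1 - g) - 2 / (2 * real k + 1 + g)" for k
    unfolding x_def using assms by (simp add: field_simps)
  ultimately show ?thesis by simp
qed

subsection \<open>Poisson kernels of the integer points\<close>

text \<open>With this exponential the dependence on \<open>Re z\<close> along a horizontal line is a
  unimodular factor, and boundedness in the upper half-plane is visible.\<close>

definition qexp :: "complex \<Rightarrow> complex" where "qexp z = exp (2 * of_real pi * \<i> * z)"

text \<open>The harmonic function \<^term>\<open>\<lambda>z. Im (hol z)\<close> is the sum of the Poisson kernels
  \<^term>\<open>\<lambda>z. Im (pker n z)\<close> of all integer points.\<close>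

definition hol :: "complex \<Rightarrow> complex" where "hol z = \<i> * (1 + qexp z) / (1 - qexp z)"
definition hol1 :: "complex \<Rightarrow> complex" where "hol1 z = - 4 * of_real pi * qexp z / (1 - qexp z)\<^sup>2"
definition hol2 :: "complex \<Rightarrow> complex" where
  "hol2 z = - 8 * of_real pi * of_real pi * \<i> * qexp z * (1 + qexp z) / (1 - qexp z) ^ 3"

definition pker :: "int \<Rightarrow> complex \<Rightarrow> complex" where "pker n z = - 1 / (of_real pi * (z - of_int n))"
text \<open>Complex derivatives are kept because one function then carries both partial derivatives
  of the Poisson kernel: \<open>Im\<close> for the horizontal and \<open>Re\<close> for the vertical
  one.\<close>

definition pker1 :: "int \<Rightarrow> complex \<Rightarrow> complex" where "pker1 n z = 1 / (of_real pi * (z - of_int n)\<^sup>2)"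
definition pker2 :: "int \<Rightarrow> complex \<Rightarrow> complex" where "pker2 n z = - 2 / (of_real pi * (z - of_int n) ^ 3)"

lemma norm_qexp: "norm (qexp z) = exp (- 2 * pi * Im z)"
  by (simp add: qexp_def)

lemma norm_qexp_less: "0 < Im z \<Longrightarrow> norm (qexp z) < 1"
  by (simp add: norm_qexp)

lemma qexp_neq_1 [simp]: "0 < Im z \<Longrightarrow> 1 - qexp z \<noteq> 0" "0 < Im z \<Longrightarrow> qexp z \<noteq> 1"
  using norm_qexp_less[of z] by auto

lemma minus_int_nz [simp]: "0 < Im z \<Longrightarrow> z - of_int n \<noteq> 0" "0 < Im z \<Longrightarrow> z \<noteq> of_int n"
  by (auto simp: complex_eq_iff)

lemma qexp_deriv: "(qexp has_field_derivative 2 * of_real pi * \<i> * qexp z) (at z)"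
  unfolding qexp_def[abs_def] by (auto intro!: derivative_eq_intros)

lemma hol_deriv: "0 < Im z \<Longrightarrow> (hol has_field_derivative hol1 z) (at z)"
  unfolding hol_def[abs_def] hol1_def
  by (auto intro!: derivative_eq_intros qexp_deriv simp: power2_eq_square divide_simps)
    (simp add: algebra_simps)

lemma hol1_deriv: assumes "0 < Im z" shows "(hol1 has_field_derivative hol2 z) (at z)"
proof -
  define q where "q = qexp z"
  have q: "1 - q \<noteq> 0" using assms by (simp add: q_def)
  have "(hol1 has_field_derivative
     (- 4 * of_real pi * (2 * of_real pi * \<i> * q) * (1 - q)\<^sup>2 - - 4 * of_real pi * q * (2 * (1 - q) * (- (2 * of_real pi * \<i> * q))))
     / ((1 - q)\<^sup>2 * (1 - q)\<^sup>2)) (at z)"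
    unfolding hol1_def[abs_def] q_def
  proof (rule DERIV_divide)
    show "((\<lambda>z. - 4 * of_real pi * qexp z) has_field_derivative - 4 * of_real pi * (2 * of_real pi * \<i> * qexp z)) (at z)"
      by (rule DERIV_cmult[OF qexp_deriv])
    show "((\<lambda>z. (1 - qexp z)\<^sup>2) has_field_derivative 2 * (1 - qexp z) * - (2 * of_real pi * \<i> * qexp z)) (at z)"
      by (auto intro!: derivative_eq_intros qexp_deriv simp: algebra_simps)
  qed (use assms in simp)
  moreover have "(- 4 * of_real pi * (2 * of_real pi * \<i> * q) * (1 - q)\<^sup>2 - - 4 * of_real pi * q * (2 * (1 - q) * (- (2 * of_real pi * \<i> * q))))
     / ((1 - q)\<^sup>2 * (1 - q)\<^sup>2) = hol2 z"
  proof -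
    have "(- 4 * P * (2 * P * \<i> * q) * r\<^sup>2 - - 4 * P * q * (2 * r * (- (2 * P * \<i> * q)))) / (r\<^sup>2 * r\<^sup>2)
      = - 8 * P * P * \<i> * q * (r + 2 * q) / r ^ 3" if "r \<noteq> 0" for P r
      using that by (simp add: divide_simps) (simp add: algebra_simps power2_eq_square power3_eq_cube power4_eq_xxxx)
    from this[OF q, of "of_real pi"] show ?thesis unfolding hol2_def q_def[symmetric] by simp
  qed
  ultimately show ?thesis by simp
qed

lemma pker_deriv: "0 < Im z \<Longrightarrow> (pker n has_field_derivative pker1 n z) (at z)"
  unfolding pker_def[abs_def] pker1_def
  by (auto intro!: derivative_eq_intros simp: divide_simps power2_eq_square)

lemma pker1_deriv: "0 < Im z \<Longrightarrow> (pker1 n has_field_derivative pker2 n z) (at z)"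
  unfolding pker1_def[abs_def] pker2_def
  by (auto intro!: derivative_eq_intros simp: divide_simps power2_eq_square power3_eq_cube)

lemma hol_eq_cot: assumes "0 < Im z" shows "hol z = - cot (of_real pi * z)"
proof -
  define a where "a = exp (\<i> * (of_real pi * z))"
  have a: "a \<noteq> 0" by (simp add: a_def)
  have b: "exp (- (\<i> * (of_real pi * z))) = 1 / a" by (simp add: a_def exp_minus field_simps)
  have q: "qexp z = a * a" unfolding qexp_def a_def by (simp add: exp_add[symmetric] algebra_simps)
  have "a * a \<noteq> 1" using qexp_neq_1(2)[OF assms] q by simp
  thus ?thesis unfolding hol_def cot_def sin_exp_eq cos_exp_eq b a_def[symmetric] q using a
    by (simp add: divide_simps) (simp add: algebra_simps)
qed

lemma Im_pker: "Im (pker n z) = Im z / (pi * ((Re z - n)\<^sup>2 + (Im z)\<^sup>2))"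
proof -
  have "pker n z = - (1 / of_real pi) * inverse (z - of_int n)" by (simp add: pker_def field_simps)
  hence "pker n z = of_real (- (1 / pi)) * inverse (z - of_int n)" by simp
  hence "Im (pker n z) = - (1 / pi) * Im (inverse (z - of_int n))" by simp
  also have "Im (inverse (z - of_int n)) = - Im z / ((Re z - n)\<^sup>2 + (Im z)\<^sup>2)" by (simp add: power2_eq_square)
  finally show ?thesis by simp
qed

lemma Im_pker_nonneg: "0 \<le> Im z \<Longrightarrow> 0 \<le> Im (pker n z)"
  unfolding Im_pker by (intro divide_nonneg_nonneg mult_nonneg_nonneg) auto

lemma Im_pker_sums:
  assumes "0 < Im z"
  shows "(\<lambda>k. Im (pker (- int k) z) + Im (pker (1 + int k) z)) sums Im (hol z)"
proof -
  have "z \<notin> \<int>" using assms by (auto simp: complex_is_Int_iff)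
  from sums_mult[OF cot_pi_sums_complex[OF this], of "- 1 / of_real pi"]
  have "(\<lambda>k. - 1 / of_real pi * (inverse (z + of_nat k) - inverse (1 - z + of_nat k))) sums hol z"
    using hol_eq_cot[OF assms] by simp
  moreover have "- 1 / of_real pi * (inverse (z + of_nat k) - inverse (1 - z + of_nat k))
     = pker (- int k) z + pker (1 + int k) z" for k
  proof -
    have "inverse (1 - z + of_nat k) = - inverse (z - of_int (1 + int k))"
      by (metis inverse_minus_eq minus_diff_eq of_int_add of_int_1 of_int_of_nat_eq add_diff_eq diff_add_eq)
    thus ?thesis unfolding pker_def divide_inverse inverse_mult_distrib by (simp add: algebra_simps)
  qed
  ultimately have "(\<lambda>k. pker (- int k) z + pker (1 + int k) z) sums hol z" by simp
  from sums_Im[OF this] show ?thesis by simp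
qed

text \<open>A finite set of integers lies in the index set of some partial sum of the paired series,
  whose terms are nonnegative. This makes the quotients by \<open>Im (hol z)\<close> weights of
  total mass at most one.\<close>

lemma sum_Im_pker_le:
  assumes "finite X" "0 < Im z"
  shows "(\<Sum>n\<in>X. Im (pker n z)) \<le> Im (hol z)"
proof -
  obtain m where m: "\<And>n. n \<in> X \<Longrightarrow> \<bar>n\<bar> < int m"
  proof -
    obtain b where b: "\<And>n. n \<in> X \<Longrightarrow> \<bar>n\<bar> \<le> b"
      using assms(1) by (metis finite_imageI imageI Max_ge)
    show thesis by (rule that[of "nat b + 1"]) (use b in force)
  qed
  define f where "f n = Im (pker n z)" for n
  have f0: "0 \<le> f n" for n unfolding f_def using assms(2) by (intro Im_pker_nonneg) simp
  have "(\<Sum>n\<in>X. f n) \<le> (\<Sum>n\<in>(\<lambda>k. - int k) ` {..<m} \<union> (\<lambda>k. 1 + int k) ` {..<m}. f n)"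
  proof (rule sum_mono2)
    show "X \<subseteq> (\<lambda>k. - int k) ` {..<m} \<union> (\<lambda>k. 1 + int k) ` {..<m}"
    proof
      fix n assume n: "n \<in> X"
      show "n \<in> (\<lambda>k. - int k) ` {..<m} \<union> (\<lambda>k. 1 + int k) ` {..<m}"
      proof (cases "n \<le> 0")
        case True
        hence "n = - int (nat (- n))" "nat (- n) < m" using m[OF n] by auto
        thus ?thesis by blast
      next
        case False
        hence "n = 1 + int (nat (n - 1))" "nat (n - 1) < m" using m[OF n] by auto
        thus ?thesis by blast
      qed
    qed
  qed (use f0 in auto)
  also have "\<dots> = (\<Sum>n\<in>(\<lambda>k. - int k) ` {..<m}. f n) + (\<Sum>n\<in>(\<lambda>k. 1 + int k) ` {..<m}. f n)"
    by (rule sum.union_disjoint) auto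
  also have "\<dots> = (\<Sum>k<m. f (- int k) + f (1 + int k))"
    by (simp add: sum.reindex inj_on_def sum.distrib)
  also have "\<dots> \<le> Im (hol z)"
    using sum_le_suminf[of "\<lambda>k. f (- int k) + f (1 + int k)" "{..<m}"] Im_pker_sums[OF assms(2), folded f_def] f0
    by (auto simp: sums_iff)
  finally show ?thesis by (simp add: f_def)
qed

text \<open>With \<open>q = qexp z\<close>, the imaginary part is the Poisson kernel
  \<open>(1 - |q|^2) / |1 - q|^2\<close> of the unit disc; the lower bound is its minimum on the
  circle of radius \<open>|q|\<close>.\<close>

lemma Im_hol_bounds:
  assumes "0 < Im z"
  shows "(1 - exp (- 2 * pi * Im z)) / (1 + exp (- 2 * pi * Im z)) \<le> Im (hol z)" "0 < Im (hol z)"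
proof -
  define q where "q = qexp z"
  define e where "e = exp (- 2 * pi * Im z)"
  have e: "norm q = e" "0 < e" "e < 1" using assms by (auto simp: q_def e_def norm_qexp)
  have n: "norm (1 - q) > 0" "norm (1 - q) \<le> 1 + e" using e norm_triangle_ineq4[of 1 q] by auto
  have "Im (hol z) = Re ((1 + q) / (1 - q))" unfolding hol_def q_def[symmetric]
    by (simp add: Im_divide Re_divide)
  also have "\<dots> = Re ((1 + q) * cnj (1 - q)) / (norm (1 - q))\<^sup>2"
    by (simp add: complex_div_cnj[of "1 + q"] flip: of_real_power)
  also have "Re ((1 + q) * cnj (1 - q)) = 1 - (norm q)\<^sup>2"
    unfolding cmod_power2 by (simp add: algebra_simps power2_eq_square)
  finally have 1: "Im (hol z) = (1 - e\<^sup>2) / (norm (1 - q))\<^sup>2" by (simp add: e)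
  have e2: "e\<^sup>2 < 1" using e by (simp add: power_less_one_iff)
  show "0 < Im (hol z)" unfolding 1 using n e2 by simp
  have "1 - e\<^sup>2 = (1 - e) * (1 + e)" by (simp add: power2_eq_square algebra_simps)
  hence "(1 - e) / (1 + e) = (1 - e\<^sup>2) / (1 + e)\<^sup>2" using e by (simp add: power2_eq_square)
  also have "\<dots> \<le> Im (hol z)" unfolding 1 using n e2 e by (intro divide_left_mono power_mono) auto
  finally show "(1 - exp (- 2 * pi * Im z)) / (1 + exp (- 2 * pi * Im z)) \<le> Im (hol z)" by (simp add: e_def)
qed

subsection \<open>The Pichorides inequality\<close>

definition pichT :: "real \<Rightarrow> real" where "pichT p = tan (pi / (2 * p))"
text \<open>The coefficient for which equality in Pichorides' inequality is a critical point: it is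
  attained at the angle \<open>pi / (2 * p)\<close>, where \<open>cos (p * t)\<close>
  vanishes.\<close>

definition pichD :: "real \<Rightarrow> real" where
  "pichD p = sin (pi / (2 * p)) powr (p - 1) / cos (pi / (2 * p))"

lemma pich_angle:
  fixes p :: real assumes "1 < p" "p \<le> 2"
  shows "0 < pi / (2 * p)" "pi / (2 * p) < pi / 2" "0 < sin (pi / (2 * p))"
        "0 < cos (pi / (2 * p))" "0 < pichT p" "0 < pichD p"
proof -
  show a: "0 < pi / (2 * p)" and b: "pi / (2 * p) < pi / 2"
    using assms by (auto simp: field_simps)
  show c: "0 < sin (pi / (2 * p))" using a b by (intro sin_gt_zero) auto
  show d: "0 < cos (pi / (2 * p))" using a b by (intro cos_gt_zero) auto
  show "0 < pichT p" unfolding pichT_def using a b by (intro tan_gt_zero) auto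
  show "0 < pichD p" unfolding pichD_def using c d by simp
qed

text \<open>The logarithmic derivative of \<open>sin t powr c / sin (c * t)\<close> is
  \<open>c * (cot t - cot (c * t))\<close>, which is at most 0 because \<open>c * t \<le> t\<close>
  and the cotangent decreases. The statement is this monotonicity, cross-multiplied.\<close>

lemma pich_ratio_antimono:
  fixes c x y :: real
  assumes "0 < c" "c \<le> 1" "0 < x" "x \<le> y" "y < pi / 2"
  shows "sin y powr c * sin (c * x) \<le> sin x powr c * sin (c * y)"
proof -
  define g where "g t = c * ln (sin t) - ln (sin (c * t))" for t :: real
  have pos: "0 < sin t" "0 < cos t" "0 < sin (c * t)" "0 < c * t" "c * t \<le> t" if "0 < t" "t \<le> y" for t
  proof -
    show 1: "0 < c * t" "c * t \<le> t" using assms that by (auto simp: mult_le_cancel_right1)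
    show "0 < sin t" "0 < cos t" using that assms by (auto intro!: sin_gt_zero cos_gt_zero)
    have "c * t < pi" using 1 that assms(5) pi_gt_zero by linarith
    thus "0 < sin (c * t)" using 1 by (intro sin_gt_zero) auto
  qed
  have "g y \<le> g x"
  proof (rule DERIV_nonpos_imp_nonincreasing[OF assms(4)])
    fix t assume t: "x \<le> t" "t \<le> y"
    note pt = pos[of t]
    have t0: "0 < t" using t assms by simp
    have "DERIV g t :> c * (cos t / sin t) - c * cos (c * t) / sin (c * t)"
      unfolding g_def using pt t t0 by (auto intro!: derivative_eq_intros simp: field_simps)
    moreover have "c * (cos t / sin t) - c * cos (c * t) / sin (c * t) \<le> 0"
    proof -
      have "0 \<le> t - c * t" "t - c * t \<le> pi" using pt[OF t0 t(2)] t t0 assms pi_gt_zero by linarith+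
      hence "sin (t - c * t) \<ge> 0" by (intro sin_ge_zero)
      hence "cos t * sin (c * t) \<le> cos (c * t) * sin t"
        by (simp add: sin_diff algebra_simps)
      hence "cos t / sin t \<le> cos (c * t) / sin (c * t)"
        using pt t t0 by (simp add: field_simps)
      hence "c * (cos t / sin t) \<le> c * (cos (c * t) / sin (c * t))" using assms(1) by (intro mult_left_mono) auto
      thus ?thesis by simp
    qed
    ultimately show "\<exists>z. DERIV g t :> z \<and> z \<le> 0" by blast
  qed
  hence "c * ln (sin y) + ln (sin (c * x)) \<le> c * ln (sin x) + ln (sin (c * y))"
    by (simp add: g_def)
  hence "exp (c * ln (sin y) + ln (sin (c * x))) \<le> exp (c * ln (sin x) + ln (sin (c * y)))" by simp
  thus ?thesis using pos[of x] pos[of y] assms by (simp add: exp_add powr_def)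
qed

text \<open>After division by \<open>cos t powr p\<close> the left side becomes \<open>h\<close>,
  whose derivative has the sign of \<open>sin u powr (p - 1) - D * sin ((p - 1) * u)\<close>. By the
  monotone ratio this sign changes once, at \<open>t0\<close>, so \<open>h\<close> is largest there,
  with value \<open>pichT p powr p\<close>.\<close>

lemma pichorides_angle:
  fixes p t :: real
  assumes p: "1 < p" "p \<le> 2" and t: "0 \<le> t" "t < pi / 2"
  shows "sin t powr p + pichD p * cos (p * t) \<le> pichT p powr p * cos t powr p"
proof -
  define t0 where "t0 = pi / (2 * p)"
  define D where "D = pichD p"
  note pa = pich_angle[OF p, folded t0_def]
  define h where "h t = (sin t powr p + D * cos (p * t)) / cos t powr p" for t
  \<comment> \<open>This is the choice of \<open>D\<close>: the derivative of \<open>h\<close>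
    vanishes at \<open>t0\<close>, since \<open>(p - 1) * t0\<close> and \<open>t0\<close> are
    complementary angles.\<close>
  have Deq: "D * sin ((p - 1) * t0) = sin t0 powr (p - 1)"
  proof -
    have "(p - 1) * t0 = pi / 2 - t0" unfolding t0_def using p by (simp add: field_simps)
    hence "sin ((p - 1) * t0) = cos t0" by (simp add: cos_sin_eq)
    thus ?thesis unfolding D_def pichD_def t0_def[symmetric] using pa by simp
  qed
  have cpos: "0 < cos u" if "0 \<le> u" "u < pi / 2" for u using that by (intro cos_gt_zero_pi) auto
  have spos: "0 < sin u" if "0 < u" "u < pi / 2" for u using that by (intro sin_gt_zero) auto
  have der: "DERIV h u :> p / cos u powr (p + 1) * (sin u powr (p - 1) - D * sin ((p - 1) * u))"
    if u: "0 < u" "u < pi / 2" for u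
  proof -
    note c = cpos[OF less_imp_le[OF u(1)] u(2)] and s = spos[OF u]
    have sq: "sin u * sin u + cos u * cos u = 1" using sin_cos_squared_add3[of u] by (simp add: algebra_simps)
    have pw: "cos u powr (p - 1) = cos u powr p / cos u" "sin u powr p = sin u powr (p - 1) * sin u"
             "cos u powr (p + 1) = cos u powr p * cos u"
      using c s by (simp_all add: powr_diff powr_add)
    have sd: "sin ((p - 1) * u) = sin (p * u) * cos u - cos (p * u) * sin u"
      by (simp add: left_diff_distrib sin_diff)
    have d1: "(h has_real_derivative ((p * sin u powr (p - 1) * cos u - D * (p * sin (p * u))) * cos u powr p
        - (sin u powr p + D * cos (p * u)) * (p * cos u powr (p - 1) * (- sin u)))
        / (cos u powr p * cos u powr p)) (at u)"
      unfolding h_def using c s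
      by (auto intro!: derivative_eq_intros DERIV_fun_powr simp: mult_ac)
    have d2: "((p * sin u powr (p - 1) * cos u - D * (p * sin (p * u))) * cos u powr p
        - (sin u powr p + D * cos (p * u)) * (p * cos u powr (p - 1) * (- sin u)))
        / (cos u powr p * cos u powr p) = p / cos u powr (p + 1) * (sin u powr (p - 1) - D * sin ((p - 1) * u))"
    proof -
      define X where "X = sin u powr (p - 1)"
      define Y where "Y = cos u powr p"
      have Y: "Y > 0" using c by (simp add: Y_def)
      have "((p * X * C - D * (p * A)) * Y - (X * S + D * B) * (p * (Y / C) * (- S))) / (Y * Y)
        = p / (Y * C) * (X * (S * S + C * C) - D * (A * C - B * S))" if "C > 0" for A B C S
        using that Y by (simp add: divide_simps) (simp add: algebra_simps)
      from this[OF c, of "sin (p * u)" "sin u" "cos (p * u)"]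
      have "((p * X * cos u - D * (p * sin (p * u))) * Y
        - (X * sin u + D * cos (p * u)) * (p * (Y / cos u) * (- sin u))) / (Y * Y)
        = p / (Y * cos u) * (X * (sin u * sin u + cos u * cos u) - D * (sin (p * u) * cos u - cos (p * u) * sin u))" .
      thus ?thesis unfolding pw sd X_def[symmetric] Y_def[symmetric] sq by simp
    qed
    show ?thesis using d1 unfolding d2 .
  qed
  have cont: "continuous_on {0..b} h" if "b < pi / 2" for b
    unfolding h_def using that p cpos
    by (intro continuous_on_divide continuous_on_add continuous_on_powr' continuous_intros)
      (auto intro!: sin_ge_zero less_imp_le[OF cpos], force+)
  have main: "h t \<le> h t0"
  proof (cases "t \<le> t0")
    case True
    show ?thesis
    proof (rule DERIV_nonneg_imp_increasing_open[OF True])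
      fix u assume u: "t < u" "u < t0"
      have u': "0 < u" "u < pi / 2" using u t pa by auto
      have "sin t0 powr (p - 1) * sin ((p - 1) * u) \<le> sin u powr (p - 1) * sin ((p - 1) * t0)"
        using p u u' pa by (intro pich_ratio_antimono) auto
      hence "D * sin ((p - 1) * t0) * sin ((p - 1) * u) \<le> sin u powr (p - 1) * sin ((p - 1) * t0)"
        using Deq by simp
      moreover have "0 < sin ((p - 1) * t0)"
        by (rule zero_less_mult_pos[of D]) (use Deq pa(3,6) in \<open>simp_all add: D_def\<close>)
      ultimately have "D * sin ((p - 1) * u) \<le> sin u powr (p - 1)"
        by (metis mult.assoc mult.commute mult_le_cancel_right_pos)
      hence "0 \<le> p / cos u powr (p + 1) * (sin u powr (p - 1) - D * sin ((p - 1) * u))"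
        using p cpos[of u] u' by simp
      thus "\<exists>y. DERIV h u :> y \<and> 0 \<le> y" using der[OF u'] by blast
    next
      show "continuous_on {t..t0} h" using cont[of t0] pa t by (auto elim: continuous_on_subset)
    qed
  next
    case False
    show ?thesis
    proof (rule DERIV_nonpos_imp_decreasing_open[where a = t0 and b = t])
      show "t0 \<le> t" using False by simp
      fix u assume u: "t0 < u" "u < t"
      have u': "0 < u" "u < pi / 2" using u t pa by auto
      have "sin u powr (p - 1) * sin ((p - 1) * t0) \<le> sin t0 powr (p - 1) * sin ((p - 1) * u)"
        using p u u' pa by (intro pich_ratio_antimono) auto
      hence "sin u powr (p - 1) * sin ((p - 1) * t0) \<le> D * sin ((p - 1) * t0) * sin ((p - 1) * u)"
        using Deq by simp
      moreover have "0 < sin ((p - 1) * t0)"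
        by (rule zero_less_mult_pos[of D]) (use Deq pa(3,6) in \<open>simp_all add: D_def\<close>)
      ultimately have "sin u powr (p - 1) \<le> D * sin ((p - 1) * u)"
        by (metis mult.assoc mult.commute mult_le_cancel_right_pos)
      hence "p / cos u powr (p + 1) * (sin u powr (p - 1) - D * sin ((p - 1) * u)) \<le> 0"
        using p cpos[of u] u' by (intro mult_nonneg_nonpos) auto
      thus "\<exists>y. DERIV h u :> y \<and> y \<le> 0" using der[OF u'] by blast
    next
      show "continuous_on {t0..t} h" using cont[of t] pa t by (auto elim: continuous_on_subset)
    qed
  qed
  have "h t0 = pichT p powr p"
  proof -
    have "p * t0 = pi / 2" using p by (simp add: t0_def)
    hence "cos (p * t0) = 0" by (simp only: cos_pi_half)
    thus ?thesis using pa unfolding h_def pichT_def t0_def[symmetric]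
      by (simp add: tan_def powr_divide)
  qed
  with main have "h t \<le> pichT p powr p" by simp
  thus ?thesis using cpos[OF t] unfolding h_def D_def by (simp add: field_simps)
qed

lemma Complex_polar:
  assumes "0 < r"
  obtains t where "-pi/2 < t" "t < pi/2" "r = cmod (Complex r s) * cos t"
    "s = cmod (Complex r s) * sin t" "Arg (Complex r s) = t"
    "\<And>a. Complex r s powr of_real a = of_real (cmod (Complex r s) powr a) * cis (a * t)"
proof -
  define z where "z = Complex r s"
  have z: "z \<noteq> 0" "Re z > 0" using assms by (auto simp: z_def complex_eq_iff)
  have A: "Arg z \<in> {-pi/2<..<pi/2}" using z Re_Ln_pos_lt[of z] Arg_def[of z] z by (auto simp: abs_less_iff Re_Ln_pos_lt)
  have e: "z = rcis (cmod z) (Arg z)" by (simp add: rcis_cmod_Arg)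
  have "Re z = cmod z * cos (Arg z)" "Im z = cmod z * sin (Arg z)"
    by (metis Re_rcis e, metis Im_rcis e)
  moreover have "z powr of_real a = of_real (cmod z powr a) * cis (a * Arg z)" for a
  proof -
    have "z powr of_real a = exp (of_real a * (of_real (ln (cmod z)) + \<i> * of_real (Arg z)))"
      using z by (simp add: powr_def Ln_Arg)
    also have "\<dots> = exp (of_real (a * ln (cmod z))) * exp (\<i> * of_real (a * Arg z))"
      by (simp add: exp_add[symmetric] algebra_simps)
    also have "\<dots> = of_real (exp (a * ln (cmod z))) * cis (a * Arg z)"
      by (simp only: exp_of_real cis_conv_exp)
    also have "\<dots> = of_real (cmod z powr a) * cis (a * Arg z)"
      using z by (simp add: powr_def)
    finally show ?thesis .
  qed
  ultimately show thesis using A by (intro that[of "Arg z"]) (auto simp: z_def)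
qed

text \<open>Both sides are homogeneous of degree \<open>p\<close> in \<open>(r, s)\<close> and even
  in \<open>s\<close>, so only a polar angle in \<open>[0, pi / 2)\<close> matters.\<close>

lemma pichorides:
  fixes p r s :: real
  assumes p: "1 < p" "p \<le> 2" and r: "0 < r"
  shows "\<bar>s\<bar> powr p \<le> pichT p powr p * r powr p - pichD p * Re (Complex r s powr of_real p)"
proof -
  define z where "z = Complex r s"
  obtain t where t: "-pi/2 < t" "t < pi/2" "r = cmod z * cos t" "s = cmod z * sin t"
    and pw: "\<And>a. z powr of_real a = of_real (cmod z powr a) * cis (a * t)"
    using Complex_polar[OF r, of s] unfolding z_def by blast
  have m: "cmod z > 0" using r by (auto simp: z_def complex_eq_iff)
  have abss: "\<bar>s\<bar> = cmod z * sin \<bar>t\<bar>"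
  proof (cases "t \<ge> 0")
    case True
    hence "sin t \<ge> 0" using t by (intro sin_ge_zero) auto
    thus ?thesis using True t(4) m by (metis abs_mult abs_of_nonneg abs_norm_cancel)
  next
    case False
    hence "sin (- t) \<ge> 0" using t by (intro sin_ge_zero) auto
    hence "\<bar>sin t\<bar> = sin \<bar>t\<bar>" using False by auto
    thus ?thesis using t(4) by (metis abs_mult abs_norm_cancel)
  qed
  have rr: "r = cmod z * cos \<bar>t\<bar>" using t by (simp add: abs_if)
  have "sin \<bar>t\<bar> powr p + pichD p * cos (p * \<bar>t\<bar>) \<le> pichT p powr p * cos \<bar>t\<bar> powr p"
    using t by (intro pichorides_angle p) auto
  hence "cmod z powr p * (sin \<bar>t\<bar> powr p + pichD p * cos (p * \<bar>t\<bar>)) \<le> cmod z powr p * (pichT p powr p * cos \<bar>t\<bar> powr p)"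
    by (intro mult_left_mono) auto
  moreover have "0 \<le> sin \<bar>t\<bar>" "0 \<le> cos \<bar>t\<bar>" using t by (auto intro!: sin_ge_zero cos_ge_zero)
  hence "\<bar>s\<bar> powr p = cmod z powr p * sin \<bar>t\<bar> powr p" "r powr p = cmod z powr p * cos \<bar>t\<bar> powr p"
    unfolding abss by (simp add: powr_mult, subst rr, simp add: powr_mult)
  moreover have "Re (z powr of_real p) = cmod z powr p * cos (p * \<bar>t\<bar>)"
    unfolding pw by (simp add: abs_if)
  ultimately show ?thesis unfolding z_def[symmetric] by (simp add: algebra_simps)
qed

subsection \<open>The Bellman function\<close>

text \<open>All that the half-plane argument uses of \<open>F\<close>, free of the exponent. In
  \<open>ell\<close>, \<open>(a, a')\<close> and \<open>(b, b')\<close> stand for the gradients of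
  \<open>u\<close> and \<open>v\<close>: the Hessian form dominates twice the Jacobian.
  \<open>F0\<close> lets missing mass be placed at the origin at no cost and makes \<open>F\<close>
  small of higher than first order there.\<close>

locale bellman =
  fixes F F1 F2 F11 F12 F22 :: "real \<times> real \<Rightarrow> real"
  assumes dF: "\<And>w. (F has_derivative (\<lambda>d. F1 w * fst d + F2 w * snd d)) (at w)"
    and dF1: "\<And>w. (F1 has_derivative (\<lambda>d. F11 w * fst d + F12 w * snd d)) (at w)"
    and dF2: "\<And>w. (F2 has_derivative (\<lambda>d. F12 w * fst d + F22 w * snd d)) (at w)"
    and cF11: "continuous_on UNIV F11" and cF12: "continuous_on UNIV F12"
    and cF22: "continuous_on UNIV F22"
    and ell: "\<And>w a a' b b'. 2 * (a * b' - a' * b) \<le>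
       F11 w * (a\<^sup>2 + a'\<^sup>2) + 2 * F12 w * (a * b + a' * b') + F22 w * (b\<^sup>2 + b'\<^sup>2)"
    and F0: "F (0, 0) = 0" "F1 (0, 0) = 0" "F2 (0, 0) = 0"

section \<open>The smoothed potential and its partial Legendre transform\<close>

text \<open>The parameter \<open>e\<close> replaces \<open>\<bar>x\<bar>\<close> by
  \<open>sqrt (x^2 + e^2)\<close>, which is smooth and keeps the base of the complex power in the
  open right half-plane. It tends to 0 only in the final inequality for finite sums.\<close>

locale potential =
  fixes p e :: real
  assumes p1: "1 < p" and p2: "p \<le> 2" and e0: "0 < e"
begin

definition rad :: "real \<Rightarrow> real" where "rad x = sqrt (x\<^sup>2 + e\<^sup>2)"
definition slope :: "real \<Rightarrow> real" where "slope x = x / rad x"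
definition Z :: "real \<times> real \<Rightarrow> complex" where
  "Z w = of_real (rad (fst w)) + \<i> * of_real (snd w)"
text \<open>Differentiating \<open>M a\<close> or \<open>N a\<close> lowers the exponent to
  \<open>a - 1\<close> and mixes the two by the Cauchy-Riemann equations, so all derivatives stay in
  this family. The potential is \<open>D / p * M p\<close>.\<close>

definition M :: "real \<Rightarrow> real \<times> real \<Rightarrow> real" where "M a w = Re (Z w powr of_real a)"
definition N :: "real \<Rightarrow> real \<times> real \<Rightarrow> real" where "N a w = Im (Z w powr of_real a)"

lemma rad_pos [simp]: "0 < rad x" "rad x \<noteq> 0"
proof -
  show "0 < rad x" unfolding rad_def using e0 by (simp add: add_nonneg_pos)
  thus "rad x \<noteq> 0" by simp
qed

lemma rad_sq: "(rad x)\<^sup>2 = x\<^sup>2 + e\<^sup>2"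
  by (simp add: rad_def)

lemma rad_deriv: "(rad has_real_derivative slope x) (at x)"
proof -
  have "0 < x\<^sup>2 + e\<^sup>2" using e0 by (simp add: add_nonneg_pos)
  thus ?thesis unfolding rad_def[abs_def] slope_def
    by (auto intro!: derivative_eq_intros simp: field_simps)
qed

lemma slope_deriv: "(slope has_real_derivative (e\<^sup>2 / rad x ^ 3)) (at x)"
proof -
  have *: "(slope has_real_derivative (1 * rad x - x * slope x) / (rad x * rad x)) (at x)"
    unfolding slope_def[abs_def] by (rule DERIV_divide) (auto intro!: DERIV_ident rad_deriv[unfolded slope_def])
  have "rad x * rad x = x * x + e * e" using rad_sq[of x] by (simp add: power2_eq_square)
  hence "rad x - x * slope x = e\<^sup>2 / rad x"
    unfolding slope_def by (simp add: field_simps power2_eq_square)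
  hence "(1 * rad x - x * slope x) / (rad x * rad x) = e\<^sup>2 / rad x ^ 3"
    by (simp add: power3_eq_cube)
  with * show ?thesis by simp
qed

lemma Re_Z [simp]: "Re (Z w) = rad (fst w)" and Im_Z [simp]: "Im (Z w) = snd w"
  by (simp_all add: Z_def)

lemma Z_nz [simp]: "Z w \<noteq> 0" "Z w \<notin> \<real>\<^sub>\<le>\<^sub>0"
  by (auto simp: complex_eq_iff complex_nonpos_Reals_iff not_le less_imp_le)

lemma Z_Complex: "Z w = Complex (rad (fst w)) (snd w)"
  by (simp add: complex_eq_iff)

lemma Z_deriv: "(Z has_derivative (\<lambda>d. of_real (slope (fst w) * fst d) + \<i> * of_real (snd d))) (at w)"
proof -
  have "((\<lambda>w. rad (fst w)) has_derivative (\<lambda>d. fst d * slope (fst w))) (at w)"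
    by (rule DERIV_compose_FDERIV[OF rad_deriv]) (auto intro!: derivative_intros)
  thus ?thesis unfolding Z_def[abs_def]
    by (auto intro!: derivative_eq_intros simp: mult.commute)
qed

lemma Zpowr_deriv: "((\<lambda>w. Z w powr of_real a) has_derivative
   (\<lambda>d. (of_real (slope (fst w) * fst d) + \<i> * of_real (snd d)) * (of_real a * Z w powr of_real (a - 1)))) (at w)"
proof -
  have "((\<lambda>z. z powr of_real a) has_field_derivative of_real a * Z w powr (of_real a - 1)) (at (Z w))"
    by (rule has_field_derivative_powr) simp
  hence "((\<lambda>z. z powr of_real a) has_field_derivative of_real a * Z w powr of_real (a - 1)) (at (Z w))"
    by simp
  hence "((\<lambda>z. z powr of_real a) has_derivative (*) (of_real a * Z w powr of_real (a - 1))) (at (Z w))"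
    by (simp add: has_field_derivative_def)
  from has_derivative_compose[OF Z_deriv this] show ?thesis
    by (rule has_derivative_eq_rhs) (simp add: fun_eq_iff mult.commute)
qed

lemma M_deriv: "(M a has_derivative
   (\<lambda>d. a * (M (a - 1) w * slope (fst w)) * fst d + - a * N (a - 1) w * snd d)) (at w)"
proof -
  have "(M a has_derivative (\<lambda>d. Re ((of_real (slope (fst w) * fst d) + \<i> * of_real (snd d)) * (of_real a * Z w powr of_real (a - 1))))) (at w)"
    unfolding M_def[abs_def] using Zpowr_deriv by (rule has_derivative_Re)
  thus ?thesis by (rule has_derivative_eq_rhs) (auto simp: M_def N_def algebra_simps fun_eq_iff)
qed

lemma N_deriv: "(N a has_derivative
   (\<lambda>d. a * (N (a - 1) w * slope (fst w)) * fst d + a * M (a - 1) w * snd d)) (at w)"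
proof -
  have "(N a has_derivative (\<lambda>d. Im ((of_real (slope (fst w) * fst d) + \<i> * of_real (snd d)) * (of_real a * Z w powr of_real (a - 1))))) (at w)"
    unfolding N_def[abs_def] using Zpowr_deriv by (rule has_derivative_Im)
  thus ?thesis by (rule has_derivative_eq_rhs) (auto simp: M_def N_def algebra_simps fun_eq_iff)
qed

lemma cont_MN: "continuous_on UNIV (M a)" "continuous_on UNIV (N a)" "continuous_on UNIV rad" "continuous_on UNIV slope"
  using M_deriv N_deriv rad_deriv slope_deriv
  by (meson has_derivative_continuous continuous_at_imp_continuous_on DERIV_isCont)+

lemma polar:
  obtains t where "-pi/2 < t" "t < pi/2" "rad (fst w) = cmod (Z w) * cos t"
    "snd w = cmod (Z w) * sin t" "0 < cmod (Z w)" "Arg (Z w) = t"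
    "\<And>a. M a w = cmod (Z w) powr a * cos (a * t)" "\<And>a. N a w = cmod (Z w) powr a * sin (a * t)"
proof -
  obtain t where t: "-pi/2 < t" "t < pi/2" "rad (fst w) = cmod (Z w) * cos t"
    "snd w = cmod (Z w) * sin t" "Arg (Z w) = t"
    "\<And>a. Z w powr of_real a = of_real (cmod (Z w) powr a) * cis (a * t)"
    using Complex_polar[of "rad (fst w)" "snd w"] unfolding Z_Complex by auto
  show thesis by (rule that[OF t(1-4) _ t(5)]) (simp_all add: M_def N_def t(6))
qed

text \<open>The argument of \<open>Z w\<close> lies strictly between \<open>- pi / 2\<close> and
  \<open>pi / 2\<close>, so its multiple by \<open>a\<close> has positive cosine. For
  \<open>a = p - 2\<close> this gives strict concavity of the potential in the second
  variable.\<close>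

lemma M_pos: "\<bar>a\<bar> \<le> 1 \<Longrightarrow> 0 < M a w"
proof -
  assume a: "\<bar>a\<bar> \<le> 1"
  obtain t where t: "-pi/2 < t" "t < pi/2" "0 < cmod (Z w)" "M a w = cmod (Z w) powr a * cos (a * t)"
    by (rule polar[of w]) blast
  have "\<bar>a * t\<bar> \<le> 1 * \<bar>t\<bar>" unfolding abs_mult using a by (intro mult_right_mono) auto
  hence "-pi/2 < a * t" "a * t < pi/2" using t by auto
  hence "0 < cos (a * t)" by (intro cos_gt_zero_pi) auto
  thus ?thesis using t by simp
qed

text \<open>Expand \<open>cos (t + (p - 2) * t)\<close>: the product of sines has a definite sign
  because \<open>p - 2\<close> lies between -1 and 0. This inequality is what keeps the potential
  subharmonic after smoothing.\<close>

lemma M_step: "rad (fst w) * M (p - 2) w \<le> M (p - 1) w"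
proof -
  obtain t where t: "-pi/2 < t" "t < pi/2" "rad (fst w) = cmod (Z w) * cos t"
    "snd w = cmod (Z w) * sin t" "0 < cmod (Z w)"
    "\<And>a. M a w = cmod (Z w) powr a * cos (a * t)"
    by (rule polar[of w]) blast
  have "cos ((p - 1) * t) = cos t * cos ((p - 2) * t) - sin t * sin ((p - 2) * t)"
    using cos_add[of t "(p - 2) * t"] by (simp add: algebra_simps)
  moreover have "sin t * sin ((p - 2) * t) \<le> 0"
  proof (cases "t \<ge> 0")
    case True
    have "(2 - p) * t \<le> 1 * t" using True p1 p2 by (intro mult_right_mono) auto
    hence "0 \<le> sin t" "0 \<le> sin ((2 - p) * t)" using True t p1 p2 by (auto intro!: sin_ge_zero)
    moreover have "sin ((p - 2) * t) = - sin ((2 - p) * t)" by (simp flip: sin_minus add: algebra_simps)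
    ultimately show ?thesis by (simp add: mult_nonneg_nonneg)
  next
    case False
    have "(2 - p) * (- t) \<le> 1 * (- t)" using False p1 p2 by (intro mult_right_mono) auto
    moreover have "0 \<le> (2 - p) * (- t)" using False p2 by (intro mult_nonneg_nonneg) auto
    moreover have "- t < pi" using t pi_gt_zero by linarith
    ultimately have "0 \<le> sin (- t)" "0 \<le> sin ((2 - p) * (- t))" using False
      by (intro sin_ge_zero; linarith)+
    moreover have "(p - 2) * t = (2 - p) * (- t)" by (simp add: algebra_simps)
    ultimately show ?thesis by (auto intro!: mult_nonpos_nonpos)
  qed
  ultimately have "cos t * cos ((p - 2) * t) \<le> cos ((p - 1) * t)" by simp
  hence "cmod (Z w) powr (p - 1) * (cos t * cos ((p - 2) * t)) \<le> cmod (Z w) powr (p - 1) * cos ((p - 1) * t)"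
    by (intro mult_left_mono) auto
  moreover have "cmod (Z w) powr (p - 1) = cmod (Z w) * cmod (Z w) powr (p - 2)"
    using t(5) powr_add[of "cmod (Z w)" 1 "p - 2"] by simp
  ultimately show ?thesis unfolding t(3) t(6) by (simp add: mult_ac)
qed

definition D :: real where "D = pichD p"
text \<open>\<open>\<kappa>\<close> and \<open>\<beta>\<close> are the partial derivatives of
  \<open>D * N (p - 1)\<close> in the second and the first variable; \<open>- \<kappa>\<close> is
  the second derivative of the potential in the second variable.\<close>

definition \<kappa> :: "real \<times> real \<Rightarrow> real" where "\<kappa> w = D * (p - 1) * M (p - 2) w"
definition \<beta> :: "real \<times> real \<Rightarrow> real" where "\<beta> w = D * (p - 1) * N (p - 2) w * slope (fst w)"

lemma D_pos [simp]: "0 < D" unfolding D_def using pich_angle[OF p1 p2] by simp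
lemma kappa_pos [simp]: "0 < \<kappa> w" "\<kappa> w \<noteq> 0"
proof -
  show "0 < \<kappa> w" unfolding \<kappa>_def using p1 p2 by (intro mult_pos_pos M_pos) auto
  thus "\<kappa> w \<noteq> 0" by simp
qed

text \<open>The second component is minus the \<open>s\<close>-derivative of the potential, so
  \<open>G (x, s) = (x, y)\<close> says that \<open>s\<close> is a critical point of
  \<open>y * s + D / p * M p (x, s)\<close>.\<close>

definition G :: "real \<times> real \<Rightarrow> real \<times> real" where "G w = (fst w, D * N (p - 1) w)"

lemma G_deriv: "(G has_derivative (\<lambda>d. (fst d, \<beta> w * fst d + \<kappa> w * snd d))) (at w)"
  unfolding G_def[abs_def]
  by (auto intro!: derivative_eq_intros N_deriv simp: \<beta>_def \<kappa>_def algebra_simps fun_eq_iff)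

lemma N_line_deriv: "((\<lambda>s. D * N (p - 1) (x, s)) has_real_derivative \<kappa> (x, s)) (at s)"
proof -
  have *: "((\<lambda>s. (x, s)) has_derivative (\<lambda>d. (0, d))) (at s)" by (auto intro!: derivative_eq_intros)
  have "((\<lambda>s. N (p - 1) (x, s)) has_derivative (\<lambda>d. (p - 1) * M (p - 2) (x, s) * d)) (at s)"
    using has_derivative_compose[OF * N_deriv, of "p - 1"] by simp
  hence "((\<lambda>s. N (p - 1) (x, s)) has_real_derivative (p - 1) * M (p - 2) (x, s)) (at s)"
    by (simp add: has_field_derivative_def)
  thus ?thesis by (auto intro!: derivative_eq_intros simp: \<kappa>_def)
qed

lemma N_line_mono: "s < s' \<Longrightarrow> N (p - 1) (x, s) < N (p - 1) (x, s')"
  using DERIV_pos_imp_increasing[of s s' "\<lambda>s. D * N (p - 1) (x, s)"] N_line_deriv kappa_pos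
  by (metis D_pos mult_less_cancel_left_pos)

lemma N_odd: "N a (x, - s) = - N a (x, s)"
proof -
  have "Z (x, - s) = cnj (Z (x, s))" by (simp add: complex_eq_iff)
  moreover have "cnj (Z (x, s)) powr cnj (of_real a) = cnj (Z (x, s) powr of_real a)"
    using cnj_powr[of "Z (x, s)" "of_real a"] Z_nz(2)[of "(x, s)"]
    by (auto simp: complex_nonpos_Reals_iff)
  ultimately show ?thesis by (simp add: N_def)
qed

text \<open>Where \<open>s \<ge> rad x\<close> the polar angle is at least \<open>pi / 4\<close>, so
  \<open>N (p - 1)\<close> grows at least like \<open>s powr (p - 1)\<close>. Together with oddness
  this yields surjectivity of \<open>G\<close> by intermediate values.\<close>

lemma N_line_large: "\<exists>s. y \<le> D * N (p - 1) (x, s)"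
proof -
  define c where "c = sin ((p - 1) * (pi / 4))"
  have "0 < (p - 1) * (pi / 4)" "(p - 1) * (pi / 4) < pi"
  proof -
    show "0 < (p - 1) * (pi / 4)" using p1 by simp
    have "(p - 1) * (pi / 4) \<le> 1 * (pi / 4)" using p2 by (intro mult_right_mono) auto
    thus "(p - 1) * (pi / 4) < pi" using pi_gt_zero by linarith
  qed
  hence c: "0 < c" unfolding c_def by (intro sin_gt_zero) auto
  have "filterlim (\<lambda>s. D * (s powr (p - 1) * c)) at_top at_top"
    using c p1 D_pos by real_asymp
  hence "eventually (\<lambda>s. y \<le> D * (s powr (p - 1) * c)) at_top" by (simp add: filterlim_at_top)
  moreover have "eventually (\<lambda>s. s \<ge> rad x) at_top" by (rule eventually_ge_at_top)
  ultimately have "eventually (\<lambda>s. y \<le> D * (s powr (p - 1) * c) \<and> s \<ge> rad x) at_top" by (rule eventually_conj)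
  then obtain s where s: "y \<le> D * (s powr (p - 1) * c)" "s \<ge> rad x"
    using eventually_happens by fastforce
  have s0: "s > 0" using s(2) rad_pos(1)[of x] by linarith
  obtain t where t: "-pi/2 < t" "t < pi/2" "rad x = cmod (Z (x, s)) * cos t"
    "s = cmod (Z (x, s)) * sin t" "0 < cmod (Z (x, s))"
    "\<And>a. N a (x, s) = cmod (Z (x, s)) powr a * sin (a * t)"
    by (rule polar[of "(x, s)"]) auto
  have "tan t \<ge> 1"
  proof -
    have "cos t > 0" using t by (intro cos_gt_zero_pi) auto
    moreover have "cos t \<le> sin t" using s(2) t(3,4,5) by (metis mult_le_cancel_left_pos)
    ultimately show ?thesis by (simp add: tan_def)
  qed
  hence t4: "pi / 4 \<le> t"
    using t tan_mono_lt_eq[of t "pi/4"] by (force simp: tan_45 not_less[symmetric])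
  have "0 \<le> t" using t4 pi_gt_zero by linarith
  hence "(p - 1) * t \<le> 1 * t" using p2 by (intro mult_right_mono) auto
  moreover have "0 \<le> (p - 1) * (pi / 4)" "(p - 1) * (pi / 4) \<le> (p - 1) * t"
    using p1 t4 by (auto intro!: mult_left_mono)
  ultimately have "c \<le> sin ((p - 1) * t)" unfolding c_def using t pi_gt_zero
    by (intro sin_monotone_2pi_le) linarith+
  moreover have "s \<le> cmod (Z (x, s))" using abs_Im_le_cmod[of "Z (x, s)"] by simp
  hence "s powr (p - 1) \<le> cmod (Z (x, s)) powr (p - 1)" using s0 p1 by (intro powr_mono2) auto
  ultimately have "s powr (p - 1) * c \<le> N (p - 1) (x, s)"
    unfolding t(6) using c by (intro mult_mono) auto
  hence "D * (s powr (p - 1) * c) \<le> D * N (p - 1) (x, s)"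
    by (rule mult_left_mono) (simp add: less_imp_le)
  thus ?thesis using s(1) order_trans by blast
qed

lemma bij_G: "bij G"
  unfolding bij_def
proof
  show "inj G"
  proof (rule injI)
    fix w w' assume "G w = G w'"
    hence "fst w = fst w'" "D * N (p - 1) w = D * N (p - 1) w'" by (auto simp: G_def)
    hence *: "fst w = fst w'" "N (p - 1) w = N (p - 1) w'" using D_pos by (simp_all del: D_pos)
    hence "snd w = snd w'" using N_line_mono[of "snd w" "snd w'" "fst w"] N_line_mono[of "snd w'" "snd w" "fst w"]
      by (metis linorder_less_linear order_less_irrefl prod.collapse)
    thus "w = w'" using * by (simp add: prod_eq_iff)
  qed
  have "\<exists>s. D * N (p - 1) (x, s) = y" for x y
  proof -
    obtain a where a: "\<bar>y\<bar> \<le> D * N (p - 1) (x, a)" using N_line_large by blast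
    have b: "D * N (p - 1) (x, - a) = - (D * N (p - 1) (x, a))" by (simp add: N_odd)
    have a0: "- a \<le> a"
    proof (rule ccontr)
      assume "\<not> ?thesis"
      hence "N (p - 1) (x, a) < N (p - 1) (x, - a)" by (intro N_line_mono) simp
      hence "D * N (p - 1) (x, a) < D * N (p - 1) (x, - a)" by simp
      thus False using a b by simp
    qed
    have "\<exists>s\<ge>-a. s \<le> a \<and> D * N (p - 1) (x, s) = y"
      using a b a0 by (intro IVT') (auto intro!: DERIV_atLeastAtMost_imp_continuous_on N_line_deriv simp del: D_pos)
    thus ?thesis by blast
  qed
  hence "\<exists>w. G w = z" for z unfolding G_def by (metis fst_conv snd_conv prod.collapse)
  thus "surj G" by (metis surj_def)
qed

definition K :: "real \<times> real \<Rightarrow> real \<times> real" where "K = inv G"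

lemma G_K [simp]: "G (K w) = w" and K_G [simp]: "K (G w) = w"
  using bij_G by (simp_all add: K_def bij_is_surj surj_f_inv_f bij_is_inj)

lemma fst_K [simp]: "fst (K w) = fst w"
  using G_K[of w] unfolding G_def by (metis fst_conv)

lemma snd_K: "D * N (p - 1) (K w) = snd w"
  using G_K[of w] unfolding G_def by (metis snd_conv)

text \<open>Invariance of domain: a continuous bijection of the plane has a continuous
  inverse.\<close>

lemma continuous_K: "continuous_on UNIV K"
proof -
  have "continuous_on (G ` UNIV) K"
    using G_deriv by (intro continuous_on_inverse_open)
      (auto intro!: continuous_at_imp_continuous_on has_derivative_continuous)
  thus ?thesis using bij_G by (simp add: bij_is_surj)
qed

text \<open>The derivative of \<open>G\<close> is lower triangular with diagonal \<open>1\<close>,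
  \<open>\<kappa>\<close>, so its inverse is explicit.\<close>

lemma K_deriv: "(K has_derivative (\<lambda>d. (fst d, - \<beta> (K w) / \<kappa> (K w) * fst d + 1 / \<kappa> (K w) * snd d))) (at w)"
proof (rule has_derivative_inverse_basic[OF G_deriv, where T = UNIV])
  show "bounded_linear (\<lambda>d. (fst d, - \<beta> (K w) / \<kappa> (K w) * fst d + 1 / \<kappa> (K w) * snd d))"
    by (intro bounded_linear_Pair bounded_linear_fst bounded_linear_add bounded_linear_const_mult bounded_linear_snd)
  show "(\<lambda>d. (fst d, - \<beta> (K w) / \<kappa> (K w) * fst d + 1 / \<kappa> (K w) * snd d)) \<circ> (\<lambda>d. (fst d, \<beta> (K w) * fst d + \<kappa> (K w) * snd d)) = id"
    by (auto simp: fun_eq_iff field_simps)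
  show "continuous (at w) K" using continuous_K continuous_on_eq_continuous_at[OF open_UNIV] by blast
qed auto

lemma snd_K_deriv: "((\<lambda>w. snd (K w)) has_derivative
    (\<lambda>d. - \<beta> (K w) / \<kappa> (K w) * fst d + 1 / \<kappa> (K w) * snd d)) (at w)"
  using has_derivative_snd[OF K_deriv[of w]]
  by simp

text \<open>For \<open>w = (x, y)\<close> the point \<^term>\<open>snd (K w)\<close> maximizes the concave function
  \<open>\<lambda>s. y * s + D / p * M p (x, s)\<close>, and \<open>F w\<close> is the maximum, normalized to vanish at the origin.\<close>

definition F :: "real \<times> real \<Rightarrow> real" where
  "F w = snd w * snd (K w) + D / p * M p (K w) - D / p * e powr p"
definition F1 :: "real \<times> real \<Rightarrow> real" where
  "F1 w = D * M (p - 1) (K w) * slope (fst w)"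
definition F2 :: "real \<times> real \<Rightarrow> real" where "F2 w = snd (K w)"
text \<open>The first two terms are the second \<open>x\<close>-derivative of the potential at the
  maximizer; the third comes from the motion of the maximizer with \<open>x\<close>.\<close>

definition F11 :: "real \<times> real \<Rightarrow> real" where
  "F11 w = \<kappa> (K w) * (slope (fst w))\<^sup>2 + D * M (p - 1) (K w) * (e\<^sup>2 / rad (fst w) ^ 3)
     + (\<beta> (K w))\<^sup>2 / \<kappa> (K w)"
definition F12 :: "real \<times> real \<Rightarrow> real" where "F12 w = - \<beta> (K w) / \<kappa> (K w)"
definition F22 :: "real \<times> real \<Rightarrow> real" where "F22 w = 1 / \<kappa> (K w)"

lemma MK_deriv: "((\<lambda>w. M a (K w)) has_derivative
   (\<lambda>d. a * (M (a - 1) (K w) * slope (fst w)) * fst d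
     + - a * N (a - 1) (K w) * (- \<beta> (K w) / \<kappa> (K w) * fst d + 1 / \<kappa> (K w) * snd d))) (at w)"
  using has_derivative_compose[OF K_deriv M_deriv, of a w]
  by (rule has_derivative_eq_rhs) (auto simp: fun_eq_iff field_simps)

text \<open>The envelope theorem: by stationarity the motion of the maximizer does not contribute,
  so \<open>F1\<close> is the \<open>x\<close>-derivative of the potential and \<open>F2\<close> the
  maximizer itself.\<close>

lemma F_deriv: "(F has_derivative (\<lambda>d. F1 w * fst d + F2 w * snd d)) (at w)"
proof -
  have "(F has_derivative (\<lambda>d. snd w * (- \<beta> (K w) / \<kappa> (K w) * fst d + 1 / \<kappa> (K w) * snd d)
     + snd d * snd (K w) + D / p * (p * (M (p - 1) (K w) * slope (fst w)) * fst d
     + - p * N (p - 1) (K w) * (- \<beta> (K w) / \<kappa> (K w) * fst d + 1 / \<kappa> (K w) * snd d)) - 0)) (at w)"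
    unfolding F_def[abs_def]
    by (intro has_derivative_diff has_derivative_add has_derivative_mult has_derivative_mult_right
        has_derivative_snd has_derivative_ident has_derivative_const MK_deriv snd_K_deriv)
  thus ?thesis
  proof (rule has_derivative_eq_rhs, intro ext)
    fix d :: "real \<times> real"
    \<comment> \<open>\<open>t\<close> is the derivative of the maximizer in direction
      \<open>d\<close>; its total coefficient is \<open>snd w - D * N (p - 1) (K w)\<close>, which
      is 0 by \<open>snd_K\<close>.\<close>
    define t where "t = - \<beta> (K w) / \<kappa> (K w) * fst d + 1 / \<kappa> (K w) * snd d"
    show "snd w * (- \<beta> (K w) / \<kappa> (K w) * fst d + 1 / \<kappa> (K w) * snd d)
     + snd d * snd (K w) + D / p * (p * (M (p - 1) (K w) * slope (fst w)) * fst d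
     + - p * N (p - 1) (K w) * (- \<beta> (K w) / \<kappa> (K w) * fst d + 1 / \<kappa> (K w) * snd d)) - 0
     = F1 w * fst d + F2 w * snd d"
      unfolding t_def[symmetric] F1_def F2_def using p1 by (simp add: snd_K[symmetric] field_simps)
  qed
qed

lemma slope_fst_deriv: "((\<lambda>w. slope (fst w)) has_derivative (\<lambda>d. fst d * (e\<^sup>2 / rad (fst w) ^ 3))) (at w)"
  by (rule DERIV_compose_FDERIV[OF slope_deriv]) (auto intro!: derivative_intros)

lemma F1_deriv: "(F1 has_derivative (\<lambda>d. F11 w * fst d + F12 w * snd d)) (at w)"
proof -
  have "(F1 has_derivative (\<lambda>d. D * ((p - 1) * (M (p - 1 - 1) (K w) * slope (fst w)) * fst d
     + - (p - 1) * N (p - 1 - 1) (K w) * (- \<beta> (K w) / \<kappa> (K w) * fst d + 1 / \<kappa> (K w) * snd d)) * slope (fst w)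
     + D * M (p - 1) (K w) * (fst d * (e\<^sup>2 / rad (fst w) ^ 3)))) (at w)"
    unfolding F1_def[abs_def]
    by (rule has_derivative_eq_rhs, rule has_derivative_mult[OF has_derivative_mult_right[OF MK_deriv] slope_fst_deriv])
      (simp add: fun_eq_iff)
  thus ?thesis
  proof (rule has_derivative_eq_rhs, intro ext)
    fix d :: "real \<times> real"
    have b: "\<beta> (K w) = D * (p - 1) * N (p - 2) (K w) * slope (fst w)" by (simp add: \<beta>_def)
    have k: "\<kappa> (K w) = D * (p - 1) * M (p - 2) (K w)" by (simp add: \<kappa>_def)
    have pp: "p - 1 - 1 = p - 2" by simp
    have "D * ((p - 1) * (m * sl) * x + - (p - 1) * n * (- b / k * x + 1 / k * y)) * sl + c * (x * ee)
        = (k * sl\<^sup>2 + c * ee + b\<^sup>2 / k) * x + - b / k * y"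
      if "b = D * (p - 1) * n * sl" "k = D * (p - 1) * m" "k \<noteq> 0" for m n sl x y b k c ee
    proof -
      have "D * ((p - 1) * (m * sl) * x + - (p - 1) * n * t) * sl
         = (D * (p - 1) * m) * sl\<^sup>2 * x - (D * (p - 1) * n * sl) * t" for t
        by (simp add: algebra_simps power2_eq_square)
      hence "D * ((p - 1) * (m * sl) * x + - (p - 1) * n * (- b / k * x + 1 / k * y)) * sl
         = (D * (p - 1) * m) * sl\<^sup>2 * x - (D * (p - 1) * n * sl) * (- b / k * x + 1 / k * y)" .
      also have "\<dots> = k * sl\<^sup>2 * x - b * (- b / k * x + 1 / k * y)" using that by simp
      finally show ?thesis using that(3) by (simp add: algebra_simps power2_eq_square)
    qed
    from this[OF b k kappa_pos(2)]
    show "D * ((p - 1) * (M (p - 1 - 1) (K w) * slope (fst w)) * fst d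
     + - (p - 1) * N (p - 1 - 1) (K w) * (- \<beta> (K w) / \<kappa> (K w) * fst d + 1 / \<kappa> (K w) * snd d)) * slope (fst w)
     + D * M (p - 1) (K w) * (fst d * (e\<^sup>2 / rad (fst w) ^ 3)) = F11 w * fst d + F12 w * snd d"
      unfolding F11_def F12_def pp .
  qed
qed

lemma F2_deriv: "(F2 has_derivative (\<lambda>d. F12 w * fst d + F22 w * snd d)) (at w)"
  unfolding F2_def[abs_def] F12_def F22_def by (rule snd_K_deriv)

lemma cont_MNK [continuous_intros]: "continuous_on UNIV (\<lambda>w. M a (K w))" "continuous_on UNIV (\<lambda>w. N a (K w))"
  "continuous_on UNIV (\<lambda>w::real\<times>real. slope (fst w))" "continuous_on UNIV (\<lambda>w::real\<times>real. rad (fst w))"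
  using continuous_on_compose2[OF cont_MN(1) continuous_K] continuous_on_compose2[OF cont_MN(2) continuous_K]
    continuous_on_compose2[OF cont_MN(3) continuous_on_fst[OF continuous_on_id]]
    continuous_on_compose2[OF cont_MN(4) continuous_on_fst[OF continuous_on_id]]
  by simp_all

lemma kappa_beta_K: "\<kappa> (K w) = D * (p - 1) * M (p - 2) (K w)"
  "\<beta> (K w) = D * (p - 1) * N (p - 2) (K w) * slope (fst w)"
  by (simp_all add: \<kappa>_def \<beta>_def)

lemma cont_F: "continuous_on UNIV F11" "continuous_on UNIV F12" "continuous_on UNIV F22"
proof -
  have k: "continuous_on UNIV (\<lambda>w. \<kappa> (K w))" "continuous_on UNIV (\<lambda>w. \<beta> (K w))"
    unfolding kappa_beta_K by (intro continuous_on_mult continuous_on_const cont_MNK)+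
  show "continuous_on UNIV F11" "continuous_on UNIV F12" "continuous_on UNIV F22"
    unfolding F11_def[abs_def] F12_def[abs_def] F22_def[abs_def]
    by (intro continuous_on_mult continuous_on_const cont_MNK continuous_on_add continuous_on_divide
        continuous_on_power continuous_on_minus k; simp)+
qed

text \<open>The form is at least \<open>k\<close> times the squared first gradient plus
  \<open>1 / k\<close> times the square of the second gradient sheared by \<open>- t\<close> times
  the first. A shear leaves the determinant of the two gradients unchanged, and the coefficients
  have product 1, so completing squares gives the factor 2.\<close>

lemma F_ell: "2 * (a * b' - a' * b) \<le>
       F11 w * (a\<^sup>2 + a'\<^sup>2) + 2 * F12 w * (a * b + a' * b') + F22 w * (b\<^sup>2 + b'\<^sup>2)"
proof -
  define k where "k = \<kappa> (K w)"
  define t where "t = \<beta> (K w)"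
  have k: "k > 0" by (simp add: k_def)
  \<comment> \<open>Subharmonicity of the smoothed potential: its second \<open>x\<close>-derivative
    is at least minus its second \<open>s\<close>-derivative.\<close>
  have "k \<le> \<kappa> (K w) * (slope (fst w))\<^sup>2 + D * M (p - 1) (K w) * (e\<^sup>2 / rad (fst w) ^ 3)"
  proof -
    define r where "r = rad (fst w)"
    have r: "r > 0" by (simp add: r_def)
    have s: "(slope (fst w))\<^sup>2 = 1 - e\<^sup>2 / r\<^sup>2"
    proof -
      have "(fst w)\<^sup>2 = r\<^sup>2 - e\<^sup>2" using rad_sq[of "fst w"] by (simp add: r_def)
      thus ?thesis unfolding slope_def r_def[symmetric] power_divide using r by (simp add: field_simps)
    qed
    have "(p - 1) * (r * M (p - 2) (K w)) \<le> 1 * M (p - 1) (K w)"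
    proof (rule mult_mono)
      show "r * M (p - 2) (K w) \<le> M (p - 1) (K w)" using M_step[of "K w"] by (simp add: r_def)
      show "0 \<le> r * M (p - 2) (K w)" using M_pos[of "p - 2" "K w"] r p1 p2 by simp
    qed (use p2 in auto)
    hence "D * (e\<^sup>2 / r ^ 3) * ((p - 1) * (r * M (p - 2) (K w))) \<le> D * (e\<^sup>2 / r ^ 3) * (1 * M (p - 1) (K w))"
      using r by (intro mult_left_mono mult_nonneg_nonneg) (auto simp: less_imp_le)
    moreover have "D * (e\<^sup>2 / r ^ 3) * ((p - 1) * (r * M (p - 2) (K w))) = k * (e\<^sup>2 / r\<^sup>2)"
      unfolding k_def \<kappa>_def using r by (simp add: field_simps power2_eq_square power3_eq_cube)
    ultimately show ?thesis unfolding s r_def[symmetric] k_def[symmetric] by (simp add: algebra_simps)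
  qed
  hence F11: "k + t\<^sup>2 / k \<le> F11 w" unfolding F11_def k_def t_def by simp
  have "2 * (a * b' - a' * b) = 2 * (a * (b' - t * a') - a' * (b - t * a))" by (simp add: algebra_simps)
  also have "\<dots> \<le> k * (a\<^sup>2 + a'\<^sup>2) + ((b - t * a)\<^sup>2 + (b' - t * a')\<^sup>2) / k"
  proof -
    have "0 \<le> (k * a - (b' - t * a'))\<^sup>2 + (k * a' + (b - t * a))\<^sup>2" by simp
    also have "\<dots> = k * (k * (a\<^sup>2 + a'\<^sup>2) + ((b - t * a)\<^sup>2 + (b' - t * a')\<^sup>2) / k
      - 2 * (a * (b' - t * a') - a' * (b - t * a)))"
      using k by (simp add: power2_eq_square field_simps)
    finally show ?thesis using k by (simp add: zero_le_mult_iff)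
  qed
  also have "\<dots> = (k + t\<^sup>2 / k) * (a\<^sup>2 + a'\<^sup>2) + 2 * (- t / k) * (a * b + a' * b') + 1 / k * (b\<^sup>2 + b'\<^sup>2)"
    using k by (simp add: power2_eq_square field_simps)
  also have "\<dots> \<le> F11 w * (a\<^sup>2 + a'\<^sup>2) + 2 * (- t / k) * (a * b + a' * b') + 1 / k * (b\<^sup>2 + b'\<^sup>2)"
    using F11 by (intro add_right_mono mult_right_mono) auto
  finally show ?thesis unfolding F12_def F22_def t_def k_def .
qed

lemma F_zero: "F (0, 0) = 0" "F1 (0, 0) = 0" "F2 (0, 0) = 0"
proof -
  have Z0: "Z (0, 0) = of_real e" using e0 by (simp add: Z_def rad_def)
  have pw: "of_real e powr of_real a = complex_of_real (e powr a)" for a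
    using e0 by (simp add: powr_of_real)
  have "N a (0, 0) = 0" for a unfolding N_def Z0 pw by simp
  hence "G (0, 0) = (0, 0)" by (simp add: G_def)
  hence K0: "K (0, 0) = (0, 0)" by (metis K_G)
  show "F (0, 0) = 0" by (simp add: F_def K0 M_def Z0 pw)
  show "F1 (0, 0) = 0" by (simp add: F1_def K0 slope_def)
  show "F2 (0, 0) = 0" by (simp add: F2_def K0)
qed

sublocale bellman F F1 F2 F11 F12 F22
  by unfold_locales (fact F_deriv F1_deriv F2_deriv cont_F F_ell F_zero)+

text \<open>At the maximizer \<open>s\<close>, Pichorides' inequality bounds the potential with a
  term \<open>- \<bar>s\<bar> powr p / p\<close>, and Young's inequality bounds \<open>y * s\<close>
  with the same term of opposite sign, so \<open>s\<close> disappears.\<close>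

lemma F_le:
  assumes q: "1 / p + 1 / q = 1"
  shows "F w \<le> pichT p powr p * ((fst w)\<^sup>2 + e\<^sup>2) powr (p / 2) / p + \<bar>snd w\<bar> powr q / q"
proof -
  define s where "s = snd (K w)"
  define r where "r = rad (fst w)"
  have "0 < 1 / p" "1 / p < 1" using p1 by simp_all
  hence "0 < 1 / q" "1 / q < 1" using q by linarith+
  hence q1: "1 < q" by simp
  have "K w = (fst w, s)" by (simp add: s_def prod_eq_iff)
  hence "M p (K w) = Re (Complex r s powr of_real p)" by (simp add: M_def Z_Complex r_def)
  hence 1: "D * M p (K w) \<le> pichT p powr p * r powr p - \<bar>s\<bar> powr p"
    using pichorides[OF p1 p2, of r s] by (simp add: D_def r_def)
  have 2: "snd w * s \<le> \<bar>s\<bar> powr p / p + \<bar>snd w\<bar> powr q / q"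
  proof -
    have "snd w * s \<le> \<bar>s\<bar> * \<bar>snd w\<bar>" by (metis abs_ge_self abs_mult mult.commute)
    also have "\<dots> \<le> \<bar>s\<bar> powr p / p + \<bar>snd w\<bar> powr q / q"
      using Youngs_inequality[of p q "\<bar>s\<bar>" "\<bar>snd w\<bar>"] p1 q1 q by simp
    finally show ?thesis .
  qed
  have 3: "0 \<le> D / p * e powr p" using p1 less_imp_le[OF D_pos]
    by (intro mult_nonneg_nonneg divide_nonneg_nonneg) auto
  have "D / p * M p (K w) = (D * M p (K w)) / p" by simp
  also have "\<dots> \<le> (pichT p powr p * r powr p - \<bar>s\<bar> powr p) / p"
    using 1 p1 by (intro divide_right_mono) auto
  finally have "F w \<le> pichT p powr p * r powr p / p + \<bar>snd w\<bar> powr q / q"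
    unfolding F_def s_def[symmetric] using 2 3 by (simp add: diff_divide_distrib)
  moreover have "r powr p = ((fst w)\<^sup>2 + e\<^sup>2) powr (p / 2)"
    unfolding r_def rad_def using e0 by (subst powr_half_sqrt[symmetric]) (auto simp: powr_powr)
  ultimately show ?thesis by simp
qed

end

section \<open>Convexity of the Bellman function and the chain rule along quotients\<close>

context bellman
begin

lemma cont: "continuous_on UNIV F" "continuous_on UNIV F1" "continuous_on UNIV F2"
  using dF dF1 dF2 by (meson has_derivative_continuous continuous_at_imp_continuous_on)+

lemma curve_deriv:
  assumes "(G has_derivative (\<lambda>d. G1 * fst d + G2 * snd d)) (at (f x, g x))"
    and "(f has_real_derivative f') (at x)" "(g has_real_derivative g') (at x)"
  shows "((\<lambda>x. G (f x, g x)) has_real_derivative G1 * f' + G2 * g') (at x)"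
proof -
  have "((\<lambda>x. (f x, g x)) has_derivative (\<lambda>d. (f' * d, g' * d))) (at x)"
    using assms(2,3) unfolding has_field_derivative_def by (rule has_derivative_Pair)
  from has_derivative_compose[OF this assms(1)] show ?thesis
    unfolding has_field_derivative_def by (rule has_derivative_eq_rhs) (simp add: fun_eq_iff algebra_simps)
qed

text \<open>\<open>ell\<close> with \<open>a' = b' = 0\<close> says that the Hessian is positive
  semidefinite, so \<open>F\<close> is convex along segments.\<close>

lemma tangent: "F w + F1 w * (fst w' - fst w) + F2 w * (snd w' - snd w) \<le> F w'"
proof -
  define a where "a = fst w' - fst w"
  define b where "b = snd w' - snd w"
  define c where "c t = (fst w + t * a, snd w + t * b)" for t
  have "(F1 (c 0) * a + F2 (c 0) * b) * (1 - 0) \<le> F (c 1) - F (c 0)"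
  proof (rule f''_imp_f'[of UNIV "\<lambda>t. F (c t)" "\<lambda>t. F1 (c t) * a + F2 (c t) * b"
        "\<lambda>t. (F11 (c t) * a + F12 (c t) * b) * a + (F12 (c t) * a + F22 (c t) * b) * b"])
    fix t :: real
    have d: "((\<lambda>t. fst w + t * a) has_real_derivative a) (at t)" "((\<lambda>t. snd w + t * b) has_real_derivative b) (at t)"
      by (auto intro!: derivative_eq_intros)
    show "((\<lambda>t. F (c t)) has_real_derivative F1 (c t) * a + F2 (c t) * b) (at t)"
      unfolding c_def by (rule curve_deriv[OF dF d])
    show "((\<lambda>t. F1 (c t) * a + F2 (c t) * b) has_real_derivative
      (F11 (c t) * a + F12 (c t) * b) * a + (F12 (c t) * a + F22 (c t) * b) * b) (at t)"
      unfolding c_def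
      by (auto intro!: derivative_eq_intros curve_deriv[OF dF1 d] curve_deriv[OF dF2 d])
    show "0 \<le> (F11 (c t) * a + F12 (c t) * b) * a + (F12 (c t) * a + F22 (c t) * b) * b"
      using ell[of a 0 0 b "c t"] ell[where a = a and a' = 0 and b = b and b' = 0 and w = "c t"]
      by (simp add: power2_eq_square algebra_simps)
  qed auto
  thus ?thesis by (simp add: c_def a_def b_def algebra_simps)
qed

lemma F_nonneg: "0 \<le> F w"
  using tangent[of "(0, 0)" w] F0 by simp

text \<open>The tangent inequality at the barycentre; the missing weight \<open>1 - sum t X\<close>
  sits at the origin, where \<open>F\<close> vanishes.\<close>

lemma jensen:
  assumes "finite X" "\<And>n. n \<in> X \<Longrightarrow> 0 \<le> t n" "sum t X \<le> 1"
  shows "F (\<Sum>n\<in>X. t n * a n, \<Sum>n\<in>X. t n * b n) \<le> (\<Sum>n\<in>X. t n * F (a n, b n))"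
proof -
  define w where "w = (\<Sum>n\<in>X. t n * a n, \<Sum>n\<in>X. t n * b n)"
  define l where "l = F1 w * fst w + F2 w * snd w"
  have "F w \<le> l" using tangent[of w "(0, 0)"] F0 by (simp add: l_def)
  hence "(1 - sum t X) * F w \<le> (1 - sum t X) * l" using assms(3) by (intro mult_left_mono) auto
  hence "F w \<le> sum t X * (F w - l) + l" by (simp add: algebra_simps)
  also have "\<dots> = (\<Sum>n\<in>X. t n * (F w + F1 w * (a n - fst w) + F2 w * (b n - snd w)))"
  proof -
    have "(\<Sum>n\<in>X. t n * (c + d * (a n - r) + e * (b n - s)))
      = sum t X * c + d * ((\<Sum>n\<in>X. t n * a n) - sum t X * r) + e * ((\<Sum>n\<in>X. t n * b n) - sum t X * s)"
      for c d e r s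
      by (simp add: sum_distrib_left sum_distrib_right sum.distrib sum_subtractf algebra_simps)
    from this[of "F w" "F1 w" "fst w" "F2 w" "snd w"] show ?thesis
      by (simp add: l_def w_def algebra_simps)
  qed
  also have "\<dots> \<le> (\<Sum>n\<in>X. t n * F (a n, b n))"
    using tangent[of w] assms by (intro sum_mono mult_left_mono) force+
  finally show ?thesis by (simp add: w_def)
qed

lemma W_deriv1:
  fixes h f g :: "real \<Rightarrow> real"
  assumes "(h has_real_derivative h1) (at x)" "(f has_real_derivative f1) (at x)"
    "(g has_real_derivative g1) (at x)" "h x \<noteq> 0"
  defines "u \<equiv> f x / h x" and "v \<equiv> g x / h x"
  shows "((\<lambda>x. h x * F (f x / h x, g x / h x)) has_real_derivative
     h1 * F (u, v) + F1 (u, v) * (f1 - u * h1) + F2 (u, v) * (g1 - v * h1)) (at x)"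
proof -
  have du: "((\<lambda>x. f x / h x) has_real_derivative (f1 - u * h1) / h x) (at x)"
    using assms(4) unfolding u_def
    by (auto intro!: derivative_eq_intros assms(1,2) simp: field_simps)
  have dv: "((\<lambda>x. g x / h x) has_real_derivative (g1 - v * h1) / h x) (at x)"
    using assms(4) unfolding v_def
    by (auto intro!: derivative_eq_intros assms(1,3) simp: field_simps)
  show ?thesis
    by (rule DERIV_cong[OF DERIV_mult[OF assms(1) curve_deriv[OF dF du dv]]])
      (use assms(4) in \<open>simp add: u_def v_def distrib_right\<close>)
qed

text \<open>The terms with \<open>F\<close>, \<open>F1\<close>, \<open>F2\<close> are linear in
  \<open>h2\<close>, \<open>f2\<close>, \<open>g2\<close>. For harmonic functions they cancel when
  both coordinate directions are added, and only the Hessian term survives.\<close>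

lemma W_deriv2:
  fixes h f g h1 f1 g1 :: "real \<Rightarrow> real"
  assumes h: "(h has_real_derivative h1 x) (at x)" "(h1 has_real_derivative h2) (at x)"
    and f: "(f has_real_derivative f1 x) (at x)" "(f1 has_real_derivative f2) (at x)"
    and g: "(g has_real_derivative g1 x) (at x)" "(g1 has_real_derivative g2) (at x)"
    and nz: "h x \<noteq> 0"
  defines "u \<equiv> f x / h x" and "v \<equiv> g x / h x"
  defines "du \<equiv> f1 x - u * h1 x" and "dv \<equiv> g1 x - v * h1 x"
  shows "((\<lambda>x. h1 x * F (f x / h x, g x / h x) + F1 (f x / h x, g x / h x) * (f1 x - f x / h x * h1 x)
       + F2 (f x / h x, g x / h x) * (g1 x - g x / h x * h1 x)) has_real_derivative
     h2 * F (u, v) + F1 (u, v) * (f2 - u * h2) + F2 (u, v) * (g2 - v * h2)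
     + (F11 (u, v) * du\<^sup>2 + 2 * F12 (u, v) * (du * dv) + F22 (u, v) * dv\<^sup>2) / h x) (at x)"
proof -
  have d1: "((\<lambda>x. f x / h x) has_real_derivative du / h x) (at x)"
    using nz unfolding u_def du_def
    by (auto intro!: derivative_eq_intros h f simp: field_simps)
  have d2: "((\<lambda>x. g x / h x) has_real_derivative dv / h x) (at x)"
    using nz unfolding v_def dv_def
    by (auto intro!: derivative_eq_intros h g simp: field_simps)
  note D = DERIV_add[OF DERIV_add[OF DERIV_mult[OF h(2) curve_deriv[OF dF d1 d2]]
       DERIV_mult[OF curve_deriv[OF dF1 d1 d2] DERIV_diff[OF f(2) DERIV_mult[OF d1 h(2)]]]]
       DERIV_mult[OF curve_deriv[OF dF2 d1 d2] DERIV_diff[OF g(2) DERIV_mult[OF d2 h(2)]]]]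
  show ?thesis
    unfolding u_def v_def
    apply (rule DERIV_cong[OF D])
    unfolding u_def[symmetric] v_def[symmetric] du_def[symmetric] dv_def[symmetric]
    using nz by (simp add: field_simps power2_eq_square)
qed

end

text \<open>The Cauchy-Riemann equations; the minus sign in the third rule is what makes imaginary
  parts harmonic.\<close>

lemma Im_line_derivs:
  assumes "(f has_field_derivative f') (at (Complex x y))"
  shows "((\<lambda>t. Im (f (Complex t y))) has_real_derivative Im f') (at x)"
    and "((\<lambda>t. Im (f (Complex x t))) has_real_derivative Re f') (at y)"
    and "((\<lambda>t. Re (f (Complex x t))) has_real_derivative - Im f') (at y)"
proof -
  have c1: "((\<lambda>t. Complex t y) has_derivative (\<lambda>d. of_real d)) (at x)"
    unfolding Complex_eq by (auto intro!: derivative_eq_intros)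
  have c2: "((\<lambda>t. Complex x t) has_derivative (\<lambda>d. \<i> * of_real d)) (at y)"
    unfolding Complex_eq by (auto intro!: derivative_eq_intros)
  have f: "(f has_derivative (*) f') (at (Complex x y))" using assms by (simp add: has_field_derivative_def)
  note 1 = has_derivative_compose[OF c1 f] and 2 = has_derivative_compose[OF c2 f]
  show "((\<lambda>t. Im (f (Complex t y))) has_real_derivative Im f') (at x)"
    using has_derivative_Im[OF 1] unfolding has_field_derivative_def
    by (rule has_derivative_eq_rhs) (simp add: fun_eq_iff)
  show "((\<lambda>t. Im (f (Complex x t))) has_real_derivative Re f') (at y)"
    using has_derivative_Im[OF 2] unfolding has_field_derivative_def
    by (rule has_derivative_eq_rhs) (simp add: fun_eq_iff)
  show "((\<lambda>t. Re (f (Complex x t))) has_real_derivative - Im f') (at y)"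
    using has_derivative_Re[OF 2] unfolding has_field_derivative_def
    by (rule has_derivative_eq_rhs) (simp add: fun_eq_iff)
qed

subsection \<open>The Bellman function along quotients of Poisson sums\<close>

locale bellman_sequences = bellman +
  fixes X :: "int set" and a b :: "int \<Rightarrow> real"
  assumes fin: "finite X"
begin

definition ext :: "(int \<Rightarrow> complex \<Rightarrow> complex) \<Rightarrow> (int \<Rightarrow> real) \<Rightarrow> complex \<Rightarrow> complex" where
  "ext k c z = (\<Sum>n\<in>X. of_real (c n) * k n z)"

lemma ext_deriv: "0 < Im z \<Longrightarrow> (ext pker c has_field_derivative ext pker1 c z) (at z)"
  "0 < Im z \<Longrightarrow> (ext pker1 c has_field_derivative ext pker2 c z) (at z)"
  unfolding ext_def[abs_def]
  by (auto intro!: DERIV_sum DERIV_cmult pker_deriv pker1_deriv)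

lemma Im_ext: "Im (ext k c z) = (\<Sum>n\<in>X. c n * Im (k n z))" "Re (ext k c z) = (\<Sum>n\<in>X. c n * Re (k n z))"
  by (simp_all add: ext_def)

definition h :: "complex \<Rightarrow> real" where "h z = Im (hol z)"
definition quo :: "(int \<Rightarrow> real) \<Rightarrow> complex \<Rightarrow> real" where "quo c z = Im (ext pker c z) / h z"
text \<open>\<open>quo_x\<close> and \<open>quo_y\<close> are \<open>h\<close> times the partial
  derivatives of \<open>quo\<close>, which avoids denominators in the chain rule.\<close>

definition quo_x :: "(int \<Rightarrow> real) \<Rightarrow> complex \<Rightarrow> real" where
  "quo_x c z = Im (ext pker1 c z) - quo c z * Im (hol1 z)"
definition quo_y :: "(int \<Rightarrow> real) \<Rightarrow> complex \<Rightarrow> real" where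
  "quo_y c z = Re (ext pker1 c z) - quo c z * Re (hol1 z)"
definition UV :: "complex \<Rightarrow> real \<times> real" where "UV z = (quo a z, quo b z)"
definition W :: "complex \<Rightarrow> real" where "W z = h z * F (UV z)"
definition Wx :: "complex \<Rightarrow> real" where
  "Wx z = Im (hol1 z) * F (UV z) + F1 (UV z) * quo_x a z + F2 (UV z) * quo_x b z"
definition Wy :: "complex \<Rightarrow> real" where
  "Wy z = Re (hol1 z) * F (UV z) + F1 (UV z) * quo_y a z + F2 (UV z) * quo_y b z"
definition Wxx :: "complex \<Rightarrow> real" where
  "Wxx z = Im (hol2 z) * F (UV z) + F1 (UV z) * (Im (ext pker2 a z) - quo a z * Im (hol2 z))
     + F2 (UV z) * (Im (ext pker2 b z) - quo b z * Im (hol2 z))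
     + (F11 (UV z) * (quo_x a z)\<^sup>2 + 2 * F12 (UV z) * (quo_x a z * quo_x b z) + F22 (UV z) * (quo_x b z)\<^sup>2) / h z"
definition Wyy :: "complex \<Rightarrow> real" where
  "Wyy z = - Im (hol2 z) * F (UV z) + F1 (UV z) * (- Im (ext pker2 a z) - quo a z * - Im (hol2 z))
     + F2 (UV z) * (- Im (ext pker2 b z) - quo b z * - Im (hol2 z))
     + (F11 (UV z) * (quo_y a z)\<^sup>2 + 2 * F12 (UV z) * (quo_y a z * quo_y b z) + F22 (UV z) * (quo_y b z)\<^sup>2) / h z"
text \<open>Each factor \<open>quo_x\<close>, \<open>quo_y\<close> carries one \<open>h\<close>, so
  this is \<open>h\<close> times the Jacobian determinant of \<open>(u, v)\<close>.\<close>

definition jac :: "complex \<Rightarrow> real" where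
  "jac z = (quo_x a z * quo_y b z - quo_y a z * quo_x b z) / h z"

lemma h_pos: "0 < Im z \<Longrightarrow> 0 < h z" unfolding h_def by (rule Im_hol_bounds)

lemma
  assumes "0 < y"
  shows Wx_deriv: "((\<lambda>t. W (Complex t y)) has_real_derivative Wx (Complex x y)) (at x)"
    and Wxx_deriv: "((\<lambda>t. Wx (Complex t y)) has_real_derivative Wxx (Complex x y)) (at x)"
    and Wy_deriv: "((\<lambda>t. W (Complex x t)) has_real_derivative Wy (Complex x y)) (at y)"
    and Wyy_deriv: "((\<lambda>t. Wy (Complex x t)) has_real_derivative Wyy (Complex x y)) (at y)"
proof -
  define z where "z = Complex x y"
  have z: "0 < Im z" using assms by (simp add: z_def)
  note d1 = Im_line_derivs[OF hol_deriv[OF z, unfolded z_def]]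
    and d2 = Im_line_derivs[OF hol1_deriv[OF z, unfolded z_def]]
    and e1 = Im_line_derivs[OF ext_deriv(1)[OF z, unfolded z_def]]
    and e2 = Im_line_derivs[OF ext_deriv(2)[OF z, unfolded z_def]]
  have nz: "Im (hol (Complex x y)) \<noteq> 0" using h_pos[OF z] by (simp add: z_def h_def)
  note defs = W_def Wx_def Wxx_def Wy_def Wyy_def UV_def quo_x_def quo_y_def quo_def h_def
  show "((\<lambda>t. W (Complex t y)) has_real_derivative Wx (Complex x y)) (at x)"
    using W_deriv1[OF d1(1) e1(1) e1(1) nz] unfolding defs .
  show "((\<lambda>t. Wx (Complex t y)) has_real_derivative Wxx (Complex x y)) (at x)"
    using W_deriv2[OF d1(1) d2(1) e1(1) e2(1) e1(1) e2(1) nz] unfolding defs .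
  show "((\<lambda>t. W (Complex x t)) has_real_derivative Wy (Complex x y)) (at y)"
    using W_deriv1[OF d1(2) e1(2) e1(2) nz] unfolding defs .
  show "((\<lambda>t. Wy (Complex x t)) has_real_derivative Wyy (Complex x y)) (at y)"
    using W_deriv2[OF d1(2) d2(3) e1(2) e2(3) e1(2) e2(3) nz] unfolding defs .
qed

text \<open>The terms with \<open>hol2\<close> and \<open>pker2\<close> enter \<open>Wxx\<close> and
  \<open>Wyy\<close> with opposite signs; what remains is the Hessian form of \<open>ell\<close>
  divided by \<open>h\<close>.\<close>

lemma laplacian_ge:
  assumes "0 < Im z" shows "2 * jac z \<le> Wxx z + Wyy z"
proof -
  define w where "w = UV z"
  have "Wxx z + Wyy z = (F11 w * ((quo_x a z)\<^sup>2 + (quo_y a z)\<^sup>2)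
     + 2 * F12 w * (quo_x a z * quo_x b z + quo_y a z * quo_y b z)
     + F22 w * ((quo_x b z)\<^sup>2 + (quo_y b z)\<^sup>2)) / h z"
    unfolding Wxx_def Wyy_def w_def[symmetric] by (simp add: algebra_simps add_divide_distrib)
  moreover have "2 * jac z \<le> \<dots>"
    unfolding jac_def times_divide_eq_right using ell h_pos[OF assms] by (intro divide_right_mono) auto
  ultimately show ?thesis by simp
qed

abbreviation uhp :: "complex set" where "uhp \<equiv> {z. 0 < Im z}"

lemma cont_hol: "continuous_on uhp hol" "continuous_on uhp hol1" "continuous_on uhp hol2"
proof -
  show "continuous_on uhp hol" "continuous_on uhp hol1"
    using hol_deriv hol1_deriv by (auto intro!: continuous_at_imp_continuous_on DERIV_isCont)
  have "continuous_on uhp qexp"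
    using qexp_deriv by (auto intro!: continuous_at_imp_continuous_on DERIV_isCont)
  thus "continuous_on uhp hol2" unfolding hol2_def[abs_def]
    by (intro continuous_on_divide continuous_on_mult continuous_on_const continuous_on_power
        continuous_on_add continuous_on_diff) auto
qed

lemma cont_ext: "continuous_on uhp (ext pker c)" "continuous_on uhp (ext pker1 c)" "continuous_on uhp (ext pker2 c)"
proof -
  show "continuous_on uhp (ext pker c)" "continuous_on uhp (ext pker1 c)"
    using ext_deriv by (auto intro!: continuous_at_imp_continuous_on DERIV_isCont)
  show "continuous_on uhp (ext pker2 c)" unfolding ext_def[abs_def] pker2_def
    by (intro continuous_on_divide continuous_on_mult continuous_on_const continuous_on_power
        continuous_on_sum continuous_on_diff continuous_on_id) auto
qed

lemma cont_quo: "continuous_on uhp h" "continuous_on uhp (quo c)" "continuous_on uhp (quo_x c)" "continuous_on uhp (quo_y c)"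
proof -
  show h: "continuous_on uhp h" unfolding h_def[abs_def] by (intro continuous_intros cont_hol)
  show q: "continuous_on uhp (quo c)" unfolding quo_def[abs_def]
    by (intro continuous_intros cont_ext h) (auto dest: h_pos)
  show "continuous_on uhp (quo_x c)" "continuous_on uhp (quo_y c)"
    unfolding quo_x_def[abs_def] quo_y_def[abs_def]
    by (intro continuous_intros cont_ext cont_hol q)+
qed

lemma cont_UV: "continuous_on uhp UV"
  unfolding UV_def[abs_def] by (intro continuous_intros cont_quo)

lemma cont_comp_UV: "continuous_on UNIV G \<Longrightarrow> continuous_on uhp (\<lambda>z. G (UV z))"
  by (rule continuous_on_compose2[OF _ cont_UV]) auto

lemma cont_W: "continuous_on uhp W" "continuous_on uhp Wx" "continuous_on uhp Wy"
  "continuous_on uhp Wxx" "continuous_on uhp Wyy" "continuous_on uhp jac"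
  unfolding W_def[abs_def] Wx_def[abs_def] Wy_def[abs_def] Wxx_def[abs_def] Wyy_def[abs_def] jac_def[abs_def]
  by (intro continuous_on_mult continuous_on_add continuous_on_diff continuous_on_divide continuous_on_power
      continuous_on_minus continuous_on_const continuous_on_Im continuous_on_Re
      cont_ext cont_hol cont_quo cont_comp_UV cont cF11 cF12 cF22; auto dest: h_pos)+

lemma cont_line: "continuous_on uhp G \<Longrightarrow> 0 < y \<Longrightarrow> continuous_on S (\<lambda>x. G (Complex x y))"
  by (rule continuous_on_compose2[of uhp G]) (auto intro!: continuous_on_Complex continuous_on_id continuous_on_const)

lemma cont_plane: "continuous_on uhp G \<Longrightarrow> continuous_on ({0<..} \<times> S) (\<lambda>(y, x). G (Complex x y))"
  unfolding case_prod_unfold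
  by (rule continuous_on_compose2[of uhp G])
    (auto intro!: continuous_on_Complex continuous_on_fst continuous_on_snd continuous_on_id)

definition mass :: "nat \<Rightarrow> real \<Rightarrow> real" where
  "mass N y = integral {- real N..real N} (\<lambda>x. W (Complex x y))"

lemma integrable_line: "continuous_on uhp G \<Longrightarrow> 0 < y \<Longrightarrow> (\<lambda>x. G (Complex x y)) integrable_on {c..d}"
  for G :: "complex \<Rightarrow> real"
  by (rule integrable_continuous_real, rule cont_line)

lemma line_integral_deriv:
  fixes G G' :: "complex \<Rightarrow> real"
  assumes "continuous_on uhp G" "continuous_on uhp G'" "0 < y"
    and "\<And>x y. 0 < y \<Longrightarrow> ((\<lambda>t. G (Complex x t)) has_real_derivative G' (Complex x y)) (at y)"
  shows "((\<lambda>y. integral {c..d} (\<lambda>x. G (Complex x y))) has_real_derivative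
      integral {c..d} (\<lambda>x. G' (Complex x y))) (at y)"
proof -
  have "((\<lambda>y. integral (cbox c d) (\<lambda>x. G (Complex x y))) has_real_derivative
      integral (cbox c d) (\<lambda>x. G' (Complex x y))) (at y within {0<..})"
  proof (rule leibniz_rule_field_derivative)
    show "continuous_on ({0<..} \<times> cbox c d) (\<lambda>(y, x). G' (Complex x y))" by (rule cont_plane[OF assms(2)])
  qed (use assms in \<open>auto intro: has_field_derivative_at_within integrable_line\<close>)
  moreover have "at y within {0<..} = at y" using assms(3) by (intro at_within_open) auto
  ultimately show ?thesis by simp
qed

lemma line_integral_cont:
  fixes G :: "complex \<Rightarrow> real"
  assumes "continuous_on uhp G"
  shows "continuous_on {0<..} (\<lambda>y. integral {c..d} (\<lambda>x. G (Complex x y)))"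
  using integral_continuous_on_param[of "{0<..}" c d "\<lambda>y x. G (Complex x y)"] cont_plane[OF assms, of "cbox c d"]
  by simp

lemma mass_deriv:
  assumes "0 < y"
  shows "(mass N has_real_derivative integral {- real N..real N} (\<lambda>x. Wy (Complex x y))) (at y)"
    and "((\<lambda>y. integral {- real N..real N} (\<lambda>x. Wy (Complex x y))) has_real_derivative
       integral {- real N..real N} (\<lambda>x. Wyy (Complex x y))) (at y)"
  unfolding mass_def[abs_def]
  using line_integral_deriv[OF cont_W(1,3) assms Wy_deriv] line_integral_deriv[OF cont_W(3,5) assms Wyy_deriv]
  by simp_all

text \<open>Integrate \<open>laplacian_ge\<close> over the segment: \<open>Wxx\<close> contributes
  only the end values of \<open>Wx\<close>.\<close>

lemma mass_deriv2_ge: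
  assumes "0 < y"
  shows "integral {- real N..real N} (\<lambda>x. 2 * jac (Complex x y)) - (Wx (Complex (real N) y) - Wx (Complex (- real N) y))
     \<le> integral {- real N..real N} (\<lambda>x. Wyy (Complex x y))"
proof -
  have "((\<lambda>x. Wxx (Complex x y)) has_integral (Wx (Complex (real N) y) - Wx (Complex (- real N) y))) {- real N..real N}"
    using assms by (intro fundamental_theorem_of_calculus)
      (auto simp: has_real_derivative_iff_has_vector_derivative[symmetric] intro!: has_field_derivative_at_within Wxx_deriv)
  hence xx: "integral {- real N..real N} (\<lambda>x. Wxx (Complex x y)) = Wx (Complex (real N) y) - Wx (Complex (- real N) y)"
    by (simp add: integral_unique)
  have "integral {- real N..real N} (\<lambda>x. 2 * jac (Complex x y))
     \<le> integral {- real N..real N} (\<lambda>x. Wxx (Complex x y) + Wyy (Complex x y))"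
    using integrable_line[OF continuous_on_mult[OF continuous_on_const cont_W(6)] assms, of 2]
      integrable_line[OF continuous_on_add[OF cont_W(4,5)] assms] assms
    by (intro integral_le) (auto intro!: laplacian_ge)
  also have "\<dots> = integral {- real N..real N} (\<lambda>x. Wxx (Complex x y)) + integral {- real N..real N} (\<lambda>x. Wyy (Complex x y))"
    by (rule Henstock_Kurzweil_Integration.integral_add[OF integrable_line[OF cont_W(4) assms] integrable_line[OF cont_W(5) assms]])
  finally show ?thesis unfolding xx by simp
qed

end

section \<open>Bounds on the mass, its decay, and the boundary terms\<close>

lemma Im_pker_integral_le:
  assumes "0 < y"
  shows "integral {- real N..real N} (\<lambda>x. Im (pker n (Complex x y))) \<le> 1"
    and "(\<lambda>x. Im (pker n (Complex x y))) integrable_on {c..d}"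
proof -
  have d: "((\<lambda>x. arctan ((x - n) / y) / pi) has_real_derivative Im (pker n (Complex x y))) (at x)" for x
  proof -
    have "1 + ((x - n) / y)\<^sup>2 = ((x - n)\<^sup>2 + y\<^sup>2) / y\<^sup>2" using assms by (simp add: power_divide field_simps)
    moreover have "(x - n)\<^sup>2 + y\<^sup>2 > 0" using assms by (simp add: add_nonneg_pos)
    ultimately have "inverse (1 + ((x - n) / y)\<^sup>2) * (1 / y) / pi = Im (pker n (Complex x y))"
      using assms unfolding Im_pker by (simp add: field_simps power2_eq_square)
    moreover have "((\<lambda>x. arctan ((x - n) / y) / pi) has_real_derivative inverse (1 + ((x - n) / y)\<^sup>2) * (1 / y) / pi) (at x)"
      using assms by (auto intro!: derivative_eq_intros)
    ultimately show ?thesis by simp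
  qed
  have "((\<lambda>x. Im (pker n (Complex x y))) has_integral
     (arctan ((real N - n) / y) / pi - arctan ((- real N - n) / y) / pi)) {- real N..real N}"
    by (intro fundamental_theorem_of_calculus)
      (auto simp: has_real_derivative_iff_has_vector_derivative[symmetric] intro!: has_field_derivative_at_within d)
  moreover have "arctan ((real N - n) / y) / pi - arctan ((- real N - n) / y) / pi \<le> 1"
  proof -
    have "arctan ((real N - n) / y) - arctan ((- real N - n) / y) \<le> pi"
      using arctan_bounded[of "(real N - n) / y"] arctan_bounded[of "(- real N - n) / y"] by linarith
    thus ?thesis by (simp add: diff_divide_distrib[symmetric])
  qed
  ultimately show "integral {- real N..real N} (\<lambda>x. Im (pker n (Complex x y))) \<le> 1"
    by (simp add: integral_unique)
  show "(\<lambda>x. Im (pker n (Complex x y))) integrable_on {c..d}"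
  proof (cases "c \<le> d")
    case True
    have "((\<lambda>x. Im (pker n (Complex x y))) has_integral
     (arctan ((d - n) / y) / pi - arctan ((c - n) / y) / pi)) {c..d}"
    by (intro fundamental_theorem_of_calculus)
      (auto simp: True has_real_derivative_iff_has_vector_derivative[symmetric] intro!: has_field_derivative_at_within d)
    thus ?thesis by blast
  qed auto
qed

lemma Im_pker_le: "0 < y \<Longrightarrow> Im (pker n (Complex x y)) \<le> 1 / (pi * y)"
proof -
  assume y: "0 < y"
  have "Im (pker n (Complex x y)) \<le> y / (pi * y\<^sup>2)"
    unfolding Im_pker complex.sel using y
    by (intro divide_left_mono mult_left_mono mult_pos_pos) (auto intro!: add_nonneg_pos)
  also have "\<dots> = 1 / (pi * y)" using y by (simp add: power2_eq_square)
  finally show ?thesis .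
qed

lemma norm_pker1: "0 < Im z \<Longrightarrow> norm (pker1 n z) = Im (pker n z) / Im z"
  by (simp add: pker1_def Im_pker norm_divide norm_mult norm_power cmod_power2)

text \<open>On the vertical line through an integer \<open>qexp\<close> is real, hence so is
  \<open>hol1\<close>.\<close>

lemma Im_hol1_int [simp]: "Im (hol1 (Complex (of_int n) y)) = 0"
proof -
  have "qexp (Complex (of_int n) y) = exp (2 * of_int n * of_real pi * \<i>) * exp (of_real (- 2 * pi * y))"
    unfolding qexp_def exp_add[symmetric] by (simp add: Complex_eq algebra_simps)
  also have "exp (2 * of_int n * of_real pi * \<i>) = 1"
    using exp_integer_2pi[of "of_int n"] by (simp add: mult_ac)
  finally have q: "qexp (Complex (of_int n) y) = of_real (exp (- 2 * pi * y))" by (simp only: mult_1 exp_of_real)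
  have "hol1 (Complex (of_int n) y) = of_real (- 4 * pi * exp (- 2 * pi * y) / (1 - exp (- 2 * pi * y))\<^sup>2)"
    unfolding hol1_def q by simp
  thus ?thesis by (simp only: Im_complex_of_real)
qed

lemma Im_hol1_nat [simp]: "Im (hol1 (Complex (real N) y)) = 0" "Im (hol1 (Complex (- real N) y)) = 0"
  using Im_hol1_int[of "int N" y] Im_hol1_int[of "- int N" y] by simp_all

lemma Im_hol_ge_half: "1 \<le> Im z \<Longrightarrow> 1 / 2 \<le> Im (hol z)"
proof -
  assume z: "1 \<le> Im z"
  define e where "e = exp (- 2 * pi * Im z)"
  have "2 * 1 \<le> pi * Im z" using z pi_ge_two by (intro mult_mono) auto
  hence "1 + 2 \<le> exp (2 * pi * Im z)" using exp_ge_add_one_self[of "2 * pi * Im z"] by linarith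
  hence "e \<le> 1 / 3" unfolding e_def by (simp add: exp_minus field_simps)
  moreover have "0 < e" by (simp add: e_def)
  ultimately have "1 / 2 \<le> (1 - e) / (1 + e)" by (simp add: field_simps)
  thus ?thesis using Im_hol_bounds(1)[of z] z unfolding e_def by linarith
qed

context bellman_sequences
begin

lemma quo_eq: "quo c z = (\<Sum>n\<in>X. Im (pker n z) / h z * c n)"
  unfolding quo_def Im_ext by (simp add: sum_divide_distrib mult.commute)

lemma weights:
  assumes "0 < Im z"
  shows "n \<in> X \<Longrightarrow> 0 \<le> Im (pker n z) / h z" "(\<Sum>n\<in>X. Im (pker n z) / h z) \<le> 1"
proof -
  show "n \<in> X \<Longrightarrow> 0 \<le> Im (pker n z) / h z" using Im_pker_nonneg[of z n] h_pos[OF assms] assms by simp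
  show "(\<Sum>n\<in>X. Im (pker n z) / h z) \<le> 1"
    using sum_Im_pker_le[OF fin assms] h_pos[OF assms] unfolding sum_divide_distrib[symmetric] h_def by simp
qed

text \<open>Jensen with the weights \<open>Im (pker n z) / h z\<close>; the factor
  \<open>h z\<close> of \<open>W\<close> turns them back into Poisson kernels.\<close>

lemma W_le:
  assumes "0 < Im z"
  shows "W z \<le> (\<Sum>n\<in>X. Im (pker n z) * F (a n, b n))"
proof -
  have "F (UV z) \<le> (\<Sum>n\<in>X. Im (pker n z) / h z * F (a n, b n))"
    unfolding UV_def quo_eq using weights[OF assms] by (intro jensen fin) auto
  hence "W z \<le> h z * (\<Sum>n\<in>X. Im (pker n z) / h z * F (a n, b n))"
    unfolding W_def using h_pos[OF assms] by (intro mult_left_mono) auto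
  thus ?thesis using h_pos[OF assms] by (simp add: sum_distrib_left)
qed

lemma W_nonneg: "0 < Im z \<Longrightarrow> 0 \<le> W z"
  unfolding W_def using F_nonneg h_pos by (simp add: less_imp_le)

lemma integral_poisson_sum_le:
  assumes "0 < y" "\<And>n. n \<in> X \<Longrightarrow> 0 \<le> c n"
    and "\<And>x. W (Complex x y) \<le> (\<Sum>n\<in>X. Im (pker n (Complex x y)) * c n)"
  shows "mass N y \<le> (\<Sum>n\<in>X. c n)"
proof -
  have "mass N y \<le> integral {- real N..real N} (\<lambda>x. \<Sum>n\<in>X. Im (pker n (Complex x y)) * c n)"
    unfolding mass_def using assms
    by (intro integral_le integrable_line cont_W integrable_sum fin integrable_on_mult_left Im_pker_integral_le) auto
  also have "\<dots> = (\<Sum>n\<in>X. integral {- real N..real N} (\<lambda>x. Im (pker n (Complex x y))) * c n)"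
    using assms by (subst integral_sum) (auto intro!: fin integrable_on_mult_left Im_pker_integral_le)
  also have "\<dots> \<le> (\<Sum>n\<in>X. 1 * c n)"
    using assms by (intro sum_mono mult_right_mono Im_pker_integral_le) auto
  finally show ?thesis by simp
qed

lemma mass_le: "0 < y \<Longrightarrow> mass N y \<le> (\<Sum>n\<in>X. F (a n, b n))"
  by (rule integral_poisson_sum_le) (auto simp: F_nonneg intro: W_le)

lemma mass_nonneg: "0 < y \<Longrightarrow> 0 \<le> mass N y"
  unfolding mass_def by (intro integral_nonneg integrable_line cont_W W_nonneg) auto

lemma abs_quo_le:
  assumes "0 < Im z"
  shows "\<bar>quo c z\<bar> \<le> (\<Sum>n\<in>X. Im (pker n z) / h z * \<bar>c n\<bar>)" "\<bar>quo c z\<bar> \<le> (\<Sum>n\<in>X. \<bar>c n\<bar>)"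
proof -
  have "\<bar>quo c z\<bar> \<le> (\<Sum>n\<in>X. \<bar>Im (pker n z) / h z * c n\<bar>)" unfolding quo_eq by (rule sum_abs)
  also have "\<dots> = (\<Sum>n\<in>X. Im (pker n z) / h z * \<bar>c n\<bar>)"
    using weights(1)[OF assms] by (intro sum.cong refl) (metis abs_mult abs_of_nonneg)
  finally show 1: "\<bar>quo c z\<bar> \<le> (\<Sum>n\<in>X. Im (pker n z) / h z * \<bar>c n\<bar>)" .
  have "Im (pker n z) / h z \<le> 1" if "n \<in> X" for n
    using weights[OF assms] member_le_sum[OF that, of "\<lambda>n. Im (pker n z) / h z"] fin by fastforce
  hence "(\<Sum>n\<in>X. Im (pker n z) / h z * \<bar>c n\<bar>) \<le> (\<Sum>n\<in>X. 1 * \<bar>c n\<bar>)"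
    by (intro sum_mono mult_right_mono) auto
  with 1 show "\<bar>quo c z\<bar> \<le> (\<Sum>n\<in>X. \<bar>c n\<bar>)" by simp
qed

text \<open>\<open>F\<close> and its gradient vanish at the origin, so \<open>F w\<close> is small
  compared with \<open>norm w\<close>, while \<open>UV\<close> tends to 0 with growing height. Hence
  \<open>W\<close> is a small multiple of a Poisson sum of bounded mass. The bound is uniform in
  \<open>N\<close> because \<open>N\<close> goes to infinity first.\<close>

lemma mass_vanishes:
  assumes "0 < \<epsilon>"
  shows "\<exists>Y\<ge>1. \<forall>y\<ge>Y. \<forall>N. mass N y \<le> \<epsilon>"
proof -
  define C where "C = (\<Sum>n\<in>X. \<bar>a n\<bar> + \<bar>b n\<bar>)"
  have C: "0 \<le> C" unfolding C_def by (intro sum_nonneg) auto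
  define \<eta> where "\<eta> = \<epsilon> / (C + 1)"
  have \<eta>: "0 < \<eta>" using assms C by (simp add: \<eta>_def)
  have "(F has_derivative (\<lambda>d. 0)) (at (0, 0))" using dF[of "(0, 0)"] F0 by simp
  from this[unfolded has_derivative_at_alt] F0 \<eta>
  obtain \<delta> where \<delta>: "0 < \<delta>" "\<And>w. norm w < \<delta> \<Longrightarrow> \<bar>F w\<bar> \<le> \<eta> * norm w"
    by (auto simp: zero_prod_def[symmetric])
  \<comment> \<open>For \<open>y \<ge> 1\<close> one has \<open>h z \<ge> 1 / 2\<close>, and a
    Poisson kernel is at most \<open>1 / (pi * y)\<close>; so above \<open>Y\<close> the norm of
    \<open>UV z\<close> is at most \<open>2 * C / (pi * y) < \<delta>\<close>.\<close>
  define Y where "Y = max 1 (2 * C / (pi * \<delta>) + 1)"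
  show ?thesis
  proof (intro exI[of _ Y] conjI allI impI)
    show "1 \<le> Y" by (simp add: Y_def)
    fix y N assume y: "Y \<le> y"
    have y1: "1 \<le> y" "0 < y" using y by (auto simp: Y_def)
    have "W (Complex x y) \<le> (\<Sum>n\<in>X. Im (pker n (Complex x y)) * (\<eta> * (\<bar>a n\<bar> + \<bar>b n\<bar>)))" for x
    proof -
      define z where "z = Complex x y"
      have z: "0 < Im z" "Im z = y" using y1 by (simp_all add: z_def)
      have hz: "0 < h z" "1 / 2 \<le> h z" using h_pos[OF z(1)] Im_hol_ge_half[of z] y1 z by (auto simp: h_def)
      have q: "\<bar>quo a z\<bar> + \<bar>quo b z\<bar> \<le> (\<Sum>n\<in>X. Im (pker n z) / h z * (\<bar>a n\<bar> + \<bar>b n\<bar>))"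
        using abs_quo_le(1)[OF z(1), of a] abs_quo_le(1)[OF z(1), of b] by (simp add: sum.distrib distrib_left)
      have nUV: "norm (UV z) \<le> \<bar>quo a z\<bar> + \<bar>quo b z\<bar>"
        unfolding UV_def norm_Pair by (simp add: sqrt_sum_squares_le_sum_abs)
      have "(\<Sum>n\<in>X. Im (pker n z) / h z * (\<bar>a n\<bar> + \<bar>b n\<bar>)) \<le> (\<Sum>n\<in>X. 2 / (pi * y) * (\<bar>a n\<bar> + \<bar>b n\<bar>))"
      proof (intro sum_mono mult_right_mono)
        fix n
        have "Im (pker n z) / h z \<le> (1 / (pi * y)) / (1 / 2)"
          using hz Im_pker_le[OF y1(2)] y1 unfolding z_def[symmetric]
          by (intro frac_le) (auto simp: z_def)
        thus "Im (pker n z) / h z \<le> 2 / (pi * y)" by simp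
      qed auto
      also have "\<dots> = 2 / (pi * y) * C" unfolding C_def sum_distrib_left ..
      also have "\<dots> = 2 * C / (pi * y)" by simp
      also have "\<dots> < \<delta>"
      proof -
        have "2 * C / (pi * \<delta>) < y" using y by (simp add: Y_def)
        thus ?thesis using \<delta>(1) y1 by (simp add: field_simps)
      qed
      finally have "norm (UV z) < \<delta>" using q nUV by linarith
      hence "F (UV z) \<le> \<eta> * norm (UV z)" using \<delta>(2) by fastforce
      also have "\<dots> \<le> \<eta> * (\<Sum>n\<in>X. Im (pker n z) / h z * (\<bar>a n\<bar> + \<bar>b n\<bar>))"
        using nUV q \<eta> by (intro mult_left_mono) auto
      finally have "W z \<le> h z * (\<eta> * (\<Sum>n\<in>X. Im (pker n z) / h z * (\<bar>a n\<bar> + \<bar>b n\<bar>)))"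
        unfolding W_def using hz by (intro mult_left_mono) auto
      also have "\<dots> = (\<Sum>n\<in>X. Im (pker n z) * (\<eta> * (\<bar>a n\<bar> + \<bar>b n\<bar>)))"
        using hz by (simp add: sum_distrib_left mult_ac)
      finally show ?thesis by (simp add: z_def)
    qed
    hence "mass N y \<le> (\<Sum>n\<in>X. \<eta> * (\<bar>a n\<bar> + \<bar>b n\<bar>))"
      using y1 \<eta> by (intro integral_poisson_sum_le) auto
    also have "\<dots> = \<eta> * C" by (simp add: C_def sum_distrib_left)
    also have "\<dots> \<le> \<epsilon>" using assms C unfolding \<eta>_def by (simp add: field_simps)
    finally show "mass N y \<le> \<epsilon>" .
  qed
qed

text \<open>The quotients are bounded by the sums of \<open>\<bar>a n\<bar>\<close> and
  \<open>\<bar>b n\<bar>\<close>, so \<open>UV\<close> stays in a fixed compact rectangle.\<close>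

lemma UV_bounded:
  "\<exists>B\<ge>0. \<forall>z. 0 < Im z \<longrightarrow> \<bar>F1 (UV z)\<bar> \<le> B \<and> \<bar>F2 (UV z)\<bar> \<le> B"
proof -
  define R where "R = (\<Sum>n\<in>X. \<bar>a n\<bar>)"
  define R' where "R' = (\<Sum>n\<in>X. \<bar>b n\<bar>)"
  define S where "S = {-R..R} \<times> {-R'..R'}"
  have "compact S" unfolding S_def by (intro compact_Times compact_Icc)
  have "bounded (F1 ` S)" "bounded (F2 ` S)"
    using \<open>compact S\<close> cont(2,3)
    by (meson compact_imp_bounded compact_continuous_image continuous_on_subset subset_UNIV)+
  then obtain B B' where B: "\<And>w. w \<in> S \<Longrightarrow> \<bar>F1 w\<bar> \<le> B" "\<And>w. w \<in> S \<Longrightarrow> \<bar>F2 w\<bar> \<le> B'"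
    unfolding bounded_iff ball_simps real_norm_def by metis
  have "UV z \<in> S" if "0 < Im z" for z
    using abs_quo_le(2)[OF that, of a] abs_quo_le(2)[OF that, of b]
    by (auto simp: UV_def S_def R_def R'_def abs_le_iff)
  hence "\<bar>F1 (UV z)\<bar> \<le> max 0 (max B B') \<and> \<bar>F2 (UV z)\<bar> \<le> max 0 (max B B')" if "0 < Im z" for z
    using B(1)[of "UV z"] B(2)[of "UV z"] that by (auto simp: le_max_iff_disj)
  thus ?thesis by (intro exI[of _ "max 0 (max B B')"]) auto
qed

text \<open>The lines are cut at integers because \<^term>\<open>Im (hol1 z)\<close> vanishes there, so that \<^term>\<open>Wx\<close>
  decays at the end points.\<close>

lemma boundary_small:
  "\<exists>B\<ge>0. \<exists>m. \<forall>N>m. \<forall>y>0. \<bar>Wx (Complex (real N) y)\<bar> \<le> B / (real N - real m) \<and>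
     \<bar>Wx (Complex (- real N) y)\<bar> \<le> B / (real N - real m)"
proof -
  obtain B where B: "B \<ge> 0" "\<And>z. 0 < Im z \<Longrightarrow> \<bar>F1 (UV z)\<bar> \<le> B" "\<And>z. 0 < Im z \<Longrightarrow> \<bar>F2 (UV z)\<bar> \<le> B"
    using UV_bounded by blast
  obtain m :: nat where m: "\<And>n. n \<in> X \<Longrightarrow> \<bar>real_of_int n\<bar> \<le> real m"
  proof -
    obtain k where k: "\<And>n. n \<in> X \<Longrightarrow> \<bar>n\<bar> \<le> k"
      using fin by (metis finite_imageI imageI Max_ge)
    show thesis
    proof (rule that[of "nat k"])
      fix n assume "n \<in> X"
      from k[OF this] have "\<bar>n\<bar> \<le> int (nat k)" by linarith
      thus "\<bar>real_of_int n\<bar> \<le> real (nat k)" by linarith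
    qed
  qed
  define A where "A = (\<Sum>n\<in>X. \<bar>a n\<bar>)"
  define A' where "A' = (\<Sum>n\<in>X. \<bar>b n\<bar>)"
  have main: "\<bar>Wx z\<bar> \<le> B * (A + A') / (real N - real m)"
    if N: "N > m" and z: "0 < Im z" "\<bar>Re z\<bar> = real N" "Im (hol1 z) = 0" for N z
  proof -
    have pos: "1 \<le> real N - real m" using N by linarith
    have k: "\<bar>Im (pker1 n z)\<bar> \<le> 1 / (real N - real m)" if "n \<in> X" for n
    proof -
      have "real N - real m \<le> \<bar>Re (z - of_int n)\<bar>" using m[OF that] z(2) by simp
      also have "\<dots> \<le> norm (z - of_int n)" by (rule abs_Re_le_cmod)
      finally have 1: "real N - real m \<le> norm (z - of_int n)" .
      have "1 * (real N - real m) \<le> pi * (norm (z - of_int n))\<^sup>2"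
      proof (rule mult_mono)
        show "1 \<le> pi" using pi_ge_two by simp
        show "real N - real m \<le> (norm (z - of_int n))\<^sup>2"
          using 1 pos self_le_power[of "norm (z - of_int n)" 2] by linarith
      qed (use pos in auto)
      hence "1 / (pi * (norm (z - of_int n))\<^sup>2) \<le> 1 / (real N - real m)"
        using pos by (intro divide_left_mono) auto
      moreover have "norm (pker1 n z) = 1 / (pi * (norm (z - of_int n))\<^sup>2)"
        by (simp add: pker1_def norm_divide norm_mult norm_power)
      ultimately show ?thesis using abs_Im_le_cmod[of "pker1 n z"] by linarith
    qed
    have e: "\<bar>Im (ext pker1 c z)\<bar> \<le> (\<Sum>n\<in>X. \<bar>c n\<bar>) / (real N - real m)" for c
    proof -
      have "\<bar>Im (ext pker1 c z)\<bar> \<le> (\<Sum>n\<in>X. \<bar>c n * Im (pker1 n z)\<bar>)" unfolding Im_ext by (rule sum_abs)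
      also have "\<dots> \<le> (\<Sum>n\<in>X. \<bar>c n\<bar> * (1 / (real N - real m)))"
        unfolding abs_mult using k by (intro sum_mono mult_left_mono) auto
      finally show ?thesis by (simp add: sum_divide_distrib)
    qed
    have "\<bar>Wx z\<bar> \<le> \<bar>F1 (UV z)\<bar> * \<bar>Im (ext pker1 a z)\<bar> + \<bar>F2 (UV z)\<bar> * \<bar>Im (ext pker1 b z)\<bar>"
      unfolding Wx_def quo_x_def z(3) by (simp add: abs_mult[symmetric] abs_triangle_ineq)
    also have "\<dots> \<le> B * (A / (real N - real m)) + B * (A' / (real N - real m))"
      unfolding A_def A'_def using B z e by (intro add_mono mult_mono) auto
    finally show ?thesis by (simp add: distrib_left add_divide_distrib)
  qed
  have "0 \<le> B * (A + A')" using B(1) by (auto simp: A_def A'_def intro!: mult_nonneg_nonneg add_nonneg_nonneg sum_nonneg)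
  thus ?thesis using main by (intro exI[of _ "B * (A + A')"] conjI exI[of _ m]) auto
qed

definition flux :: "nat \<Rightarrow> real \<Rightarrow> real" where
  "flux N y = integral {- real N..real N} (\<lambda>x. 2 * jac (Complex x y))"

lemma flux_cont: "continuous_on {0<..} (flux N)"
  unfolding flux_def[abs_def]
  by (rule line_integral_cont[of "\<lambda>z. 2 * jac z"]) (intro continuous_on_mult continuous_on_const cont_W)

text \<open>The weight is the Green function of the second derivative on \<^term>\<open>{y1..y2}\<close>: integrate by parts
  twice against \<^term>\<open>mass N\<close>.\<close>

lemma flux_integral_le:
  "\<exists>B\<ge>0. \<exists>m. \<forall>N>m. \<forall>y1 y2. 0 < y1 \<longrightarrow> y1 < y2 \<longrightarrow>
     integral {y1..y2} (\<lambda>y. (y - y1) * (y2 - y) / (y2 - y1) * flux N y)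
      \<le> (\<Sum>n\<in>X. F (a n, b n)) + mass N y2 + B / (real N - real m) * (y2 - y1)\<^sup>2"
proof -
  obtain B m where B: "0 \<le> B" "\<And>N y. N > m \<Longrightarrow> 0 < y \<Longrightarrow> \<bar>Wx (Complex (real N) y)\<bar> \<le> B / (real N - real m) \<and>
     \<bar>Wx (Complex (- real N) y)\<bar> \<le> B / (real N - real m)"
    using boundary_small by blast
  have "integral {y1..y2} (\<lambda>y. (y - y1) * (y2 - y) / (y2 - y1) * flux N y)
      \<le> (\<Sum>n\<in>X. F (a n, b n)) + mass N y2 + (2 * B) / (real N - real m) * (y2 - y1)\<^sup>2"
    if N: "N > m" and y: "0 < y1" "y1 < y2" for N y1 y2
  proof -
    define L where "L = y2 - y1"
    have L: "0 < L" using y by (simp add: L_def)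
    define E where "E = 2 * B / (real N - real m)"
    have E: "0 \<le> E" using B(1) N by (simp add: E_def)
    define G where "G t = (t - y1) * (y2 - t) / L" for t
    define G' where "G' t = (y1 + y2 - 2 * t) / L" for t
    define M1 where "M1 t = integral {- real N..real N} (\<lambda>x. Wy (Complex x t))" for t
    define M2 where "M2 t = integral {- real N..real N} (\<lambda>x. Wyy (Complex x t))" for t
    have dM: "(mass N has_real_derivative M1 t) (at t)" "(M1 has_real_derivative M2 t) (at t)" if "0 < t" for t
      using mass_deriv[OF that, of N] by (simp_all add: M1_def[abs_def] M2_def[abs_def])
    \<comment> \<open>Antiderivative from the two integrations by parts, using
      \<open>G'' = - 2 / L\<close>. \<open>G\<close> vanishes at both ends and \<open>G'\<close> is
      \<open>1\<close> and \<open>- 1\<close> there, so only \<open>mass N y1 + mass N y2\<close>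
      remains, plus the linear term that absorbs the boundary error \<open>E\<close>. The term
      \<open>2 / L * mass\<close> in \<open>R'\<close> is nonnegative and is given away.\<close>
    define R where "R t = G t * M1 t - G' t * mass N t + E * L * t" for t
    define R' where "R' t = G t * M2 t + 2 / L * mass N t + E * L" for t
    have dR: "(R has_real_derivative R' t) (at t)" if "0 < t" for t
    proof -
      have g: "(G has_real_derivative G' t) (at t)" "(G' has_real_derivative (- 2 / L)) (at t)"
        unfolding G_def[abs_def] G'_def[abs_def] using L by (auto intro!: derivative_eq_intros simp: field_simps)
      show ?thesis unfolding R_def[abs_def] R'_def
        by (auto intro!: derivative_eq_intros dM[OF that] g simp: algebra_simps)
    qed
    have hi: "(R' has_integral (R y2 - R y1)) {y1..y2}"
      using y by (intro fundamental_theorem_of_calculus)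
        (auto simp: has_real_derivative_iff_has_vector_derivative[symmetric] intro!: has_field_derivative_at_within dR)
    have G: "0 \<le> G t" "G t \<le> L" if "t \<in> {y1..y2}" for t
    proof -
      show "0 \<le> G t" using that L unfolding G_def by auto
      have "(t - y1) * (y2 - t) \<le> L * L" using that unfolding L_def by (intro mult_mono) auto
      thus "G t \<le> L" unfolding G_def using L by (simp add: field_simps)
    qed
    have le: "G t * flux N t \<le> R' t" if t: "t \<in> {y1..y2}" for t
    proof -
      have t0: "0 < t" using t y by simp
      have "flux N t - (Wx (Complex (real N) t) - Wx (Complex (- real N) t)) \<le> M2 t"
        using mass_deriv2_ge[OF t0, of N] by (simp add: flux_def M2_def)
      moreover have "Wx (Complex (real N) t) - Wx (Complex (- real N) t) \<le> E"
        using B(2)[OF N t0] unfolding E_def by (auto simp: abs_le_iff)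
      ultimately have "flux N t \<le> M2 t + E" by linarith
      hence "G t * flux N t \<le> G t * (M2 t + E)" using G[OF t] by (intro mult_left_mono)
      also have "\<dots> = G t * M2 t + G t * E" by (simp add: algebra_simps)
      also have "\<dots> \<le> G t * M2 t + L * E" using G[OF t] E by (intro add_left_mono mult_right_mono)
      also have "\<dots> \<le> R' t" unfolding R'_def using mass_nonneg[OF t0, of N] L by (simp add: mult.commute)
      finally show ?thesis .
    qed
    have "continuous_on {y1..y2} (\<lambda>t. G t * flux N t)"
      unfolding G_def using L y
      by (intro continuous_intros continuous_on_subset[OF flux_cont]) auto
    hence "(\<lambda>t. G t * flux N t) integrable_on {y1..y2}" by (rule integrable_continuous_real)
    hence "integral {y1..y2} (\<lambda>t. G t * flux N t) \<le> integral {y1..y2} R'"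
      using hi le by (intro integral_le) auto
    also have "\<dots> = R y2 - R y1" using hi by (rule integral_unique)
    also have "\<dots> = mass N y1 + mass N y2 + E * L * L"
      unfolding R_def G_def G'_def using L by (simp add: L_def field_simps)
    also have "\<dots> \<le> (\<Sum>n\<in>X. F (a n, b n)) + mass N y2 + E * L\<^sup>2"
      using mass_le[OF y(1), of N] by (simp add: power2_eq_square)
    finally show ?thesis unfolding G_def L_def E_def by simp
  qed
  thus ?thesis using B(1) by (intro exI[of _ "2 * B"] conjI exI[of _ m]) auto
qed

end

subsection \<open>The horizontal integrals\<close>

text \<open>Principal value by symmetric truncation at integers, the same truncation as in
  \<open>mass\<close>; a simple pole has no integral over the line otherwise. Continuity is included
  so that all truncations are integrable and limits can be combined linearly.\<close>

definition PV :: "(real \<Rightarrow> complex) \<Rightarrow> complex \<Rightarrow> bool" where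
  "PV g L \<longleftrightarrow> continuous_on UNIV g \<and> (\<lambda>N. integral {- real N..real N} g) \<longlonglongrightarrow> L"

lemma PV_integrable: "PV g L \<Longrightarrow> g integrable_on {c..d}"
  unfolding PV_def by (meson integrable_continuous_real continuous_on_subset top_greatest)

lemma PV_add: "PV f L \<Longrightarrow> PV g K \<Longrightarrow> PV (\<lambda>x. f x + g x) (L + K)"
proof -
  assume fg: "PV f L" "PV g K"
  have "integral {- real N..real N} (\<lambda>x. f x + g x) = integral {- real N..real N} f + integral {- real N..real N} g" for N
    by (intro Henstock_Kurzweil_Integration.integral_add PV_integrable[OF fg(1)] PV_integrable[OF fg(2)])
  thus ?thesis using fg unfolding PV_def by (auto intro!: continuous_on_add tendsto_add)
qed

lemma PV_cmult: "PV f L \<Longrightarrow> PV (\<lambda>x. c * f x) (c * L)"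
  unfolding PV_def by (auto intro!: continuous_on_mult continuous_on_const tendsto_mult simp: integral_mult_right)

lemma PV_diff: "PV f L \<Longrightarrow> PV g K \<Longrightarrow> PV (\<lambda>x. f x - g x) (L - K)"
  using PV_add[of f L "\<lambda>x. (-1) * g x" "(-1) * K"] PV_cmult[of g K "-1"] by simp

lemma PV_cong: "PV f L \<Longrightarrow> (\<And>x. f x = g x) \<Longrightarrow> L = K \<Longrightarrow> PV g K"
proof -
  assume 1: "PV f L" and 2: "\<And>x. f x = g x" and 3: "L = K"
  from 2 have "f = g" by (rule ext)
  show "PV g K" using 1 unfolding \<open>f = g\<close> 3 .
qed

lemma PV_deriv:
  assumes d: "\<And>x. (G has_vector_derivative g x) (at x)" and "continuous_on UNIV g"
    and "(\<lambda>N. G (real N) - G (- real N)) \<longlonglongrightarrow> L"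
  shows "PV g L"
proof -
  have "integral {- real N..real N} g = G (real N) - G (- real N)" for N
  proof (rule integral_unique, rule fundamental_theorem_of_calculus)
    fix x show "(G has_vector_derivative g x) (at x within {- real N..real N})"
      by (rule has_vector_derivative_at_within[OF d])
  qed simp
  hence "(\<lambda>N. integral {- real N..real N} g) \<longlonglongrightarrow> L" using assms(3) by (simp only:)
  thus ?thesis using assms(2) unfolding PV_def by blast
qed

lemma inv_line_tendsto: "(\<lambda>N. 1 / (of_real (real N) - w)) \<longlonglongrightarrow> (0::complex)"
  "(\<lambda>N. 1 / (of_real (- real N) - w)) \<longlonglongrightarrow> (0::complex)"
proof -
  have 0: "filterlim (\<lambda>N. of_real (real N) :: complex) at_infinity sequentially"
    using tendsto_of_nat by simp
  have 1: "filterlim (\<lambda>N. of_real (real N) - w) at_infinity sequentially"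
    using tendsto_add_filterlim_at_infinity'[OF 0 tendsto_const[of "-w"]] by simp
  have 2: "filterlim (\<lambda>N. of_real (real N) + w) at_infinity sequentially"
    using tendsto_add_filterlim_at_infinity'[OF 0 tendsto_const[of w]] by simp
  show "(\<lambda>N. 1 / (of_real (real N) - w)) \<longlonglongrightarrow> (0::complex)"
    by (rule tendsto_divide_0[OF tendsto_const 1])
  have "(\<lambda>N. - 1 / (of_real (real N) + w)) \<longlonglongrightarrow> (0::complex)"
    by (rule tendsto_divide_0[OF tendsto_const 2])
  moreover have "- 1 / (of_real (real N) + w) = 1 / (of_real (- real N) - w)" for N
    by (metis add.commute diff_minus_eq_add minus_diff_eq minus_divide_divide minus_minus of_real_minus uminus_add_conv_diff)
  ultimately show "(\<lambda>N. 1 / (of_real (- real N) - w)) \<longlonglongrightarrow> (0::complex)" by simp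
qed

lemma of_real_minus_nz: "Im w \<noteq> 0 \<Longrightarrow> of_real x - w \<noteq> 0"
  by (auto simp: complex_eq_iff)

lemma of_real_deriv: "((\<lambda>x. complex_of_real x) has_vector_derivative 1) (at x within S)"
  by (rule has_vector_derivative_of_real[OF DERIV_ident, simplified])

lemma line_deriv:
  fixes f :: "complex \<Rightarrow> complex"
  assumes "(f has_field_derivative f') (at (of_real x))"
  shows "((\<lambda>x. f (of_real x)) has_vector_derivative f') (at x)"
  using field_vector_diff_chain_at[OF of_real_deriv[where S = UNIV] assms] by (simp add: o_def)

text \<open>The primitive is \<open>Ln (x - w)\<close>. At the two ends the logarithms of the moduli
  cancel in the limit, and the arguments differ by \<open>pi\<close> with the sign of the half-plane
  of \<open>w\<close>.\<close>

lemma PV_inverse: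
  assumes "Im w \<noteq> 0"
  shows "PV (\<lambda>x. 1 / (of_real x - w)) (\<i> * of_real pi * of_real (sgn (Im w)))"
proof (rule PV_deriv[where G = "\<lambda>x. Ln (of_real x - w)"])
  fix x :: real
  have "of_real x - w \<notin> \<real>\<^sub>\<le>\<^sub>0" using assms by (auto simp: complex_nonpos_Reals_iff)
  hence "((\<lambda>z. Ln (z - w)) has_field_derivative 1 / (of_real x - w)) (at (of_real x))"
    by (auto intro!: derivative_eq_intros simp: field_simps)
  thus "((\<lambda>x. Ln (of_real x - w)) has_vector_derivative 1 / (of_real x - w)) (at x)" by (rule line_deriv)
next
  show "continuous_on UNIV (\<lambda>x. 1 / (of_real x - w))"
    using of_real_minus_nz[OF assms] by (intro continuous_intros) auto
next
  have ev: "eventually (\<lambda>N. Ln (1 - w / of_nat N) - Ln (1 + w / of_nat N) + \<i> * of_real pi * of_real (sgn (Im w))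
     = Ln (of_real (real N) - w) - Ln (of_real (- real N) - w)) sequentially"
    using eventually_gt_at_top[of 0]
  proof eventually_elim
    case (elim N)
    have nz: "1 - w / of_nat N \<noteq> 0" "1 + w / of_nat N \<noteq> 0"
      using assms elim by (auto simp: complex_eq_iff)
    have 1: "of_real (real N) - w = of_real (real N) * (1 - w / of_nat N)" using elim by (simp add: field_simps)
    have 2: "of_real (- real N) - w = of_real (real N) * (- (1 + w / of_nat N))" using elim by (simp add: field_simps)
    have im: "Im (1 + w / of_nat N) = Im w / real N" by (simp add: Im_divide_of_nat)
    have 3: "Ln (- (1 + w / of_nat N)) = Ln (1 + w / of_nat N) - \<i> * of_real pi * of_real (sgn (Im w))"
      using Ln_minus[OF nz(2)] assms elim unfolding im by (auto simp: sgn_if divide_le_0_iff)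
    have L: "Ln (of_real r * z) = of_real (ln r) + Ln z" if "0 < r" "z \<noteq> 0" for r z
      using Ln_times_of_real[OF that] that(1) by (simp add: Ln_of_real)
    have "Ln (of_real (real N) - w) = ln (real N) + Ln (1 - w / of_nat N)"
      unfolding 1 using elim nz by (intro L) auto
    moreover have "Ln (of_real (- real N) - w) = ln (real N) + Ln (- (1 + w / of_nat N))"
      unfolding 2 by (rule L)
        (use elim nz(2) in \<open>simp_all only: neg_equal_0_iff_equal of_nat_0_less_iff not_False_eq_True\<close>)
    ultimately show ?case unfolding 3 by simp
  qed
  have wN: "(\<lambda>N. w / of_nat N) \<longlonglongrightarrow> 0" by (rule lim_const_over_n)
  have "(\<lambda>N. Ln (1 - w / of_nat N) - Ln (1 + w / of_nat N) + \<i> * of_real pi * of_real (sgn (Im w))) \<longlonglongrightarrow>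
    Ln (1 - 0) - Ln (1 + 0) + \<i> * of_real pi * of_real (sgn (Im w))"
    by (intro tendsto_intros wN) (auto simp: complex_nonpos_Reals_iff)
  thus "(\<lambda>N. Ln (of_real (real N) - w) - Ln (of_real (- real N) - w)) \<longlonglongrightarrow> \<i> * of_real pi * of_real (sgn (Im w))"
    using ev by (simp add: Lim_transform_eventually)
qed

lemma PV_inverse_sq:
  assumes "Im w \<noteq> 0"
  shows "PV (\<lambda>x. 1 / (of_real x - w)\<^sup>2) 0"
proof (rule PV_deriv[where G = "\<lambda>x. - (1 / (of_real x - w))"])
  fix x :: real
  have "((\<lambda>z. - (1 / (z - w))) has_field_derivative 1 / (of_real x - w)\<^sup>2) (at (of_real x))"
    using of_real_minus_nz[OF assms, of x] by (auto intro!: derivative_eq_intros simp: field_simps power2_eq_square)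
  thus "((\<lambda>x. - (1 / (of_real x - w))) has_vector_derivative 1 / (of_real x - w)\<^sup>2) (at x)" by (rule line_deriv)
next
  show "continuous_on UNIV (\<lambda>x. 1 / (of_real x - w)\<^sup>2)"
    using of_real_minus_nz[OF assms] by (intro continuous_intros) auto
  show "(\<lambda>N. - (1 / (of_real (real N) - w)) - - (1 / (of_real (- real N) - w))) \<longlonglongrightarrow> 0"
    by (rule tendsto_eq_rhs[OF tendsto_diff[OF tendsto_minus[OF inv_line_tendsto(1)] tendsto_minus[OF inv_line_tendsto(2)]]]) simp
qed

text \<open>Close the segment by the upper semicircle: quadratic decay makes the arc contribute
  \<open>O(1 / N)\<close>. The margin \<open>\<eta>\<close> puts the real line inside the domain of
  holomorphy.\<close>

lemma PV_upper_zero: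
  fixes f :: "complex \<Rightarrow> complex"
  assumes hol: "f holomorphic_on {z. - \<eta> < Im z}" and eta: "0 < \<eta>"
    and bd: "\<And>z. 0 \<le> Im z \<Longrightarrow> rr \<le> norm z \<Longrightarrow> norm (f z) \<le> B / (norm z)\<^sup>2"
  shows "PV (\<lambda>x. f (of_real x)) 0"
proof -
  let ?S = "{z. - \<eta> < Im z}"
  have cvx: "convex ?S" using convex_halfspace_Im_gt by auto
  have B: "0 \<le> B"
  proof -
    define z where "z = complex_of_real (max 1 rr)"
    have "0 \<le> norm (f z)" by simp
    also have "\<dots> \<le> B / (norm z)\<^sup>2" by (rule bd) (auto simp: z_def)
    finally show ?thesis by (auto simp: z_def zero_le_divide_iff)
  qed
  have cont: "continuous_on ?S f" using hol by (rule holomorphic_on_imp_continuous_on)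
  have contR: "continuous_on UNIV (\<lambda>x. f (of_real x))"
    using eta by (intro continuous_on_compose2[OF cont]) (auto intro!: continuous_intros)
  have le: "norm (integral {- real N..real N} (\<lambda>x. f (of_real x))) \<le> B * pi * (1 / real N)"
    if N: "N > 0" "rr \<le> real N" for N
  proof -
    define I where "I = integral {- real N..real N} (\<lambda>x. f (of_real x))"
    define r where "r = real N"
    have r: "0 < r" using N by (simp add: r_def)
    define g1 where "g1 = linepath (- of_real r) (complex_of_real r)"
    define g2 where "g2 = part_circlepath 0 r 0 pi"
    have "((\<lambda>x. f (of_real x)) has_integral I) {- r..r}" unfolding I_def r_def
      by (intro integrable_integral integrable_continuous_real continuous_on_subset[OF contR]) auto
    hence 1: "(f has_contour_integral I) g1" unfolding g1_def
      using r by (subst has_contour_integral_linepath_Reals_iff) auto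
    have im2: "0 \<le> Im z \<and> norm z = r" if "z \<in> path_image g2" for z
    proof -
      have s: "closed_segment 0 pi = {0..pi}" by (simp add: closed_segment_eq_real_ivl)
      have "z \<in> (\<lambda>t. 0 + of_real r * cis t) ` {0..pi}"
        using that unfolding g2_def path_image_part_circlepath' s .
      then obtain t where t: "0 \<le> t" "t \<le> pi" "z = of_real r * cis t" by auto
      thus ?thesis using r by (auto simp: norm_mult intro!: mult_nonneg_nonneg sin_ge_zero)
    qed
    have im1: "Im z = 0" if "z \<in> path_image g1" for z
      using that unfolding g1_def by (auto simp: closed_segment_def)
    have "(f has_contour_integral 0) (g1 +++ g2)"
      using hol cvx
    proof (rule Cauchy_theorem_convex_simple)
      show "valid_path (g1 +++ g2)" unfolding g1_def g2_def by (intro valid_path_join) auto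
      show "path_image (g1 +++ g2) \<subseteq> ?S"
        using im1 im2 eta by (intro subset_path_image_join) force+
      show "pathfinish (g1 +++ g2) = pathstart (g1 +++ g2)" unfolding g1_def g2_def by (simp add: exp_Euler)
    qed
    moreover have "f contour_integrable_on g2"
      unfolding g2_def
    proof (intro contour_integrable_continuous_part_circlepath continuous_on_subset[OF cont])
      show "path_image (part_circlepath 0 r 0 pi) \<subseteq> ?S" using im2 eta unfolding g2_def by force
    qed
    hence 2: "(f has_contour_integral (contour_integral g2 f)) g2" by (rule has_contour_integral_integral)
    have "(f has_contour_integral (I + contour_integral g2 f)) (g1 +++ g2)"
      using 1 2 by (intro has_contour_integral_join) (auto simp: g1_def g2_def)
    ultimately have "I + contour_integral g2 f = 0" by (metis contour_integral_unique)
    hence "norm I = norm (contour_integral g2 f)" by (metis add_eq_0_iff norm_minus_cancel)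
    also have "\<dots> \<le> B / r\<^sup>2 * r * (pi - 0)"
      unfolding g2_def
    proof (rule has_contour_integral_bound_part_circlepath[OF 2[unfolded g2_def]])
      show "\<And>z. z \<in> path_image (part_circlepath 0 r 0 pi) \<Longrightarrow> norm (f z) \<le> B / r\<^sup>2"
        using im2 bd N unfolding g2_def r_def by fastforce
    qed (use r B in auto)
    finally show ?thesis using r unfolding I_def r_def[symmetric] by (simp add: power2_eq_square mult_ac)
  qed
  have "(\<lambda>N. integral {- real N..real N} (\<lambda>x. f (of_real x))) \<longlonglongrightarrow> 0"
  proof (rule Lim_null_comparison)
    show "eventually (\<lambda>N. norm (integral {- real N..real N} (\<lambda>x. f (of_real x))) \<le> B * pi * (1 / real N)) sequentially"
      using eventually_gt_at_top[of 0] eventually_ge_at_top[of "nat \<lceil>rr\<rceil>"]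
      by eventually_elim (intro le, auto)
    show "(\<lambda>N. B * pi * (1 / real N)) \<longlonglongrightarrow> 0"
      using tendsto_mult[OF tendsto_const lim_1_over_n[where 'a = real], of "B * pi"] by simp
  qed
  thus ?thesis using contR by (simp add: PV_def)
qed

lemma norm_qexp_le: "0 \<le> Im z \<Longrightarrow> norm (qexp z) \<le> 1" by (simp add: norm_qexp)
lemma norm_qexp_real [simp]: "norm (qexp (of_real x)) = 1" by (simp add: norm_qexp)

lemma norm_diff_ge_half: "2 * norm w \<le> norm z \<Longrightarrow> norm z / 2 \<le> norm (z - w)" for z w :: complex
  using norm_triangle_ineq2[of z w] by linarith

lemma inv_prod_bound:
  fixes z w v :: complex
  assumes "2 * norm w \<le> norm z" "2 * norm v \<le> norm z" "0 < norm z"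
  shows "norm (1 / ((z - w) * (z - v))) \<le> 4 / (norm z)\<^sup>2"
proof -
  have "norm z / 2 * (norm z / 2) \<le> norm (z - w) * norm (z - v)"
    using assms by (intro mult_mono norm_diff_ge_half) auto
  moreover have "0 < norm z / 2 * (norm z / 2)" using assms by simp
  ultimately have "1 / (norm (z - w) * norm (z - v)) \<le> 1 / (norm z / 2 * (norm z / 2))"
    by (intro divide_left_mono) auto
  thus ?thesis by (simp add: norm_divide norm_mult power2_eq_square)
qed

text \<open>Integration by parts with boundary terms of size \<open>1 / N\<close>, as
  \<open>qexp\<close> is unimodular on the real line. It reduces a simple pole to a double pole, for
  which the semicircle estimate applies.\<close>

lemma PV_qexp_parts:
  assumes "Im w \<noteq> 0" "PV (\<lambda>x. qexp (of_real x) * (1 / (of_real x - w)\<^sup>2)) L"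
  shows "PV (\<lambda>x. qexp (of_real x) * (1 / (of_real x - w))) (L / (2 * of_real pi * \<i>))"
proof -
  have cE: "continuous_on UNIV (\<lambda>x. qexp (complex_of_real x))"
    unfolding qexp_def by (intro continuous_intros)
  have c1: "continuous_on UNIV (\<lambda>x. of_real x - w)"
    by (rule continuous_on_diff[OF continuous_on_of_real[OF continuous_on_id] continuous_on_const])
  have c2: "continuous_on UNIV (\<lambda>x. 1 / (of_real x - w))"
    by (rule continuous_on_divide[OF continuous_on_const c1]) (use of_real_minus_nz[OF assms(1)] in blast)
  have c3: "continuous_on UNIV (\<lambda>x. 1 / (of_real x - w)\<^sup>2)"
    by (rule continuous_on_divide[OF continuous_on_const continuous_on_power[OF c1]])
      (use of_real_minus_nz[OF assms(1)] in \<open>simp only: power_eq_0_iff, blast\<close>)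
  have "PV (\<lambda>x. 2 * of_real pi * \<i> * (qexp (of_real x) * (1 / (of_real x - w))) - qexp (of_real x) * (1 / (of_real x - w)\<^sup>2)) 0"
  proof (rule PV_deriv[where G = "\<lambda>x. qexp (of_real x) * (1 / (of_real x - w))"])
    fix x :: real
    have "((\<lambda>z. qexp z * (1 / (z - w))) has_field_derivative
       2 * of_real pi * \<i> * (qexp (of_real x) * (1 / (of_real x - w))) - qexp (of_real x) * (1 / (of_real x - w)\<^sup>2)) (at (of_real x))"
      using of_real_minus_nz[OF assms(1), of x]
      by (auto intro!: derivative_eq_intros qexp_deriv simp: power2_eq_square diff_divide_distrib)
    thus "((\<lambda>x. qexp (of_real x) * (1 / (of_real x - w))) has_vector_derivative
       2 * of_real pi * \<i> * (qexp (of_real x) * (1 / (of_real x - w))) - qexp (of_real x) * (1 / (of_real x - w)\<^sup>2)) (at x)"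
      by (rule line_deriv)
  next
    show "continuous_on UNIV (\<lambda>x. 2 * of_real pi * \<i> * (qexp (of_real x) * (1 / (of_real x - w))) - qexp (of_real x) * (1 / (of_real x - w)\<^sup>2))"
      by (rule continuous_on_diff[OF continuous_on_mult[OF continuous_on_const continuous_on_mult[OF cE c2]] continuous_on_mult[OF cE c3]])
    have "(\<lambda>N. qexp (of_real (real N)) * (1 / (of_real (real N) - w))) \<longlonglongrightarrow> 0"
      by (rule tendsto_norm_zero_cancel, unfold norm_mult norm_qexp_real mult_1)
        (rule tendsto_norm_zero[OF inv_line_tendsto(1)])
    moreover have "(\<lambda>N. qexp (of_real (- real N)) * (1 / (of_real (- real N) - w))) \<longlonglongrightarrow> 0"
      by (rule tendsto_norm_zero_cancel, unfold norm_mult norm_qexp_real mult_1)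
        (rule tendsto_norm_zero[OF inv_line_tendsto(2)])
    ultimately show "(\<lambda>N. qexp (of_real (real N)) * (1 / (of_real (real N) - w)) - qexp (of_real (- real N)) * (1 / (of_real (- real N) - w))) \<longlonglongrightarrow> 0"
      by (rule tendsto_eq_rhs[OF tendsto_diff]) simp
  qed
  from PV_cmult[OF PV_add[OF this assms(2)], of "1 / (2 * of_real pi * \<i>)"]
  show ?thesis by (rule PV_cong) auto
qed

text \<open>In the upper half-plane \<open>qexp\<close> is bounded by 1 and the integrand has no
  pole.\<close>

lemma PV_qexp_lower:
  assumes "Im v < 0"
  shows "PV (\<lambda>x. qexp (of_real x) * (1 / (of_real x - v)\<^sup>2)) 0" "PV (\<lambda>x. qexp (of_real x) * (1 / (of_real x - v))) 0"
proof -
  show 1: "PV (\<lambda>x. qexp (of_real x) * (1 / (of_real x - v)\<^sup>2)) 0"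
  proof (rule PV_upper_zero[where \<eta> = "- Im v" and rr = "2 * norm v + 1" and B = 4])
    show "(\<lambda>z. qexp z * (1 / (z - v)\<^sup>2)) holomorphic_on {z. - (- Im v) < Im z}"
      unfolding qexp_def by (intro holomorphic_intros) auto
    fix z assume z: "0 \<le> Im z" "2 * norm v + 1 \<le> norm z"
    have "norm (qexp z) * norm (1 / ((z - v) * (z - v))) \<le> 1 * (4 / (norm z)\<^sup>2)"
    proof (intro mult_mono norm_qexp_le inv_prod_bound)
      show "0 < norm z" using z(2) norm_ge_zero[of v] by linarith
    qed (use z in auto)
    thus "norm (qexp z * (1 / (z - v)\<^sup>2)) \<le> 4 / (norm z)\<^sup>2" by (simp only: norm_mult power2_eq_square mult_1)
  qed (use assms in auto)
  show "PV (\<lambda>x. qexp (of_real x) * (1 / (of_real x - v))) 0"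
    using PV_qexp_parts[OF _ 1] assms by simp
qed

text \<open>The values are \<open>2 pi i\<close> times the residues at \<open>w\<close>, which are
  \<open>qexp' (w)\<close> for the double and \<open>qexp w\<close> for the simple pole. The
  principal part is subtracted and its principal values are added back.\<close>

lemma PV_qexp_upper:
  assumes "0 < Im w"
  shows "PV (\<lambda>x. qexp (of_real x) * (1 / (of_real x - w)\<^sup>2)) ((2 * of_real pi * \<i>)\<^sup>2 * qexp w)"
    "PV (\<lambda>x. qexp (of_real x) * (1 / (of_real x - w))) (2 * of_real pi * \<i> * qexp w)"
proof -
  define E1 where "E1 = 2 * of_real pi * \<i> * qexp w"
  \<comment> \<open>Two successive difference quotients at \<open>w\<close> remove the double pole,
    so \<open>g2\<close> is entire.\<close>
  define g1 where "g1 z = (if z = w then deriv qexp w else (qexp z - qexp w) / (z - w))" for z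
  define g2 where "g2 z = (if z = w then deriv g1 w else (g1 z - g1 w) / (z - w))" for z
  have "qexp holomorphic_on UNIV" unfolding qexp_def[abs_def] by (intro holomorphic_intros)
  hence "g1 holomorphic_on UNIV" unfolding g1_def[abs_def] by (intro pole_lemma) auto
  hence g2: "g2 holomorphic_on UNIV" unfolding g2_def[abs_def] by (intro pole_lemma) auto
  have dE: "deriv qexp w = E1" unfolding E1_def by (rule DERIV_imp_deriv[OF qexp_deriv])
  have g2eq: "g2 z = qexp z * (1 / (z - w)\<^sup>2) - qexp w * (1 / (z - w)\<^sup>2) - E1 * (1 / (z - w))" if "z \<noteq> w" for z
  proof -
    have "((A - B) / d - C) / d = A * (1 / d\<^sup>2) - B * (1 / d\<^sup>2) - C * (1 / d)" for A B C d :: complex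
      by (simp add: diff_divide_distrib power2_eq_square)
    thus ?thesis using that unfolding g2_def g1_def dE by simp
  qed
  \<comment> \<open>\<open>g2\<close> decays only like \<open>1 / z\<close> because of the simple
    pole that was subtracted. Adding the same pole at \<open>cnj w\<close>, below the real line,
    restores quadratic decay.\<close>
  define f where "f z = g2 z + E1 * (1 / (z - cnj w))" for z
  have feq: "f z = qexp z * (1 / ((z - w) * (z - w))) - qexp w * (1 / ((z - w) * (z - w)))
     - E1 * (w - cnj w) * (1 / ((z - w) * (z - cnj w)))" if "z \<noteq> w" "z \<noteq> cnj w" for z
  proof -
    have "1 / (z - w) - 1 / (z - cnj w) = (w - cnj w) * (1 / ((z - w) * (z - cnj w)))"
      using that by (simp add: divide_simps)
    hence "E1 * (1 / (z - w)) - E1 * (1 / (z - cnj w)) = E1 * (w - cnj w) * (1 / ((z - w) * (z - cnj w)))"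
      by (metis mult.assoc right_diff_distrib)
    thus ?thesis unfolding f_def g2eq[OF that(1)] by (simp add: power2_eq_square algebra_simps)
  qed
  have 0: "PV (\<lambda>x. f (of_real x)) 0"
  proof (rule PV_upper_zero[where \<eta> = "Im w" and rr = "2 * norm w + 1" and B = "(1 + norm (qexp w) + norm (E1 * (w - cnj w))) * 4"])
    show "f holomorphic_on {z. - Im w < Im z}"
      unfolding f_def[abs_def] by (intro holomorphic_intros holomorphic_on_subset[OF g2]) (auto simp: complex_eq_iff)
    fix z assume z: "0 \<le> Im z" "2 * norm w + 1 \<le> norm z"
    have z0: "0 < norm z" using z(2) norm_ge_zero[of w] by linarith
    have zw: "z \<noteq> w" "z \<noteq> cnj w" using z(2) norm_ge_zero[of w] by (auto simp del: norm_ge_zero)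
    define t where "t = 4 / (norm z)\<^sup>2"
    have b1: "norm (1 / ((z - w) * (z - w))) \<le> t" "norm (1 / ((z - w) * (z - cnj w))) \<le> t"
      using z z0 unfolding t_def by (intro inv_prod_bound; simp)+
    have t0: "0 \<le> t" by (simp add: t_def)
    have "norm (f z) \<le> norm (qexp z * (1 / ((z - w) * (z - w)))) + norm (qexp w * (1 / ((z - w) * (z - w))))
       + norm (E1 * (w - cnj w) * (1 / ((z - w) * (z - cnj w))))"
      unfolding feq[OF zw] by (intro order_trans[OF norm_triangle_ineq4] add_right_mono norm_triangle_ineq4)
    also have "\<dots> = norm (qexp z) * norm (1 / ((z - w) * (z - w))) + norm (qexp w) * norm (1 / ((z - w) * (z - w)))
       + norm (E1 * (w - cnj w)) * norm (1 / ((z - w) * (z - cnj w)))"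
      by (simp only: norm_mult)
    also have "\<dots> \<le> 1 * t + norm (qexp w) * t + norm (E1 * (w - cnj w)) * t"
      by (intro add_mono mult_mono b1 norm_qexp_le z t0) auto
    also have "\<dots> = (1 + norm (qexp w) + norm (E1 * (w - cnj w))) * 4 / (norm z)\<^sup>2"
      by (simp add: t_def algebra_simps add_divide_distrib)
    finally show "norm (f z) \<le> (1 + norm (qexp w) + norm (E1 * (w - cnj w))) * 4 / (norm z)\<^sup>2" .
  qed (use assms in auto)
  have c: "Im (cnj w) \<noteq> 0" "Im w \<noteq> 0" using assms by auto
  \<comment> \<open>The simple poles at \<open>w\<close> and \<open>cnj w\<close> have principal
    values of opposite sign, so their difference gives the full \<open>2 pi i\<close>.\<close>
  note 1 = PV_add[OF 0 PV_add[OF PV_cmult[OF PV_inverse_sq[OF c(2)], of "qexp w"]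
        PV_cmult[OF PV_diff[OF PV_inverse[OF c(2)] PV_inverse[OF c(1)]], of E1]]]
  show 2: "PV (\<lambda>x. qexp (of_real x) * (1 / (of_real x - w)\<^sup>2)) ((2 * of_real pi * \<i>)\<^sup>2 * qexp w)"
  proof (rule PV_cong[OF 1])
    fix x :: real
    have "of_real x \<noteq> w" using of_real_minus_nz[OF c(2), of x] by auto
    from g2eq[OF this]
    show "f (of_real x) + (qexp w * (1 / (of_real x - w)\<^sup>2) + E1 * (1 / (of_real x - w) - 1 / (of_real x - cnj w)))
      = qexp (of_real x) * (1 / (of_real x - w)\<^sup>2)"
      unfolding f_def by (simp add: algebra_simps)
    show "0 + (qexp w * 0 + E1 * (\<i> * of_real pi * of_real (sgn (Im w)) - \<i> * of_real pi * of_real (sgn (Im (cnj w))))) = (2 * of_real pi * \<i>)\<^sup>2 * qexp w"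
      using assms by (simp add: E1_def power2_eq_square algebra_simps)
  qed
  show "PV (\<lambda>x. qexp (of_real x) * (1 / (of_real x - w))) (2 * of_real pi * \<i> * qexp w)"
    by (rule PV_cong[OF PV_qexp_parts[OF c(2) 2]]) (auto simp: power2_eq_square)
qed

section \<open>The Jacobian of two single kernels on a horizontal line\<close>

text \<open>\<open>pquo_x\<close>, \<open>pquo_y\<close>, \<open>pjac\<close> are
  \<open>quo_x\<close>, \<open>quo_y\<close>, \<open>jac\<close> for single Poisson kernels;
  \<open>jac\<close> is bilinear in them.\<close>

definition pquo_x :: "int \<Rightarrow> complex \<Rightarrow> real" where
  "pquo_x n z = Im (pker1 n z) - Im (pker n z) / Im (hol z) * Im (hol1 z)"
definition pquo_y :: "int \<Rightarrow> complex \<Rightarrow> real" where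
  "pquo_y n z = Re (pker1 n z) - Im (pker n z) / Im (hol z) * Re (hol1 z)"
definition pjac :: "int \<Rightarrow> int \<Rightarrow> complex \<Rightarrow> real" where
  "pjac m n z = (pquo_x m z * pquo_y n z - pquo_y m z * pquo_x n z) / Im (hol z)"

text \<open>The principal value of \<open>pjac m n\<close> over the line at height \<open>y\<close>,
  with \<open>j = n - m\<close>. For \<open>y > 0\<close> the fraction with exponentials is
  \<open>4 * pi / (sinh (2 * pi * y))^2\<close>.\<close>

definition ker_flux :: "real \<Rightarrow> real \<Rightarrow> real" where
  "ker_flux j y = - (4 / pi) * Re (1 / Complex j (2 * y) ^ 3)
     + 16 * pi * (exp (- 2 * pi * y))\<^sup>2 / (1 - (exp (- 2 * pi * y))\<^sup>2)\<^sup>2 * (1 / j - Re (1 / Complex j (2 * y)))"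

text \<open>The hypothesis is the resolvent identity for \<open>u = 1 / (x - w)\<close>,
  \<open>v = 1 / (x - w')\<close> with \<open>k = w - w'\<close>.\<close>

lemma partial_fractions:
  fixes u v k :: complex
  assumes "u - v = k * (u * v)" "k \<noteq> 0"
  shows "u * v = (u - v) / k" "u\<^sup>2 * v = u\<^sup>2 / k - (u - v) / k\<^sup>2" "u * v\<^sup>2 = (u - v) / k\<^sup>2 - v\<^sup>2 / k"
    "u\<^sup>2 * v\<^sup>2 = (u\<^sup>2 + v\<^sup>2) / k\<^sup>2 - 2 * (u - v) / k ^ 3"
proof -
  show 1: "u * v = (u - v) / k" unfolding assms(1) using assms(2) by simp
  have "u\<^sup>2 * v = u * ((u - v) / k)" unfolding 1[symmetric] by (simp add: power2_eq_square)
  also have "\<dots> = u\<^sup>2 / k - u * v / k" by (simp add: power2_eq_square right_diff_distrib diff_divide_distrib)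
  finally show 2: "u\<^sup>2 * v = u\<^sup>2 / k - (u - v) / k\<^sup>2"
    unfolding 1 by (simp add: power2_eq_square)
  have "u * v\<^sup>2 = ((u - v) / k) * v" unfolding 1[symmetric] by (simp add: power2_eq_square)
  also have "\<dots> = u * v / k - v\<^sup>2 / k" by (simp add: power2_eq_square left_diff_distrib diff_divide_distrib)
  finally show "u * v\<^sup>2 = (u - v) / k\<^sup>2 - v\<^sup>2 / k"
    unfolding 1 by (simp add: power2_eq_square)
  have "u\<^sup>2 * v\<^sup>2 = (u * v)\<^sup>2" by (simp add: power_mult_distrib)
  also have "\<dots> = ((u - v) / k)\<^sup>2" unfolding 1 ..
  also have "\<dots> = (u\<^sup>2 + v\<^sup>2) / k\<^sup>2 - 2 * (u * v) / k\<^sup>2"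
    unfolding power_divide power2_diff by (simp add: diff_divide_distrib add_divide_distrib mult.assoc)
  also have "\<dots> = (u\<^sup>2 + v\<^sup>2) / k\<^sup>2 - 2 * (u - v) / k ^ 3"
    unfolding 1 by (simp add: diff_divide_distrib power2_eq_square power3_eq_cube mult.assoc)
  finally show "u\<^sup>2 * v\<^sup>2 = (u\<^sup>2 + v\<^sup>2) / k\<^sup>2 - 2 * (u - v) / k ^ 3" .
qed

text \<open>Simple and double poles at four points, with a common factor \<open>\<phi>\<close> that
  will be \<open>1\<close> or the oscillating exponential.\<close>

lemma PV_comb:
  assumes "PV (\<lambda>x. \<phi> x * a x) A1" "PV (\<lambda>x. \<phi> x * (a x)\<^sup>2) A2"
    "PV (\<lambda>x. \<phi> x * b x) B1" "PV (\<lambda>x. \<phi> x * (b x)\<^sup>2) B2"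
    "PV (\<lambda>x. \<phi> x * c x) C1" "PV (\<lambda>x. \<phi> x * (c x)\<^sup>2) C2"
    "PV (\<lambda>x. \<phi> x * d x) D1" "PV (\<lambda>x. \<phi> x * (d x)\<^sup>2) D2"
  shows "PV (\<lambda>x. \<phi> x * (a1 * a x + a2 * (a x)\<^sup>2 + b1 * b x + b2 * (b x)\<^sup>2 + c1 * c x + c2 * (c x)\<^sup>2
      + d1 * d x + d2 * (d x)\<^sup>2)) (a1 * A1 + a2 * A2 + b1 * B1 + b2 * B2 + c1 * C1 + c2 * C2 + d1 * D1 + d2 * D2)"
  by (rule PV_cong[OF PV_add[OF PV_add[OF PV_add[OF PV_add[OF PV_add[OF PV_add[OF PV_add[OF
      PV_cmult[OF assms(1), of a1] PV_cmult[OF assms(2), of a2]] PV_cmult[OF assms(3), of b1]]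
      PV_cmult[OF assms(4), of b2]] PV_cmult[OF assms(5), of c1]] PV_cmult[OF assms(6), of c2]]
      PV_cmult[OF assms(7), of d1]] PV_cmult[OF assms(8), of d2]]])
    (simp_all add: algebra_simps)

text \<open>On the line \<open>qexp z = e * q\<close> with \<open>q\<close> unimodular, so
  \<open>|1 - qexp z|^2\<close> is the trigonometric polynomial \<open>D\<close> of degree one and
  \<open>Im (hol z) = (1 - e^2) / D\<close>. In the ratios all denominators depending on
  \<open>x\<close> cancel.\<close>

lemma hol_ratios:
  fixes x y :: real
  defines "z \<equiv> Complex x y" and "e \<equiv> exp (- 2 * pi * y)" and "q \<equiv> qexp (of_real x)"
  assumes y: "0 < y"
  shows "1 / Im (hol z) = (1 + e\<^sup>2 - 2 * e * Re q) / (1 - e\<^sup>2)"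
    "Im (hol1 z) / (Im (hol z))\<^sup>2 = - 4 * pi * e * Im q / (1 - e\<^sup>2)"
    "Re (hol1 z) / (Im (hol z))\<^sup>2 = - 4 * pi * (e * (1 + e\<^sup>2) * Re q - 2 * e\<^sup>2) / (1 - e\<^sup>2)\<^sup>2"
proof -
  have e: "0 < e" "e < 1" using y by (auto simp: e_def)
  have e2: "1 - e\<^sup>2 \<noteq> 0" using e by (simp add: power2_eq_square mult_eq_1)
  define Q where "Q = qexp z"
  have Q: "Q = of_real e * q"
    unfolding Q_def e_def q_def qexp_def z_def exp_of_real[symmetric] exp_add[symmetric]
    by (simp add: Complex_eq algebra_simps)
  have nq: "(Re q)\<^sup>2 + (Im q)\<^sup>2 = 1"
    unfolding cmod_power2[symmetric] q_def by simp
  define D where "D = 1 + e\<^sup>2 - 2 * e * Re q"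
  have cn: "(1 - Q) * cnj (1 - Q) = of_real D"
  proof -
    have "Re ((1 - Q) * cnj (1 - Q)) = D"
    proof -
      have "Re ((1 - Q) * cnj (1 - Q)) = 1 - 2 * e * Re q + e\<^sup>2 * ((Re q)\<^sup>2 + (Im q)\<^sup>2)"
        unfolding Q by (simp add: power2_eq_square algebra_simps)
      thus ?thesis unfolding nq D_def by simp
    qed
    thus ?thesis by (simp add: complex_eq_iff)
  qed
  have nz: "1 - Q \<noteq> 0" unfolding Q_def using y by (simp add: z_def)
  hence D0: "D \<noteq> 0" using cn by auto
  have inv: "1 / (1 - Q) = cnj (1 - Q) / of_real D"
    using nz D0 cn by (simp add: field_simps)
  have "hol z = \<i> * ((1 + Q) * cnj (1 - Q)) / of_real D"
    unfolding hol_def Q_def[symmetric] using inv by (metis mult.assoc times_divide_eq_right mult_1_right)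
  hence "Im (hol z) = Re ((1 + Q) * cnj (1 - Q)) / D" by (simp add: Im_divide_of_real)
  also have "Re ((1 + Q) * cnj (1 - Q)) = 1 - e\<^sup>2 * ((Re q)\<^sup>2 + (Im q)\<^sup>2)"
    unfolding Q by (simp add: power2_eq_square algebra_simps)
  finally have h: "Im (hol z) = (1 - e\<^sup>2) / D" unfolding nq by simp
  thus "1 / Im (hol z) = (1 + e\<^sup>2 - 2 * e * Re q) / (1 - e\<^sup>2)" by (simp add: D_def)
  have "hol1 z = - 4 * of_real pi * (Q * (1 / (1 - Q))\<^sup>2)"
    unfolding hol1_def Q_def[symmetric] by (simp add: power_divide)
  also have "\<dots> = of_real (- 4 * pi / D\<^sup>2) * (Q * (cnj (1 - Q))\<^sup>2)"
    unfolding inv power_divide by simp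
  finally have h1: "hol1 z = of_real (- 4 * pi / D\<^sup>2) * (Q * (cnj (1 - Q))\<^sup>2)" .
  have "Im (Q * (cnj (1 - Q))\<^sup>2) = e * Im q - e * e\<^sup>2 * (Im q * ((Re q)\<^sup>2 + (Im q)\<^sup>2))"
    unfolding Q by (simp add: power2_eq_square algebra_simps)
  hence I: "Im (Q * (cnj (1 - Q))\<^sup>2) = e * Im q * (1 - e\<^sup>2)" unfolding nq by (simp add: algebra_simps)
  have "Re (Q * (cnj (1 - Q))\<^sup>2) = e * Re q - 2 * e\<^sup>2 * ((Re q)\<^sup>2 + (Im q)\<^sup>2) + e * e\<^sup>2 * (Re q * ((Re q)\<^sup>2 + (Im q)\<^sup>2))"
    unfolding Q by (simp add: power2_eq_square algebra_simps)
  hence R: "Re (Q * (cnj (1 - Q))\<^sup>2) = e * (1 + e\<^sup>2) * Re q - 2 * e\<^sup>2" unfolding nq by (simp add: algebra_simps)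
  have "Im (hol1 z) = - 4 * pi / D\<^sup>2 * (e * Im q * (1 - e\<^sup>2))" unfolding h1 I[symmetric] by simp
  thus "Im (hol1 z) / (Im (hol z))\<^sup>2 = - 4 * pi * e * Im q / (1 - e\<^sup>2)"
    unfolding h using D0 e2 by (simp add: power_divide power2_eq_square)
  have "Re (hol1 z) = - 4 * pi / D\<^sup>2 * (e * (1 + e\<^sup>2) * Re q - 2 * e\<^sup>2)" unfolding h1 R[symmetric] by simp
  thus "Re (hol1 z) / (Im (hol z))\<^sup>2 = - 4 * pi * (e * (1 + e\<^sup>2) * Re q - 2 * e\<^sup>2) / (1 - e\<^sup>2)\<^sup>2"
    unfolding h using D0 by (simp add: power_divide)
qed

text \<open>In the determinant the products of two undifferentiated kernels cancel; the rest are
  ratios from \<open>hol_ratios\<close> times real rational functions. Because these functions are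
  real, the real part can be taken outside, and only \<open>q\<close>, which is bounded in the upper
  half-plane, occurs and not its conjugate.\<close>

lemma pjac_expand:
  fixes x y :: real and m n :: int
  defines "z \<equiv> Complex x y" and "e \<equiv> exp (- 2 * pi * y)" and "q \<equiv> qexp (of_real x)"
  defines "a \<equiv> 1 / (z - of_int m)" and "c \<equiv> 1 / (z - of_int n)"
  defines "b \<equiv> cnj a" and "d \<equiv> cnj c"
  assumes y: "0 < y"
  shows "pjac m n z = Re ((of_real (1 + e\<^sup>2) - 2 * of_real e * q) / of_real (1 - e\<^sup>2)
        * (\<i> / (2 * of_real pi * of_real pi) * (b\<^sup>2 * c\<^sup>2 - a\<^sup>2 * d\<^sup>2))
      - 4 * of_real pi * of_real e * \<i> * q / of_real (1 - e\<^sup>2)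
        * (\<i> / (4 * of_real pi * of_real pi) * ((a - b) * (c\<^sup>2 + d\<^sup>2) - (c - d) * (a\<^sup>2 + b\<^sup>2)))
      - 4 * of_real pi * (of_real (e * (1 + e\<^sup>2)) * q - of_real (2 * e\<^sup>2)) / of_real ((1 - e\<^sup>2)\<^sup>2)
        * (- 1 / (4 * of_real pi * of_real pi) * ((a - b) * (d\<^sup>2 - c\<^sup>2) - (c - d) * (b\<^sup>2 - a\<^sup>2))))"
proof -
  define P where "P = Im (pker m z)" define P' where "P' = Im (pker n z)"
  define X where "X = Im (pker1 m z)" define X' where "X' = Im (pker1 n z)"
  define Y where "Y = Re (pker1 m z)" define Y' where "Y' = Re (pker1 n z)"
  define h where "h = Im (hol z)"
  have h: "h \<noteq> 0" using Im_hol_bounds(2)[of z] y by (simp add: h_def z_def)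
  have k: "pker m z = - a / of_real pi" "pker n z = - c / of_real pi"
    "pker1 m z = a\<^sup>2 / of_real pi" "pker1 n z = c\<^sup>2 / of_real pi"
    by (simp_all add: pker_def pker1_def a_def c_def power_divide)
  have im: "complex_of_real (Im w) = (w - cnj w) / (2 * \<i>)" and re: "complex_of_real (Re w) = (w + cnj w) / 2" for w
    by (simp_all add: complex_eq_iff)
  have c1: "of_real P = \<i> / (2 * of_real pi) * (a - b)" "of_real P' = \<i> / (2 * of_real pi) * (c - d)"
    "of_real X = \<i> / (2 * of_real pi) * (b\<^sup>2 - a\<^sup>2)" "of_real X' = \<i> / (2 * of_real pi) * (d\<^sup>2 - c\<^sup>2)"
    "of_real Y = 1 / (2 * of_real pi) * (a\<^sup>2 + b\<^sup>2)" "of_real Y' = 1 / (2 * of_real pi) * (c\<^sup>2 + d\<^sup>2)"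
    unfolding P_def P'_def X_def X'_def Y_def Y'_def im re k b_def d_def
    by (simp_all add: field_simps)
  have Q1: "of_real (X * Y' - Y * X') = \<i> / (2 * of_real pi * of_real pi) * (b\<^sup>2 * c\<^sup>2 - a\<^sup>2 * d\<^sup>2)"
    unfolding of_real_diff of_real_mult c1 by (simp add: field_simps)
  have Q2: "of_real (P * Y' - P' * Y) = \<i> / (4 * of_real pi * of_real pi) * ((a - b) * (c\<^sup>2 + d\<^sup>2) - (c - d) * (a\<^sup>2 + b\<^sup>2))"
    unfolding of_real_diff of_real_mult c1 by (simp add: field_simps)
  have Q3: "of_real (P * X' - P' * X) = - 1 / (4 * of_real pi * of_real pi) * ((a - b) * (d\<^sup>2 - c\<^sup>2) - (c - d) * (b\<^sup>2 - a\<^sup>2))"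
    unfolding of_real_diff of_real_mult c1 by (simp add: field_simps)
  have "pjac m n z = 1 / h * (X * Y' - Y * X') - Im (hol1 z) / h\<^sup>2 * (P * Y' - P' * Y)
      + Re (hol1 z) / h\<^sup>2 * (P * X' - P' * X)"
    unfolding pjac_def pquo_x_def pquo_y_def P_def[symmetric] P'_def[symmetric] X_def[symmetric] X'_def[symmetric]
      Y_def[symmetric] Y'_def[symmetric] h_def[symmetric]
    using h by (simp add: power2_eq_square divide_simps) (simp add: algebra_simps)
  also have "\<dots> = (1 + e\<^sup>2 - 2 * e * Re q) / (1 - e\<^sup>2) * (X * Y' - Y * X')
      - (- 4 * pi * e * Im q / (1 - e\<^sup>2)) * (P * Y' - P' * Y)
      + (- 4 * pi * (e * (1 + e\<^sup>2) * Re q - 2 * e\<^sup>2) / (1 - e\<^sup>2)\<^sup>2) * (P * X' - P' * X)"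
    using hol_ratios[OF y, of x] unfolding h_def z_def e_def q_def by simp
  also have "\<dots> = Re ((of_real (1 + e\<^sup>2) - 2 * of_real e * q) / of_real (1 - e\<^sup>2) * of_real (X * Y' - Y * X')
      - 4 * of_real pi * of_real e * \<i> * q / of_real (1 - e\<^sup>2) * of_real (P * Y' - P' * Y)
      - 4 * of_real pi * (of_real (e * (1 + e\<^sup>2)) * q - of_real (2 * e\<^sup>2)) / of_real ((1 - e\<^sup>2)\<^sup>2) * of_real (P * X' - P' * X))"
  proof -
    have r: "Re (w / of_real s * of_real t) = Re w / s * t" for w s t by (simp add: Re_divide_of_real)
    show ?thesis unfolding minus_complex.sel r by (simp add: divide_inverse algebra_simps)
  qed
  finally show ?thesis unfolding Q1 Q2 Q3 .
qed

text \<open>Partial fractions in the four poles \<open>m - i y\<close>, \<open>m + i y\<close>,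
  \<open>n - i y\<close>, \<open>n + i y\<close>, followed by principal values term by term.\<close>

lemma PV_pjac:
  fixes m n :: int
  assumes y: "0 < y" and mn: "m \<noteq> n"
  shows "(\<lambda>N. integral {- real N..real N} (\<lambda>x. pjac m n (Complex x y))) \<longlonglongrightarrow> ker_flux (of_int (n - m)) y"
proof -
  define e where "e = exp (- 2 * pi * y)"
  define w1 where "w1 = Complex m y" define w2 where "w2 = Complex n y"
  define v1 where "v1 = Complex m (- y)" define v2 where "v2 = Complex n (- y)"
  define a where "a x = 1 / (of_real x - v1)" for x :: real
  define b where "b x = 1 / (of_real x - w1)" for x :: real
  define c where "c x = 1 / (of_real x - v2)" for x :: real
  define d where "d x = 1 / (of_real x - w2)" for x :: real
  \<comment> \<open>The differences of the poles: \<open>\<omega> = n - m + 2 i y\<close>,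
    \<open>\<delta> = m - n + 2 i y\<close>, and \<open>\<nu> = n - m\<close> for the upper pair as
    well as for the lower pair.\<close>
  define \<omega> where "\<omega> = w2 - v1" define \<delta> where "\<delta> = w1 - v2" define \<nu> where "\<nu> = w2 - w1"
  have nz: "\<omega> \<noteq> 0" "\<delta> \<noteq> 0" "\<nu> \<noteq> 0"
    using y mn by (auto simp: \<omega>_def \<delta>_def \<nu>_def w1_def w2_def v1_def v2_def complex_eq_iff)
  have rn: "of_real x - v1 \<noteq> 0" "of_real x - w1 \<noteq> 0" "of_real x - v2 \<noteq> 0" "of_real x - w2 \<noteq> 0" for x :: real
    using y by (auto simp: w1_def w2_def v1_def v2_def complex_eq_iff)
  have \<nu>': "\<nu> = v2 - v1" by (simp add: \<nu>_def w1_def w2_def v1_def v2_def complex_eq_iff)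
  have diff: "1 / s - 1 / t = (t - s) * (1 / s * (1 / t))" if "s \<noteq> 0" "t \<noteq> 0" for s t :: complex
    using that by (simp add: field_simps)
  have "b x - c x = \<delta> * (b x * c x)" "d x - a x = \<omega> * (d x * a x)" for x
    unfolding a_def b_def c_def d_def diff[OF rn(2,3)] diff[OF rn(4,1)]
    by (simp_all add: \<omega>_def \<delta>_def)
  moreover have "c x - a x = \<nu> * (c x * a x)" for x
    unfolding a_def c_def diff[OF rn(3,1)] by (simp add: \<nu>')
  moreover have "d x - b x = \<nu> * (d x * b x)" for x
    unfolding b_def d_def diff[OF rn(4,2)] by (simp add: \<nu>_def)
  ultimately have "b x - c x = \<delta> * (b x * c x)" "d x - a x = \<omega> * (d x * a x)"
    "c x - a x = \<nu> * (c x * a x)" "d x - b x = \<nu> * (d x * b x)" for x by blast+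
  note bc = partial_fractions[OF this(1) nz(2)] and da = partial_fractions[OF this(2) nz(1)]
    and ca = partial_fractions[OF this(3) nz(3)] and db = partial_fractions[OF this(4) nz(3)]
  have Q1: "(b x)\<^sup>2 * (c x)\<^sup>2 - (a x)\<^sup>2 * (d x)\<^sup>2 = (- 2 / \<omega> ^ 3) * a x + (- 1 / \<omega>\<^sup>2) * (a x)\<^sup>2
     + (- 2 / \<delta> ^ 3) * b x + 1 / \<delta>\<^sup>2 * (b x)\<^sup>2 + 2 / \<delta> ^ 3 * c x + 1 / \<delta>\<^sup>2 * (c x)\<^sup>2
     + 2 / \<omega> ^ 3 * d x + (- 1 / \<omega>\<^sup>2) * (d x)\<^sup>2" for x
  proof -
    have "(b x)\<^sup>2 * (c x)\<^sup>2 - (a x)\<^sup>2 * (d x)\<^sup>2 = (b x)\<^sup>2 * (c x)\<^sup>2 - (d x)\<^sup>2 * (a x)\<^sup>2" by (simp add: mult.commute)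
    thus ?thesis unfolding bc(4) da(4) by (simp add: divide_inverse algebra_simps)
  qed
  have Q2: "(a x - b x) * ((c x)\<^sup>2 + (d x)\<^sup>2) - (c x - d x) * ((a x)\<^sup>2 + (b x)\<^sup>2) = 2 / \<nu>\<^sup>2 * a x + (1 / \<nu> - 1 / \<omega>) * (a x)\<^sup>2
     + (- 2 / \<nu>\<^sup>2) * b x + (- 1 / \<delta> - 1 / \<nu>) * (b x)\<^sup>2 + (- 2 / \<nu>\<^sup>2) * c x + (1 / \<nu> + 1 / \<delta>) * (c x)\<^sup>2
     + 2 / \<nu>\<^sup>2 * d x + (1 / \<omega> - 1 / \<nu>) * (d x)\<^sup>2" for x
  proof -
    have "(a x - b x) * ((c x)\<^sup>2 + (d x)\<^sup>2) - (c x - d x) * ((a x)\<^sup>2 + (b x)\<^sup>2)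
      = (c x)\<^sup>2 * a x + (d x)\<^sup>2 * a x - b x * (c x)\<^sup>2 - (d x)\<^sup>2 * b x
       - c x * (a x)\<^sup>2 - (b x)\<^sup>2 * c x + d x * (a x)\<^sup>2 + d x * (b x)\<^sup>2" by (simp add: algebra_simps)
    thus ?thesis unfolding bc(2,3) da(2,3) ca(2,3) db(2,3) by (simp add: divide_inverse algebra_simps)
  qed
  have Q3: "(a x - b x) * ((d x)\<^sup>2 - (c x)\<^sup>2) - (c x - d x) * ((b x)\<^sup>2 - (a x)\<^sup>2)
     = (2 / \<omega>\<^sup>2 - 2 / \<nu>\<^sup>2) * a x + (1 / \<omega> - 1 / \<nu>) * (a x)\<^sup>2
     + (2 / \<delta>\<^sup>2 - 2 / \<nu>\<^sup>2) * b x + (- 1 / \<delta> - 1 / \<nu>) * (b x)\<^sup>2 + (2 / \<nu>\<^sup>2 - 2 / \<delta>\<^sup>2) * c x + (- 1 / \<nu> - 1 / \<delta>) * (c x)\<^sup>2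
     + (2 / \<nu>\<^sup>2 - 2 / \<omega>\<^sup>2) * d x + (1 / \<omega> - 1 / \<nu>) * (d x)\<^sup>2" for x
  proof -
    have "(a x - b x) * ((d x)\<^sup>2 - (c x)\<^sup>2) - (c x - d x) * ((b x)\<^sup>2 - (a x)\<^sup>2)
      = (d x)\<^sup>2 * a x - (c x)\<^sup>2 * a x - (d x)\<^sup>2 * b x + b x * (c x)\<^sup>2
       - (b x)\<^sup>2 * c x + c x * (a x)\<^sup>2 + d x * (b x)\<^sup>2 - d x * (a x)\<^sup>2" by (simp add: algebra_simps)
    thus ?thesis unfolding bc(2,3) da(2,3) ca(2,3) db(2,3) by (simp add: divide_inverse algebra_simps)
  qed
  have im: "Im v1 < 0" "0 < Im w1" "Im v2 < 0" "0 < Im w2" using y by (simp_all add: w1_def w2_def v1_def v2_def)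
  hence im0: "Im v1 \<noteq> 0" "Im w1 \<noteq> 0" "Im v2 \<noteq> 0" "Im w2 \<noteq> 0" by auto
  have sq: "(1 / w)\<^sup>2 = 1 / w\<^sup>2" for w :: complex by (simp add: power_divide)
  have qw: "qexp w1 = of_real e" "qexp w2 = of_real e"
  proof -
    have "qexp (Complex (of_int k) y) = of_real e" for k
    proof -
      have "qexp (Complex (of_int k) y) = exp (2 * of_int k * of_real pi * \<i>) * exp (of_real (- 2 * pi * y))"
        unfolding qexp_def exp_add[symmetric] by (simp add: Complex_eq algebra_simps)
      also have "exp (2 * of_int k * of_real pi * \<i>) = 1"
        using exp_integer_2pi[of "of_int k"] by (simp add: mult_ac)
      finally show ?thesis by (simp only: mult_1 exp_of_real e_def)
    qed
    thus "qexp w1 = of_real e" "qexp w2 = of_real e" unfolding w1_def w2_def by simp_all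
  qed
  have one: "PV (\<lambda>x. 1 * (a x)) (- (\<i> * of_real pi))" "PV (\<lambda>x. 1 * (a x)\<^sup>2) 0"
      "PV (\<lambda>x. 1 * (b x)) (\<i> * of_real pi)" "PV (\<lambda>x. 1 * (b x)\<^sup>2) 0"
      "PV (\<lambda>x. 1 * (c x)) (- (\<i> * of_real pi))" "PV (\<lambda>x. 1 * (c x)\<^sup>2) 0"
      "PV (\<lambda>x. 1 * (d x)) (\<i> * of_real pi)" "PV (\<lambda>x. 1 * (d x)\<^sup>2) 0"
    unfolding a_def b_def c_def d_def sq mult_1
    using PV_inverse[OF im0(1)] PV_inverse[OF im0(2)] PV_inverse[OF im0(3)] PV_inverse[OF im0(4)] im
      PV_inverse_sq[OF im0(1)] PV_inverse_sq[OF im0(2)] PV_inverse_sq[OF im0(3)] PV_inverse_sq[OF im0(4)]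
    by simp_all
  define q where "q x = qexp (of_real x)" for x
  \<comment> \<open>With the oscillating factor the poles below the line contribute nothing, and at
    both poles above it \<open>qexp\<close> has the same value \<open>e\<close>, since their real
    parts are integers.\<close>
  have osc: "PV (\<lambda>x. q x * (a x)) 0" "PV (\<lambda>x. q x * (a x)\<^sup>2) 0"
      "PV (\<lambda>x. q x * (b x)) (2 * of_real pi * \<i> * of_real e)" "PV (\<lambda>x. q x * (b x)\<^sup>2) ((2 * of_real pi * \<i>)\<^sup>2 * of_real e)"
      "PV (\<lambda>x. q x * (c x)) 0" "PV (\<lambda>x. q x * (c x)\<^sup>2) 0"
      "PV (\<lambda>x. q x * (d x)) (2 * of_real pi * \<i> * of_real e)" "PV (\<lambda>x. q x * (d x)\<^sup>2) ((2 * of_real pi * \<i>)\<^sup>2 * of_real e)"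
    unfolding a_def b_def c_def d_def q_def sq
    using PV_qexp_lower[OF im(1)] PV_qexp_lower[OF im(3)] PV_qexp_upper[OF im(2)] PV_qexp_upper[OF im(4)]
    unfolding qw by simp_all
  have e: "0 < e" "e < 1" using y by (auto simp: e_def)
  hence "e\<^sup>2 < 1" by (simp add: power_less_one_iff)
  hence e2: "1 - e\<^sup>2 \<noteq> 0" by simp
  define \<rho> where "\<rho> = complex_of_real pi"
  define \<epsilon> where "\<epsilon> = complex_of_real e"
  have \<rho>: "\<rho> \<noteq> 0" by (simp add: \<rho>_def)
  have \<epsilon>: "1 - \<epsilon>\<^sup>2 \<noteq> 0" using e2 unfolding \<epsilon>_def by (metis of_real_0 of_real_1 of_real_diff of_real_eq_iff of_real_power)
  define f1 where "f1 x = (b x)\<^sup>2 * (c x)\<^sup>2 - (a x)\<^sup>2 * (d x)\<^sup>2" for x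
  define f2 where "f2 x = (a x - b x) * ((c x)\<^sup>2 + (d x)\<^sup>2) - (c x - d x) * ((a x)\<^sup>2 + (b x)\<^sup>2)" for x
  define f3 where "f3 x = (a x - b x) * ((d x)\<^sup>2 - (c x)\<^sup>2) - (c x - d x) * ((b x)\<^sup>2 - (a x)\<^sup>2)" for x
  define A where "A = 1 / \<omega> ^ 3 - 1 / \<delta> ^ 3"
  define B where "B = 1 / \<delta>\<^sup>2 - 1 / \<omega>\<^sup>2"
  define D where "D = 1 / \<omega> - 1 / \<delta> - 2 / \<nu>"
  have I1: "PV (\<lambda>x. 1 * f1 x) (4 * \<i> * \<rho> * A)"
    unfolding f1_def Q1 by (rule PV_cong[OF PV_comb[OF one]], rule refl) (simp_all add: A_def B_def D_def \<rho>_def algebra_simps)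
  have I3: "PV (\<lambda>x. 1 * f3 x) (4 * \<i> * \<rho> * B)"
    unfolding f3_def Q3 by (rule PV_cong[OF PV_comb[OF one]], rule refl) (simp_all add: A_def B_def D_def \<rho>_def algebra_simps)
  have E1: "PV (\<lambda>x. q x * f1 x) (2 * \<rho> * \<i> * \<epsilon> * (2 * A + 2 * \<rho> * \<i> * B))"
    unfolding f1_def Q1 by (rule PV_cong[OF PV_comb[OF osc]], rule refl) (simp_all add: A_def B_def D_def \<rho>_def \<epsilon>_def power2_eq_square algebra_simps)
  have E2: "PV (\<lambda>x. q x * f2 x) (2 * \<rho> * \<i> * \<epsilon> * (2 * \<rho> * \<i> * D))"
    unfolding f2_def Q2 by (rule PV_cong[OF PV_comb[OF osc]], rule refl) (simp_all add: A_def B_def D_def \<rho>_def \<epsilon>_def power2_eq_square algebra_simps)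
  have E3: "PV (\<lambda>x. q x * f3 x) (2 * \<rho> * \<i> * \<epsilon> * (2 * B + 2 * \<rho> * \<i> * D))"
    unfolding f3_def Q3 by (rule PV_cong[OF PV_comb[OF osc]], rule refl) (simp_all add: A_def B_def D_def \<rho>_def \<epsilon>_def power2_eq_square algebra_simps)
  define T where "T = - (2 / \<rho>) * (1 / \<omega> ^ 3 - 1 / \<delta> ^ 3)
      + 16 * \<rho> * \<epsilon>\<^sup>2 / (1 - \<epsilon>\<^sup>2)\<^sup>2 * (1 / \<nu> - (1 / \<omega> - 1 / \<delta>) / 2)"
  define G where "G x = (of_real (1 + e\<^sup>2) - 2 * of_real e * q x) / of_real (1 - e\<^sup>2)
        * (\<i> / (2 * of_real pi * of_real pi) * f1 x)
      - 4 * of_real pi * of_real e * \<i> * q x / of_real (1 - e\<^sup>2)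
        * (\<i> / (4 * of_real pi * of_real pi) * f2 x)
      - 4 * of_real pi * (of_real (e * (1 + e\<^sup>2)) * q x - of_real (2 * e\<^sup>2)) / of_real ((1 - e\<^sup>2)\<^sup>2)
        * (- 1 / (4 * of_real pi * of_real pi) * f3 x)" for x
  have "PV G T"
  proof (rule PV_cong[OF PV_add[OF PV_add[OF PV_add[OF PV_add[OF
          PV_cmult[OF I1, of "(1 + \<epsilon>\<^sup>2) / (1 - \<epsilon>\<^sup>2) * (\<i> / (2 * \<rho> * \<rho>))"]
          PV_cmult[OF E1, of "- (2 * \<epsilon> / (1 - \<epsilon>\<^sup>2)) * (\<i> / (2 * \<rho> * \<rho>))"]]
          PV_cmult[OF E2, of "\<epsilon> / (1 - \<epsilon>\<^sup>2) / \<rho>"]]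
          PV_cmult[OF E3, of "\<epsilon> * (1 + \<epsilon>\<^sup>2) / (1 - \<epsilon>\<^sup>2)\<^sup>2 / \<rho>"]]
          PV_cmult[OF I3, of "- 2 * \<epsilon>\<^sup>2 / (1 - \<epsilon>\<^sup>2)\<^sup>2 / \<rho>"]]])
    fix x
    have r: "of_real (1 + e\<^sup>2) = 1 + \<epsilon>\<^sup>2" "of_real (1 - e\<^sup>2) = 1 - \<epsilon>\<^sup>2" "complex_of_real e = \<epsilon>" "complex_of_real pi = \<rho>"
      "of_real (e * (1 + e\<^sup>2)) = \<epsilon> * (1 + \<epsilon>\<^sup>2)" "of_real (2 * e\<^sup>2) = 2 * \<epsilon>\<^sup>2" "of_real ((1 - e\<^sup>2)\<^sup>2) = (1 - \<epsilon>\<^sup>2)\<^sup>2"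
      by (simp_all add: \<epsilon>_def \<rho>_def)
    have "C / s * (\<i> / (2 * P * P)) * (1 * F1) + - (2 * t / s) * (\<i> / (2 * P * P)) * (Q * F1)
        + t / s / P * (Q * F2) + t * C / s\<^sup>2 / P * (Q * F3) + - 2 * t\<^sup>2 / s\<^sup>2 / P * (1 * F3)
      = (C - 2 * t * Q) / s * (\<i> / (2 * P * P) * F1) - 4 * P * t * \<i> * Q / s * (\<i> / (4 * P * P) * F2)
       - 4 * P * (t * C * Q - 2 * t\<^sup>2) / s\<^sup>2 * (- 1 / (4 * P * P) * F3)"
      if "s \<noteq> 0" "P \<noteq> 0" for C s t P Q F1 F2 F3
      using that by (simp add: field_simps power2_eq_square)
    from this[OF \<epsilon> \<rho>, of "1 + \<epsilon>\<^sup>2" "f1 x" \<epsilon> "q x" "f2 x" "f3 x"]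
    show "(1 + \<epsilon>\<^sup>2) / (1 - \<epsilon>\<^sup>2) * (\<i> / (2 * \<rho> * \<rho>)) * (1 * f1 x) + - (2 * \<epsilon> / (1 - \<epsilon>\<^sup>2)) * (\<i> / (2 * \<rho> * \<rho>)) * (q x * f1 x)
        + \<epsilon> / (1 - \<epsilon>\<^sup>2) / \<rho> * (q x * f2 x) + \<epsilon> * (1 + \<epsilon>\<^sup>2) / (1 - \<epsilon>\<^sup>2)\<^sup>2 / \<rho> * (q x * f3 x)
        + - 2 * \<epsilon>\<^sup>2 / (1 - \<epsilon>\<^sup>2)\<^sup>2 / \<rho> * (1 * f3 x) = G x"
      unfolding G_def r .
  next
    \<comment> \<open>With \<open>s = 1 - \<epsilon>^2\<close> both sides become rational in
      \<open>s\<close>, because \<open>\<epsilon>\<close> occurs only through its square.\<close>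
    define s where "s = 1 - \<epsilon>\<^sup>2"
    have s: "s \<noteq> 0" using \<epsilon> by (simp add: s_def)
    have C: "1 + \<epsilon>\<^sup>2 = 2 - s" "\<epsilon>\<^sup>2 = 1 - s" by (simp_all add: s_def)
    have "(2 - s) / s * (\<i> / (2 * P * P)) * (4 * \<i> * P * A) + - (2 * t / s) * (\<i> / (2 * P * P)) * (2 * P * \<i> * t * (2 * A + 2 * P * \<i> * B))
        + t / s / P * (2 * P * \<i> * t * (2 * P * \<i> * D)) + t * (2 - s) / s\<^sup>2 / P * (2 * P * \<i> * t * (2 * B + 2 * P * \<i> * D))
        + - 2 * (1 - s) / s\<^sup>2 / P * (4 * \<i> * P * B)
        = - (2 / P) * A - 8 * P * (1 - s) / s\<^sup>2 * D"
      if "t * t = 1 - s" "P \<noteq> 0" for P A B D t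
    proof -
      have 1: "- (2 * t / s) * (\<i> / (2 * P * P)) * (2 * P * \<i> * t * (2 * A + 2 * P * \<i> * B))
        = 2 * (t * t) / (s * P) * (2 * A + 2 * P * \<i> * B)"
        using that(2) s by (simp add: field_simps)
      have 2: "t / s / P * (2 * P * \<i> * t * (2 * P * \<i> * D)) = - 4 * P * (t * t) / s * D"
        using that(2) s by (simp add: field_simps)
      have 3: "t * (2 - s) / s\<^sup>2 / P * (2 * P * \<i> * t * (2 * B + 2 * P * \<i> * D))
        = (t * t) * (2 - s) / s\<^sup>2 * (4 * \<i> * B - 4 * P * D)"
        using that(2) s by (simp add: field_simps power2_eq_square)
      have 4: "(2 - s) / s * (\<i> / (2 * P * P)) * (4 * \<i> * P * A) = - 2 * (2 - s) / (s * P) * A"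
        using that(2) s by (simp add: field_simps)
      have 5: "- 2 * (1 - s) / s\<^sup>2 / P * (4 * \<i> * P * B) = - 8 * \<i> * (1 - s) / s\<^sup>2 * B"
        using that(2) s by (simp add: field_simps)
      show ?thesis unfolding 1 2 3 4 5 that(1)
        using that(2) s by (simp add: divide_simps) (simp add: algebra_simps power2_eq_square)
    qed
    note gen = this
    have ss: "1 - (1 - s) = s" by simp
    have tt: "\<epsilon> * \<epsilon> = 1 - s" using C(2) unfolding power2_eq_square .
    have "(2 - s) / s * (\<i> / (2 * \<rho> * \<rho>)) * (4 * \<i> * \<rho> * A) + - (2 * \<epsilon> / s) * (\<i> / (2 * \<rho> * \<rho>)) * (2 * \<rho> * \<i> * \<epsilon> * (2 * A + 2 * \<rho> * \<i> * B))
        + \<epsilon> / s / \<rho> * (2 * \<rho> * \<i> * \<epsilon> * (2 * \<rho> * \<i> * D)) + \<epsilon> * (2 - s) / s\<^sup>2 / \<rho> * (2 * \<rho> * \<i> * \<epsilon> * (2 * B + 2 * \<rho> * \<i> * D))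
        + - 2 * (1 - s) / s\<^sup>2 / \<rho> * (4 * \<i> * \<rho> * B)
        = - (2 / \<rho>) * A - 8 * \<rho> * (1 - s) / s\<^sup>2 * D"
      by (rule gen[OF tt \<rho>])
    moreover have "T = - (2 / \<rho>) * A - 8 * \<rho> * (1 - s) / s\<^sup>2 * D"
    proof -
      have "U - (X - Y) / 2 = - (X - Y - 2 * U) / 2" for U X Y :: complex by (simp add: field_simps)
      from this[of "1 / \<nu>" "1 / \<omega>" "1 / \<delta>"]
      have "1 / \<nu> - (1 / \<omega> - 1 / \<delta>) / 2 = - D / 2" by (simp add: D_def)
      hence "T = - (2 / \<rho>) * A + 16 * \<rho> * (1 - s) / s\<^sup>2 * (- D / 2)"
        unfolding T_def s_def[symmetric] A_def[symmetric] C(2) ss by (simp only:)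
      thus ?thesis by simp
    qed
    ultimately show "(1 + \<epsilon>\<^sup>2) / (1 - \<epsilon>\<^sup>2) * (\<i> / (2 * \<rho> * \<rho>)) * (4 * \<i> * \<rho> * A)
      + - (2 * \<epsilon> / (1 - \<epsilon>\<^sup>2)) * (\<i> / (2 * \<rho> * \<rho>)) * (2 * \<rho> * \<i> * \<epsilon> * (2 * A + 2 * \<rho> * \<i> * B))
      + \<epsilon> / (1 - \<epsilon>\<^sup>2) / \<rho> * (2 * \<rho> * \<i> * \<epsilon> * (2 * \<rho> * \<i> * D))
      + \<epsilon> * (1 + \<epsilon>\<^sup>2) / (1 - \<epsilon>\<^sup>2)\<^sup>2 / \<rho> * (2 * \<rho> * \<i> * \<epsilon> * (2 * B + 2 * \<rho> * \<i> * D))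
      + - 2 * \<epsilon>\<^sup>2 / (1 - \<epsilon>\<^sup>2)\<^sup>2 / \<rho> * (4 * \<i> * \<rho> * B) = T"
      unfolding C ss by simp
  qed
  hence G: "continuous_on UNIV G" "(\<lambda>N. integral {- real N..real N} G) \<longlonglongrightarrow> T" unfolding PV_def by auto
  have "pjac m n (Complex x y) = Re (G x)" for x
  proof -
    have "1 / (Complex x y - of_int m) = a x" "1 / (Complex x y - of_int n) = c x"
      unfolding a_def c_def v1_def v2_def by (simp_all add: Complex_eq algebra_simps)
    moreover have "cnj (a x) = b x" "cnj (c x) = d x"
      unfolding a_def b_def c_def d_def v1_def v2_def w1_def w2_def by (simp_all add: Complex_eq)
    ultimately show ?thesis
      unfolding pjac_expand[OF y] G_def f1_def f2_def f3_def q_def e_def by simp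
  qed
  moreover have "integral {- real N..real N} (\<lambda>x. Re (G x)) = Re (integral {- real N..real N} G)" for N
    using integral_linear[of G "{- real N..real N}" Re] G(1) continuous_on_subset[OF G(1)]
    by (simp add: o_def bounded_linear_Re integrable_continuous_real)
  ultimately have "(\<lambda>N. integral {- real N..real N} (\<lambda>x. pjac m n (Complex x y))) \<longlonglongrightarrow> Re T"
    using tendsto_Re[OF G(2)] by simp
  moreover have "Re T = ker_flux (of_int (n - m)) y"
  proof -
    define j where "j = real_of_int (n - m)"
    have w: "\<omega> = Complex j (2 * y)" "\<nu> = of_real j" "\<delta> = - cnj (Complex j (2 * y))"
      by (simp_all add: \<omega>_def \<nu>_def \<delta>_def w1_def w2_def v1_def v2_def j_def complex_eq_iff)
    define W where "W = 1 / Complex j (2 * y)"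
    define W3 where "W3 = 1 / Complex j (2 * y) ^ 3"
    have neg: "1 / - cnj z = - cnj (1 / z)" "1 / (- cnj z) ^ 3 = - cnj (1 / z ^ 3)" for z
      by (simp_all add: power3_eq_cube)
    have "T = - (2 / \<rho>) * (W3 - - cnj W3) + 16 * \<rho> * \<epsilon>\<^sup>2 / (1 - \<epsilon>\<^sup>2)\<^sup>2 * (1 / of_real j - (W - - cnj W) / 2)"
      unfolding T_def w neg W_def W3_def ..
    also have "\<dots> = of_real (- (2 / pi) * (2 * Re W3) + 16 * pi * e\<^sup>2 / (1 - e\<^sup>2)\<^sup>2 * (1 / j - Re W))"
      unfolding \<rho>_def \<epsilon>_def by (simp add: complex_add_cnj)
    finally have "Re T = - (2 / pi) * (2 * Re W3) + 16 * pi * e\<^sup>2 / (1 - e\<^sup>2)\<^sup>2 * (1 / j - Re W)"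
      by (simp only: Re_complex_of_real)
    thus ?thesis unfolding ker_flux_def j_def[symmetric] e_def W_def W3_def by simp
  qed
  ultimately show ?thesis by simp
qed

subsection \<open>Integration over the height\<close>

text \<open>Monotone convergence along \<open>[0, k]\<close>; the bounded antiderivative bounds the
  integrals.\<close>

lemma improper_integrable:
  fixes f R :: "real \<Rightarrow> real"
  assumes "\<And>x. 0 \<le> x \<Longrightarrow> 0 \<le> f x" "\<And>x. 0 \<le> x \<Longrightarrow> (R has_real_derivative f x) (at x)"
    and "\<And>x. 0 \<le> x \<Longrightarrow> R x \<le> B"
  shows "f integrable_on {0..}"
proof -
  define g where "g k x = (if x \<in> {0..real k} then f x else 0)" for k :: nat and x
  have hi: "(f has_integral (R (real k) - R 0)) {0..real k}" for k
    using assms(2) by (intro fundamental_theorem_of_calculus)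
      (auto simp: has_real_derivative_iff_has_vector_derivative[symmetric] intro: has_field_derivative_at_within)
  have gi: "(g k has_integral (R (real k) - R 0)) {0..}" for k
    using hi[of k] unfolding g_def[abs_def] by (subst has_integral_restrict) auto
  have "f integrable_on {0..} \<and> (\<lambda>k. integral {0..} (g k)) \<longlonglongrightarrow> integral {0..} f"
  proof (rule monotone_convergence_increasing)
    show "g k integrable_on {0..}" for k using gi by blast
    show "g k x \<le> g (Suc k) x" if "x \<in> {0..}" for k x using assms(1)[of x] that by (auto simp: g_def)
    show "(\<lambda>k. g k x) \<longlonglongrightarrow> f x" if "x \<in> {0..}" for x
    proof (rule tendsto_eventually)
      show "eventually (\<lambda>k. g k x = f x) sequentially"
        by (rule eventually_mono[OF eventually_ge_at_top[of "nat \<lceil>x\<rceil>"]])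
          (use that in \<open>auto simp: g_def nat_le_iff ceiling_le_iff\<close>)
    qed
    have "norm (integral {0..} (g k)) \<le> \<bar>B\<bar> + \<bar>R 0\<bar>" for k
    proof -
      have "0 \<le> integral {0..} (g k)"
        using gi[of k] by (intro integral_nonneg) (auto simp: g_def assms(1))
      thus ?thesis unfolding integral_unique[OF gi[of k]] real_norm_def using assms(3)[of "real k"] by linarith
    qed
    thus "bounded (range (\<lambda>k. integral {0..} (g k)))" by (auto simp: bounded_iff)
  qed
  thus ?thesis by blast
qed

lemma improper_integral_value:
  fixes f R :: "real \<Rightarrow> real"
  assumes "f absolutely_integrable_on {0..}" "\<And>x. 0 \<le> x \<Longrightarrow> (R has_real_derivative f x) (at x)"
    and "(\<lambda>k. R (real k)) \<longlonglongrightarrow> L"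
  shows "integral {0..} f = L - R 0"
proof -
  define g where "g k x = (if x \<in> {0..real k} then f x else 0)" for k :: nat and x
  have hi: "(f has_integral (R (real k) - R 0)) {0..real k}" for k
    using assms(2) by (intro fundamental_theorem_of_calculus)
      (auto simp: has_real_derivative_iff_has_vector_derivative[symmetric] intro: has_field_derivative_at_within)
  have gi: "(g k has_integral (R (real k) - R 0)) {0..}" for k
    using hi[of k] unfolding g_def[abs_def] by (subst has_integral_restrict) auto
  have "(\<lambda>k. integral {0..} (g k)) \<longlonglongrightarrow> integral {0..} f"
  proof (rule dominated_convergence(2))
    show "g k integrable_on {0..}" for k using gi by blast
    show "(\<lambda>x. norm (f x)) integrable_on {0..}" using assms(1) by (simp add: absolutely_integrable_on_def)
    show "norm (g k x) \<le> norm (f x)" for k x by (simp add: g_def)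
    show "(\<lambda>k. g k x) \<longlonglongrightarrow> f x" if "x \<in> {0..}" for x
    proof (rule tendsto_eventually)
      show "eventually (\<lambda>k. g k x = f x) sequentially"
        by (rule eventually_mono[OF eventually_ge_at_top[of "nat \<lceil>x\<rceil>"]])
          (use that in \<open>auto simp: g_def nat_le_iff ceiling_le_iff\<close>)
    qed
  qed
  moreover have "(\<lambda>k. integral {0..} (g k)) \<longlonglongrightarrow> L - R 0"
    unfolding integral_unique[OF gi] by (intro tendsto_intros assms)
  ultimately show ?thesis by (rule LIMSEQ_unique)
qed

text \<open>A bound for both parts of the height integrand; its antiderivative
  \<open>- ((1 + t^2) powr (- 1 / 2))\<close> is elementary and bounded.\<close>

definition majorant :: "real \<Rightarrow> real" where "majorant t = t * (1 + t\<^sup>2) powr (- 3 / 2)"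

lemma majorant_integrable: "majorant integrable_on {0..}"
proof (rule improper_integrable[where R = "\<lambda>t. - ((1 + t\<^sup>2) powr (- 1 / 2))" and B = 0])
  fix x :: real
  have "1 + x\<^sup>2 > 0" by (simp add: add_pos_nonneg)
  thus "((\<lambda>t. - ((1 + t\<^sup>2) powr (- 1 / 2))) has_real_derivative majorant x) (at x)"
    unfolding majorant_def by (auto intro!: derivative_eq_intros DERIV_fun_powr simp: field_simps)
qed (auto simp: majorant_def)

lemma absolutely_integrable_majorized:
  assumes "f \<in> borel_measurable borel" "\<And>t. 0 \<le> t \<Longrightarrow> \<bar>f t\<bar> \<le> C * majorant t"
  shows "f absolutely_integrable_on {0..}"
proof (rule measurable_bounded_by_integrable_imp_absolutely_integrable)
  show "f \<in> borel_measurable (lebesgue_on {0..})"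
    using assms(1) by (intro measurable_restrict_space1 measurable_completion) simp
  show "(\<lambda>t. C * majorant t) integrable_on {0..}"
    using integrable_on_cmult_left[OF majorant_integrable, of C] by simp
qed (use assms(2) in auto)

definition Jint :: "real \<Rightarrow> real \<Rightarrow> real" where
  "Jint j y = 2 * y ^ 3 / ((y\<^sup>2 + pi\<^sup>2 * j\<^sup>2) * (sinh y)\<^sup>2)"

text \<open>The quadratic Taylor bound gives \<open>sinh t \<ge> t / 2 + t^2 / 4\<close>, hence
  \<open>(sinh t)^2 \<ge> t^2 * (1 + t^2) / 32\<close>, which absorbs the singularity at 0 and gives
  decay; \<open>1 \<le> \<bar>j\<bar>\<close> bounds the other factor below by
  \<open>1 + t^2\<close>. The constant is \<open>2 * 32\<close>.\<close>

lemma Jint_le: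
  assumes "1 \<le> \<bar>j\<bar>" "0 \<le> t"
  shows "0 \<le> Jint j t" "Jint j t \<le> 64 * majorant t"
proof -
  show nn: "0 \<le> Jint j t" unfolding Jint_def using assms(2) by (intro divide_nonneg_nonneg mult_nonneg_nonneg) auto
  show "Jint j t \<le> 64 * majorant t"
  proof (cases "t = 0")
    case False
    hence t: "0 < t" using assms(2) by simp
    have "sinh t = (exp t - exp (- t)) / 2" by (simp add: sinh_field_def)
    moreover have "1 + t + t\<^sup>2 / 2 \<le> exp t" using exp_lower_Taylor_quadratic[of t] t by simp
    moreover have "exp (- t) \<le> 1" using t by simp
    ultimately have "(t + t\<^sup>2 / 2) / 2 \<le> sinh t" by (simp only:) (rule divide_right_mono, linarith, simp)
    moreover have "(t + t\<^sup>2 / 2) / 2 = t / 2 + t\<^sup>2 / 4" by (simp add: add_divide_distrib)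
    ultimately have "t / 2 + t\<^sup>2 / 4 \<le> sinh t" by simp
    hence "(t / 2 + t\<^sup>2 / 4)\<^sup>2 \<le> (sinh t)\<^sup>2" using t by (intro power_mono) auto
    moreover have "(t / 2 + t\<^sup>2 / 4)\<^sup>2 = t\<^sup>2 / 4 + t\<^sup>2 * t / 4 + t\<^sup>2 * t\<^sup>2 / 16" by (simp add: power2_eq_square field_simps)
    moreover have "t\<^sup>2 * (1 + t\<^sup>2) / 32 \<le> t\<^sup>2 / 4 + t\<^sup>2 * t / 4 + t\<^sup>2 * t\<^sup>2 / 16"
      using t by (simp add: field_simps)
    ultimately have s: "t\<^sup>2 * (1 + t\<^sup>2) / 32 \<le> (sinh t)\<^sup>2" by linarith
    have "1 * 1 \<le> pi\<^sup>2 * j\<^sup>2"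
      using assms(1) pi_ge_two by (intro mult_mono) (auto simp: one_le_power abs_le_square_iff[of 1, simplified])
    hence c: "1 + t\<^sup>2 \<le> t\<^sup>2 + pi\<^sup>2 * j\<^sup>2" by simp
    have p: "0 < 1 + t\<^sup>2" by (simp add: add_pos_nonneg)
    have "Jint j t \<le> 2 * t ^ 3 / ((1 + t\<^sup>2) * (t\<^sup>2 * (1 + t\<^sup>2) / 32))"
      unfolding Jint_def using t s c p by (intro divide_left_mono mult_mono mult_pos_pos) auto
    also have "\<dots> = 64 * (t / (1 + t\<^sup>2)\<^sup>2)"
    proof -
      have "2 * t ^ 3 / (P * (t\<^sup>2 * P / 32)) = 64 * (t / P\<^sup>2)" if "P \<noteq> 0" for P
        using that t by (simp add: field_simps power2_eq_square power3_eq_cube)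
      thus ?thesis using p by simp
    qed
    also have "t / (1 + t\<^sup>2)\<^sup>2 = t * (1 + t\<^sup>2) powr (- 2)" using p by (simp add: powr_minus divide_inverse powr_numeral)
    also have "\<dots> \<le> majorant t" unfolding majorant_def using t by (intro mult_left_mono powr_mono) auto
    finally show ?thesis by simp
  qed (simp add: Jint_def majorant_def)
qed

lemma Jint_measurable: "Jint j \<in> borel_measurable borel"
proof -
  have "sinh \<in> borel_measurable (borel :: real measure)"
    by (intro borel_measurable_continuous_onI continuous_intros)
  thus ?thesis unfolding Jint_def[abs_def] by measurable
qed

lemma Jint_scaled:
  assumes "1 \<le> \<bar>j\<bar>"
  shows "(\<lambda>y. 2 * pi * Jint j (2 * pi * y)) absolutely_integrable_on {0..}"
    "integral {0..} (\<lambda>y. 2 * pi * Jint j (2 * pi * y)) = integral {0..} (Jint j)"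
proof -
  have "Jint j absolutely_integrable_on {0..}"
    using Jint_le[OF assms] by (intro absolutely_integrable_majorized[OF Jint_measurable, of j 64]) auto
  moreover have "(\<lambda>y. 2 * pi * y) ` {0..} = {0..}"
  proof -
    have "y \<in> (\<lambda>y. 2 * pi * y) ` {0..}" if "0 \<le> y" for y
      using that by (intro image_eqI[of _ _ "y / (2 * pi)"]) auto
    thus ?thesis by auto
  qed
  moreover have "inj_on (\<lambda>y. 2 * pi * y) {0..}" by (auto intro!: inj_onI)
  ultimately show "(\<lambda>y. 2 * pi * Jint j (2 * pi * y)) absolutely_integrable_on {0..}"
    "integral {0..} (\<lambda>y. 2 * pi * Jint j (2 * pi * y)) = integral {0..} (Jint j)"
    using has_absolute_integral_change_of_variables_1'[of "{0..}" "\<lambda>y. 2 * pi * y" "\<lambda>_. 2 * pi" "Jint j" "integral {0..} (Jint j)"]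
    by (auto intro!: derivative_eq_intros)
qed

text \<open>The part of \<open>2 * y * ker_flux j y\<close> without exponentials.\<close>

definition Jalg :: "real \<Rightarrow> real \<Rightarrow> real" where
  "Jalg j y = - (8 / pi) * y * Re (1 / Complex j (2 * y) ^ 3)"

lemma Jalg_integral:
  assumes "1 \<le> \<bar>j\<bar>"
  shows "Jalg j absolutely_integrable_on {0..}" "integral {0..} (Jalg j) = 1 / (pi * j)"
proof -
  have nz: "Complex j (2 * y) \<noteq> 0" for y using assms by (auto simp: complex_eq_iff)
  have cont: "continuous_on UNIV (Jalg j)" unfolding Jalg_def[abs_def]
    using nz by (intro continuous_on_mult continuous_on_const continuous_on_Re continuous_on_divide
        continuous_on_power continuous_on_Complex continuous_on_id) auto
  show ai: "Jalg j absolutely_integrable_on {0..}"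
  proof (rule absolutely_integrable_majorized)
    show "Jalg j \<in> borel_measurable borel" using cont by (rule borel_measurable_continuous_onI)
    fix t :: real assume t: "0 \<le> t"
    define r where "r = cmod (Complex j (2 * t))"
    have "1 \<le> j\<^sup>2" using assms abs_le_square_iff[of 1 j] by simp
    moreover have "r\<^sup>2 = j\<^sup>2 + 4 * t\<^sup>2" by (simp add: r_def cmod_power2 power_mult_distrib)
    ultimately have r2: "1 + t\<^sup>2 \<le> r\<^sup>2" using zero_le_power2[of t] by linarith
    have r0: "0 < r" using nz by (simp add: r_def)
    have "(1 + t\<^sup>2) powr (3 / 2) \<le> (r\<^sup>2) powr (3 / 2)" using r2 by (intro powr_mono2) auto
    also have "\<dots> = r ^ 3" using r0 by (simp add: powr_powr powr_realpow[symmetric] flip: powr_numeral)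
    finally have r3: "(1 + t\<^sup>2) powr (3 / 2) \<le> r ^ 3" .
    have p: "0 < (1 + t\<^sup>2) powr (3 / 2)" by (simp add: add_pos_nonneg less_imp_neq[symmetric])
    have "\<bar>Re (1 / Complex j (2 * t) ^ 3)\<bar> \<le> 1 / r ^ 3"
      using abs_Re_le_cmod[of "1 / Complex j (2 * t) ^ 3"] by (simp add: norm_divide norm_power r_def)
    also have "\<dots> \<le> 1 / (1 + t\<^sup>2) powr (3 / 2)" using r3 p r0 by (intro divide_left_mono mult_pos_pos) auto
    also have "\<dots> = (1 + t\<^sup>2) powr (- 3 / 2)" using powr_minus_divide[of "1 + t\<^sup>2" "3 / 2"] by simp
    finally have "8 / pi * t * \<bar>Re (1 / Complex j (2 * t) ^ 3)\<bar> \<le> 8 / pi * t * (1 + t\<^sup>2) powr (- 3 / 2)"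
      using t by (intro mult_left_mono) auto
    thus "\<bar>Jalg j t\<bar> \<le> 8 / pi * majorant t" using t unfolding Jalg_def majorant_def by (simp add: abs_mult)
  qed
  \<comment> \<open>With \<open>w = j + 2 i y\<close> the factor \<open>y\<close> is
    \<open>(w - j) / (2 i)\<close>, so the integrand is a combination of \<open>w^(-2)\<close> and
    \<open>w^(-3)\<close> and has this primitive.\<close>
  define R where "R y = 2 / pi * Re (- (1 / Complex j (2 * y)) + of_real (j / 2) * (1 / Complex j (2 * y))\<^sup>2)" for y
  have "integral {0..} (Jalg j) = 0 - R 0"
  proof (rule improper_integral_value[OF ai])
    fix y :: real
    have c: "((\<lambda>y. Complex j (2 * y)) has_vector_derivative 2 * \<i>) (at y)"
      unfolding Complex_eq by (auto intro!: derivative_eq_intros simp: has_vector_derivative_def scaleR_conv_of_real)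
    have "((\<lambda>w. - (1 / w) + of_real (j / 2) * (1 / w)\<^sup>2) has_field_derivative
       1 / Complex j (2 * y) ^ 2 - of_real j / Complex j (2 * y) ^ 3) (at (Complex j (2 * y)))"
    proof -
      have d: "((\<lambda>w. 1 / w) has_field_derivative - (1 / (Complex j (2 * y))\<^sup>2)) (at (Complex j (2 * y)))"
        using nz[of y] by (auto intro!: derivative_eq_intros simp: power2_eq_square)
      show ?thesis
        by (rule DERIV_cong[OF DERIV_add[OF DERIV_minus[OF d] DERIV_cmult[OF DERIV_power[OF d, of 2]]]])
          (simp add: power2_eq_square power3_eq_cube)
    qed
    from field_vector_diff_chain_at[OF c this]
    have "((\<lambda>y. - (1 / Complex j (2 * y)) + of_real (j / 2) * (1 / Complex j (2 * y))\<^sup>2) has_vector_derivative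
      2 * \<i> * (1 / Complex j (2 * y) ^ 2 - of_real j / Complex j (2 * y) ^ 3)) (at y)" by (simp add: o_def)
    also have "2 * \<i> * (1 / Complex j (2 * y) ^ 2 - of_real j / Complex j (2 * y) ^ 3) = of_real (- 4 * y) * (1 / Complex j (2 * y) ^ 3)"
    proof -
      have "1 / w ^ 2 - of_real j / w ^ 3 = (w - of_real j) / w ^ 3" if "w \<noteq> 0" for w :: complex
        using that by (simp add: diff_divide_distrib power2_eq_square power3_eq_cube)
      from this[OF nz] have "1 / Complex j (2 * y) ^ 2 - of_real j / Complex j (2 * y) ^ 3 = (2 * \<i> * of_real y) / Complex j (2 * y) ^ 3"
        by (simp add: Complex_eq)
      thus ?thesis by simp
    qed
    finally have "((\<lambda>y. Re (- (1 / Complex j (2 * y)) + of_real (j / 2) * (1 / Complex j (2 * y))\<^sup>2)) has_vector_derivative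
      Re (of_real (- 4 * y) * (1 / Complex j (2 * y) ^ 3))) (at y)" by (rule bounded_linear.has_vector_derivative[OF bounded_linear_Re])
    hence "((\<lambda>y. Re (- (1 / Complex j (2 * y)) + of_real (j / 2) * (1 / Complex j (2 * y))\<^sup>2)) has_real_derivative
      - 4 * y * Re (1 / Complex j (2 * y) ^ 3)) (at y)"
      unfolding has_real_derivative_iff_has_vector_derivative by (simp only: times_complex.sel Re_complex_of_real Im_complex_of_real mult_zero_left diff_zero)
    from DERIV_cmult[OF this, of "2 / pi"]
    show "(R has_real_derivative Jalg j y) (at y)" unfolding R_def[abs_def] Jalg_def by (simp add: algebra_simps)
  next
    have inv: "(\<lambda>k. 1 / Complex j (2 * real k)) \<longlonglongrightarrow> 0"
    proof (rule Lim_null_comparison)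
      show "(\<lambda>k. 1 / real k) \<longlonglongrightarrow> 0" by (rule lim_1_over_n)
      show "eventually (\<lambda>k. norm (1 / Complex j (2 * real k)) \<le> 1 / real k) sequentially"
        using eventually_gt_at_top[of 0]
      proof eventually_elim
        case (elim k)
        have "real k \<le> \<bar>Im (Complex j (2 * real k))\<bar>" by simp
        also have "\<dots> \<le> norm (Complex j (2 * real k))" by (rule abs_Im_le_cmod)
        finally show ?case using elim by (simp add: norm_divide divide_left_mono frac_le)
      qed
    qed
    have "(\<lambda>k. R (real k)) \<longlonglongrightarrow> 2 / pi * Re (- 0 + of_real (j / 2) * 0\<^sup>2)"
      unfolding R_def by (intro tendsto_mult tendsto_const tendsto_Re tendsto_add tendsto_minus tendsto_power inv)
    thus "(\<lambda>k. R (real k)) \<longlonglongrightarrow> 0" by simp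
  qed
  also have "\<dots> = 1 / (pi * j)"
  proof -
    have "Complex j 0 = of_real j" by (simp add: complex_eq_iff)
    hence "R 0 = 2 / pi * Re (of_real (- (1 / j) + j / 2 * (1 / j)\<^sup>2))" unfolding R_def by simp
    thus ?thesis unfolding Re_complex_of_real using assms by (simp add: field_simps power2_eq_square)
  qed
  finally show "integral {0..} (Jalg j) = 1 / (pi * j)" .
qed

text \<open>\<open>1 / j - Re (1 / (j + 2 i y))\<close> equals
  \<open>4 y^2 / (j (j^2 + 4 y^2))\<close>; the scaling by \<open>2 * pi\<close> matches its
  denominator and the \<open>sinh\<close> with the integrand of \<open>Jcoef\<close>.\<close>

lemma ker_flux_eq:
  assumes "0 \<le> y" "j \<noteq> 0"
  shows "2 * y * ker_flux j y = Jalg j y + 1 / (pi * j) * (2 * pi * Jint j (2 * pi * y))"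
proof (cases "y = 0")
  case False
  hence y: "0 < y" using assms by simp
  define e where "e = exp (- 2 * pi * y)"
  have e: "0 < e" "e < 1" using y by (auto simp: e_def)
  have e2: "1 - e\<^sup>2 \<noteq> 0" using e by (simp add: power_less_one_iff less_imp_neq[symmetric] neq_iff)
  have "exp (2 * pi * y) = 1 / e" "exp (- (2 * pi * y)) = e" by (simp_all add: e_def exp_minus field_simps)
  hence s: "sinh (2 * pi * y) = (1 - e\<^sup>2) / (2 * e)"
    unfolding sinh_field_def using e(1) by (simp only:) (simp add: field_simps power2_eq_square)
  have d: "j\<^sup>2 + 4 * y\<^sup>2 > 0" using y by (simp add: add_nonneg_pos)
  have r: "1 / j - Re (1 / Complex j (2 * y)) = 4 * y\<^sup>2 / (j * (j\<^sup>2 + 4 * y\<^sup>2))"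
    using assms(2) d by (simp add: Re_divide power_mult_distrib) (simp add: field_simps power2_eq_square)
  have J: "1 / (pi * j) * (2 * pi * Jint j (2 * pi * y)) = 2 * y * (16 * pi * e\<^sup>2 / (1 - e\<^sup>2)\<^sup>2 * (4 * y\<^sup>2 / (j * (j\<^sup>2 + 4 * y\<^sup>2))))"
  proof -
    have q: "(2 * pi * y)\<^sup>2 + pi\<^sup>2 * j\<^sup>2 = pi\<^sup>2 * (j\<^sup>2 + 4 * y\<^sup>2)" by (simp add: power_mult_distrib algebra_simps)
    have "1 / (P * j) * (2 * P * (2 * (2 * P * y) ^ 3 / (P\<^sup>2 * D * (t / (2 * e))\<^sup>2))) = 2 * y * (16 * P * e\<^sup>2 / t\<^sup>2 * (4 * y\<^sup>2 / (j * D)))"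
      if "P \<noteq> 0" "D \<noteq> 0" "t \<noteq> 0" for P D t :: real
      using that assms(2) e(1) by (simp add: field_simps power2_eq_square power3_eq_cube)
    from this[of pi "j\<^sup>2 + 4 * y\<^sup>2" "1 - e\<^sup>2"] show ?thesis unfolding Jint_def q s using d e2 by simp
  qed
  show ?thesis unfolding J unfolding ker_flux_def r Jalg_def e_def[symmetric] by (simp add: algebra_simps)
qed (simp add: Jalg_def Jint_def)

text \<open>Here the kernel of the theorem appears: \<open>Jalg\<close> integrates to the summand 1
  of the bracket in \<open>Jcoef\<close>, up to the factor \<open>1 / (pi * j)\<close>, and
  \<open>Jint\<close> to the integral.\<close>

lemma ker_flux_integral:
  fixes j :: int
  shows "(\<lambda>y. 2 * y * ker_flux (of_int j) y) absolutely_integrable_on {0..}"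
    "integral {0..} (\<lambda>y. 2 * y * ker_flux (of_int j) y) = Jcoef j"
proof -
  have "(\<lambda>y. 2 * y * ker_flux (of_int j) y) absolutely_integrable_on {0..} \<and>
    integral {0..} (\<lambda>y. 2 * y * ker_flux (of_int j) y) = Jcoef j"
  proof (cases "j = 0")
    case True
    have "Re (1 / Complex 0 (2 * y) ^ 3) = 0" "Re (1 / Complex 0 (2 * y)) = 0" for y
      by (simp_all add: Re_divide power3_eq_cube)
    hence "ker_flux 0 y = 0" for y unfolding ker_flux_def by simp
    thus ?thesis using True by (simp add: Jcoef_def)
  next
    case False
    define r where "r = real_of_int j"
    have r: "1 \<le> \<bar>r\<bar>" "r \<noteq> 0" using False by (auto simp: r_def)
    define g where "g y = Jalg r y + 1 / (pi * r) * (2 * pi * Jint r (2 * pi * y))" for y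
    note J = Jint_scaled[OF r(1)] and A = Jalg_integral[OF r(1)]
    have m: "(\<lambda>y. 1 / (pi * r) * (2 * pi * Jint r (2 * pi * y))) absolutely_integrable_on {0..}"
      using absolutely_integrable_scaleR_left[OF J(1), of "1 / (pi * r)"] by simp
    have g: "g absolutely_integrable_on {0..}" unfolding g_def[abs_def]
      by (rule set_integral_add(1)[OF A(1) m])
    have "integral {0..} g = integral {0..} (Jalg r) + integral {0..} (\<lambda>y. 1 / (pi * r) * (2 * pi * Jint r (2 * pi * y)))"
      unfolding g_def[abs_def] using A(1) m
      by (intro Henstock_Kurzweil_Integration.integral_add) (auto simp: absolutely_integrable_on_def)
    also have "\<dots> = 1 / (pi * r) + 1 / (pi * r) * integral {0..} (Jint r)"
      unfolding A(2) J(2)[symmetric] by (simp only: integral_mult_right)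
    also have "\<dots> = Jcoef j"
      using False unfolding Jcoef_def Jint_def[abs_def] r_def by (simp add: algebra_simps)
    finally have gi: "integral {0..} g = Jcoef j" .
    have eq: "2 * y * ker_flux (of_int j) y = g y" if "y \<in> {0..}" for y
      using ker_flux_eq[of y r] that r(2) by (simp add: g_def r_def)
    show ?thesis using g gi eq
      by (metis (no_types, lifting) Henstock_Kurzweil_Integration.integral_cong absolutely_integrable_spike_eq
          negligible_empty Diff_empty)
  qed
  thus "(\<lambda>y. 2 * y * ker_flux (of_int j) y) absolutely_integrable_on {0..}"
    "integral {0..} (\<lambda>y. 2 * y * ker_flux (of_int j) y) = Jcoef j" by auto
qed

lemma Im_hol_mono_bounds:
  assumes "0 < y1" "y1 \<le> Im z"
  defines "e \<equiv> exp (- 2 * pi * y1)"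
  shows "(1 - e) / (1 + e) \<le> Im (hol z)" "norm (hol1 z) \<le> 4 * pi / (1 - e)\<^sup>2" "0 < e" "e < 1"
proof -
  show e: "0 < e" "e < 1" using assms(1) by (auto simp: e_def)
  define f where "f = exp (- 2 * pi * Im z)"
  have f: "0 < f" "f \<le> e" using assms by (auto simp: e_def f_def)
  have "(1 - e) / (1 + e) \<le> (1 - f) / (1 + f)" using e f by (simp add: divide_simps) (simp add: algebra_simps)
  thus "(1 - e) / (1 + e) \<le> Im (hol z)" using Im_hol_bounds(1)[of z] assms(1,2) unfolding f_def by linarith
  have nq: "norm (qexp z) = f" by (simp add: norm_qexp f_def)
  have "1 - e \<le> norm (1 - qexp z)" using norm_triangle_ineq2[of 1 "qexp z"] nq f by simp
  hence d: "(1 - e)\<^sup>2 \<le> (norm (1 - qexp z))\<^sup>2" using e by (intro power_mono) auto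
  have "norm (hol1 z) = 4 * pi * f / (norm (1 - qexp z))\<^sup>2"
    by (simp add: hol1_def norm_divide norm_mult norm_power nq)
  also have "\<dots> \<le> 4 * pi / (1 - e)\<^sup>2" using d e f by (intro frac_le) auto
  finally show "norm (hol1 z) \<le> 4 * pi / (1 - e)\<^sup>2" .
qed

text \<open>Above height \<open>y1\<close> the norm of \<open>pker1\<close> is
  \<open>Im pker / Im z\<close>, while \<open>hol1\<close> and \<open>1 / Im hol\<close> are
  bounded. Estimating one kernel by a constant and keeping the other leaves a bound whose integral
  over the line is finite.\<close>

lemma pjac_bound:
  assumes "0 < y1"
  shows "\<exists>C\<ge>0. \<forall>z. y1 \<le> Im z \<longrightarrow> \<bar>pjac m n z\<bar> \<le> C * Im (pker m z)"
proof -
  define e where "e = exp (- 2 * pi * y1)"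
  define k where "k = (1 - e) / (1 + e)"
  define H where "H = 4 * pi / (1 - e)\<^sup>2"
  have e: "0 < e" "e < 1" using assms by (auto simp: e_def)
  have k: "0 < k" using e by (simp add: k_def)
  have H: "0 \<le> H" by (simp add: H_def)
  define c where "c = 1 / y1 + H / k"
  have c: "0 \<le> c" using assms H k by (simp add: c_def)
  have main: "\<bar>pjac m n z\<bar> \<le> 2 * c\<^sup>2 / (pi * y1 * k) * Im (pker m z)" if z: "y1 \<le> Im z" for z
  proof -
    have z0: "0 < Im z" using z assms by simp
    note b = Im_hol_mono_bounds[OF assms z, folded e_def, folded k_def H_def]
    have h: "0 < Im (hol z)" using b k by linarith
    have p0: "0 \<le> Im (pker l z)" for l using Im_pker_nonneg[of z] z0 by simp
    have gen: "\<bar>x - Im (pker l z) / Im (hol z) * t\<bar> \<le> c * Im (pker l z)"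
      if "\<bar>x\<bar> \<le> norm (pker1 l z)" "\<bar>t\<bar> \<le> norm (hol1 z)" for x t l
    proof -
      have "\<bar>x\<bar> \<le> Im (pker l z) / Im z" using that(1) norm_pker1[OF z0] by simp
      also have "\<dots> \<le> Im (pker l z) / y1" using z z0 assms p0 by (intro divide_left_mono) auto
      finally have 1: "\<bar>x\<bar> \<le> Im (pker l z) / y1" .
      have "\<bar>Im (pker l z) / Im (hol z) * t\<bar> = Im (pker l z) / Im (hol z) * \<bar>t\<bar>"
        using p0[of l] h by (simp add: abs_mult)
      also have "\<dots> \<le> Im (pker l z) / k * H"
        using p0[of l] h k b(1,2) that(2) by (intro mult_mono divide_left_mono) auto
      finally have 2: "\<bar>Im (pker l z) / Im (hol z) * t\<bar> \<le> Im (pker l z) / k * H" .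
      have "\<bar>x - Im (pker l z) / Im (hol z) * t\<bar> \<le> Im (pker l z) / y1 + Im (pker l z) / k * H"
        using 1 2 by linarith
      thus ?thesis by (simp add: c_def algebra_simps)
    qed
    have g: "\<bar>pquo_x l z\<bar> \<le> c * Im (pker l z)" "\<bar>pquo_y l z\<bar> \<le> c * Im (pker l z)" for l
      unfolding pquo_x_def pquo_y_def by (intro gen abs_Im_le_cmod abs_Re_le_cmod)+
    have pn: "Im (pker n z) \<le> 1 / (pi * y1)"
    proof -
      have "Im (pker n z) \<le> 1 / (pi * Im z)" using Im_pker_le[OF z0, of n "Re z"] by simp
      also have "\<dots> \<le> 1 / (pi * y1)" using z z0 assms by (intro divide_left_mono) auto
      finally show ?thesis .
    qed
    have "\<bar>pquo_x m z * pquo_y n z - pquo_y m z * pquo_x n z\<bar> \<le> \<bar>pquo_x m z\<bar> * \<bar>pquo_y n z\<bar> + \<bar>pquo_y m z\<bar> * \<bar>pquo_x n z\<bar>"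
      unfolding abs_mult[symmetric] by (rule abs_triangle_ineq4)
    also have "\<dots> \<le> (c * Im (pker m z)) * (c * Im (pker n z)) + (c * Im (pker m z)) * (c * Im (pker n z))"
      using g c p0 by (intro add_mono mult_mono) auto
    also have "\<dots> = 2 * c\<^sup>2 * Im (pker m z) * Im (pker n z)" by (simp add: power2_eq_square)
    also have "\<dots> \<le> 2 * c\<^sup>2 * Im (pker m z) * (1 / (pi * y1))" using pn p0[of m] by (intro mult_left_mono) auto
    finally have "\<bar>pquo_x m z * pquo_y n z - pquo_y m z * pquo_x n z\<bar> \<le> 2 * c\<^sup>2 * Im (pker m z) * (1 / (pi * y1))" .
    hence "\<bar>pquo_x m z * pquo_y n z - pquo_y m z * pquo_x n z\<bar> / Im (hol z) \<le> 2 * c\<^sup>2 * Im (pker m z) * (1 / (pi * y1)) / k"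
      using h k b(1) p0[of m] assms by (intro frac_le) auto
    thus ?thesis unfolding pjac_def using h by (simp add: mult_ac)
  qed
  show ?thesis using main assms k by (intro exI[of _ "2 * c\<^sup>2 / (pi * y1 * k)"]) auto
qed

section \<open>Limits in the truncation and in the height\<close>

context bellman_sequences
begin

lemma cont_pjac: "continuous_on uhp (pjac m n)"
proof -
  have "continuous_on uhp (pker k)" "continuous_on uhp (pker1 k)" for k
    using pker_deriv pker1_deriv by (auto intro!: continuous_at_imp_continuous_on DERIV_isCont)
  note c = this cont_hol
  have h: "\<forall>z\<in>uhp. Im (hol z) \<noteq> 0" using Im_hol_bounds(2) by fastforce
  have "continuous_on uhp (pquo_x k)" "continuous_on uhp (pquo_y k)" for k
    unfolding pquo_x_def[abs_def] pquo_y_def[abs_def]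
    by (intro continuous_on_diff continuous_on_mult continuous_on_divide continuous_on_Im continuous_on_Re c h)+
  thus ?thesis unfolding pjac_def[abs_def]
    by (intro continuous_on_diff continuous_on_mult continuous_on_divide continuous_on_Im c h)
qed

lemma pjac_integral_bound:
  assumes "0 < y1"
  shows "\<exists>C\<ge>0. \<forall>y\<ge>y1. \<forall>N. \<bar>integral {- real N..real N} (\<lambda>x. pjac m n (Complex x y))\<bar> \<le> C"
proof -
  obtain C where C: "0 \<le> C" "\<And>z. y1 \<le> Im z \<Longrightarrow> \<bar>pjac m n z\<bar> \<le> C * Im (pker m z)"
    using pjac_bound[OF assms] by blast
  have "\<bar>integral {- real N..real N} (\<lambda>x. pjac m n (Complex x y))\<bar> \<le> C" if y: "y1 \<le> y" for y N
  proof -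
    have y0: "0 < y" using y assms by simp
    have "norm (integral {- real N..real N} (\<lambda>x. pjac m n (Complex x y)))
      \<le> integral {- real N..real N} (\<lambda>x. C * Im (pker m (Complex x y)))"
      using C(2) y by (intro integral_norm_bound_integral integrable_line[OF cont_pjac y0]
          integrable_on_mult_right Im_pker_integral_le(2)[OF y0]) auto
    also have "\<dots> = C * integral {- real N..real N} (\<lambda>x. Im (pker m (Complex x y)))" by (rule integral_mult_right)
    also have "\<dots> \<le> C * 1" using C(1) Im_pker_integral_le(1)[OF y0] by (intro mult_left_mono)
    finally show ?thesis by simp
  qed
  thus ?thesis using C(1) by blast
qed

lemma quo_xy_sum:
  "quo_x c z = (\<Sum>n\<in>X. c n * pquo_x n z)" "quo_y c z = (\<Sum>n\<in>X. c n * pquo_y n z)"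
  unfolding quo_x_def quo_y_def quo_def Im_ext pquo_x_def pquo_y_def h_def
  by (simp_all add: right_diff_distrib sum_subtractf sum_divide_distrib sum_distrib_right sum_distrib_left mult_ac)

lemma jac_sum: "jac z = (\<Sum>m\<in>X. \<Sum>n\<in>X. a m * b n * pjac m n z)"
proof -
  have "quo_x a z * quo_y b z = (\<Sum>m\<in>X. \<Sum>n\<in>X. a m * b n * (pquo_x m z * pquo_y n z))"
    "quo_y a z * quo_x b z = (\<Sum>m\<in>X. \<Sum>n\<in>X. a m * b n * (pquo_y m z * pquo_x n z))"
    unfolding quo_xy_sum sum_product by (simp_all add: mult_ac)
  thus ?thesis unfolding jac_def pjac_def h_def
    by (simp add: sum_subtractf[symmetric] sum_divide_distrib right_diff_distrib diff_divide_distrib)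
qed

definition limflux :: "real \<Rightarrow> real" where
  "limflux y = (\<Sum>m\<in>X. \<Sum>n\<in>X. a m * b n * (2 * ker_flux (of_int (n - m)) y))"

lemma flux_sum:
  assumes "0 < y"
  shows "flux N y = (\<Sum>m\<in>X. \<Sum>n\<in>X. a m * b n * (2 * integral {- real N..real N} (\<lambda>x. pjac m n (Complex x y))))"
proof -
  have i: "(\<lambda>x. pjac m n (Complex x y)) integrable_on {- real N..real N}" for m n
    by (rule integrable_line[OF cont_pjac assms])
  have "flux N y = integral {- real N..real N} (\<lambda>x. \<Sum>m\<in>X. \<Sum>n\<in>X. (2 * (a m * b n)) * pjac m n (Complex x y))"
    unfolding flux_def jac_sum by (simp add: sum_distrib_left mult_ac)
  also have "\<dots> = (\<Sum>m\<in>X. \<Sum>n\<in>X. integral {- real N..real N} (\<lambda>x. (2 * (a m * b n)) * pjac m n (Complex x y)))"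
    by (subst integral_sum, rule fin, intro integrable_sum fin integrable_on_mult_right i,
        intro sum.cong refl integral_sum fin integrable_on_mult_right i)
  also have "\<dots> = (\<Sum>m\<in>X. \<Sum>n\<in>X. a m * b n * (2 * integral {- real N..real N} (\<lambda>x. pjac m n (Complex x y))))"
    unfolding integral_mult_right by (simp add: mult_ac)
  finally show ?thesis .
qed

lemma pjac_diag: "pjac m m z = 0"
  by (simp add: pjac_def mult.commute)

lemma ker_flux_0: "ker_flux 0 y = 0"
proof -
  have "Re (1 / Complex 0 (2 * y) ^ 3) = 0" "Re (1 / Complex 0 (2 * y)) = 0"
    by (simp_all add: Re_divide power3_eq_cube)
  thus ?thesis unfolding ker_flux_def by simp
qed

lemma flux_tendsto:
  assumes "0 < y"
  shows "(\<lambda>N. flux N y) \<longlonglongrightarrow> limflux y"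
proof -
  have "(\<lambda>N. integral {- real N..real N} (\<lambda>x. pjac m n (Complex x y))) \<longlonglongrightarrow> ker_flux (of_int (n - m)) y" for m n
    by (cases "m = n") (simp_all add: pjac_diag ker_flux_0 PV_pjac[OF assms] del: of_int_diff)
  thus ?thesis unfolding flux_sum[OF assms] limflux_def by (intro tendsto_sum tendsto_mult tendsto_const)
qed

text \<open>Uniformity in \<open>N\<close> is the domination needed to let \<open>N\<close> go to
  infinity under the integral over the height.\<close>

lemma flux_bound:
  assumes "0 < y1"
  shows "\<exists>C\<ge>0. \<forall>y\<ge>y1. \<forall>N. \<bar>flux N y\<bar> \<le> C"
proof -
  have "\<forall>m n. \<exists>C\<ge>0. \<forall>y\<ge>y1. \<forall>N. \<bar>integral {- real N..real N} (\<lambda>x. pjac m n (Complex x y))\<bar> \<le> C"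
    using pjac_integral_bound[OF assms] by blast
  then obtain C where C: "\<And>m n. 0 \<le> C m n"
    "\<And>m n y N. y1 \<le> y \<Longrightarrow> \<bar>integral {- real N..real N} (\<lambda>x. pjac m n (Complex x y))\<bar> \<le> C m n"
    by metis
  have "\<bar>flux N y\<bar> \<le> (\<Sum>m\<in>X. \<Sum>n\<in>X. \<bar>a m * b n\<bar> * (2 * C m n))" if y: "y1 \<le> y" for y N
  proof -
    have y0: "0 < y" using y assms by simp
    have "\<bar>flux N y\<bar> \<le> (\<Sum>m\<in>X. \<bar>\<Sum>n\<in>X. a m * b n * (2 * integral {- real N..real N} (\<lambda>x. pjac m n (Complex x y)))\<bar>)"
      unfolding flux_sum[OF y0] by (rule sum_abs)
    also have "\<dots> \<le> (\<Sum>m\<in>X. \<Sum>n\<in>X. \<bar>a m * b n * (2 * integral {- real N..real N} (\<lambda>x. pjac m n (Complex x y)))\<bar>)"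
      by (intro sum_mono sum_abs)
    also have "\<dots> \<le> (\<Sum>m\<in>X. \<Sum>n\<in>X. \<bar>a m * b n\<bar> * (2 * C m n))"
    proof (intro sum_mono)
      fix m n
      have "\<bar>2 * integral {- real N..real N} (\<lambda>x. pjac m n (Complex x y))\<bar> \<le> 2 * C m n"
        using C(2)[OF y, of N m n] by (simp add: abs_mult)
      thus "\<bar>a m * b n * (2 * integral {- real N..real N} (\<lambda>x. pjac m n (Complex x y)))\<bar> \<le> \<bar>a m * b n\<bar> * (2 * C m n)"
        unfolding abs_mult[of "a m * b n"] by (rule mult_left_mono) simp
    qed
    finally show ?thesis .
  qed
  moreover have "0 \<le> (\<Sum>m\<in>X. \<Sum>n\<in>X. \<bar>a m * b n\<bar> * (2 * C m n))"
    using C(1) by (intro sum_nonneg mult_nonneg_nonneg) auto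
  ultimately show ?thesis by blast
qed

text \<open>First limit: \<open>N\<close> grows with \<open>y1\<close>, \<open>y2\<close> fixed, and
  the boundary error vanishes like \<open>1 / N\<close>.\<close>

lemma limflux_le:
  assumes y: "0 < y1" "y1 < y2" and \<epsilon>: "\<And>N. mass N y2 \<le> \<epsilon>"
  shows "(\<lambda>y. (y - y1) * (y2 - y) / (y2 - y1) * limflux y) integrable_on {y1..y2}"
    "integral {y1..y2} (\<lambda>y. (y - y1) * (y2 - y) / (y2 - y1) * limflux y) \<le> (\<Sum>n\<in>X. F (a n, b n)) + \<epsilon>"
proof -
  define G where "G y = (y - y1) * (y2 - y) / (y2 - y1)" for y
  obtain C where C: "0 \<le> C" "\<And>y N. y1 \<le> y \<Longrightarrow> \<bar>flux N y\<bar> \<le> C" using flux_bound[OF y(1)] by blast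
  have G: "0 \<le> G t" "G t \<le> y2 - y1" if "t \<in> {y1..y2}" for t
  proof -
    show "0 \<le> G t" using that y unfolding G_def by auto
    have "(t - y1) * (y2 - t) \<le> (y2 - y1) * (y2 - y1)" using that by (intro mult_mono) auto
    thus "G t \<le> y2 - y1" unfolding G_def using y by (simp add: field_simps)
  qed
  have i: "(\<lambda>t. G t * flux N t) integrable_on {y1..y2}" for N
  proof (rule integrable_continuous_real)
    have "continuous_on {y1..y2} (flux N)" using y by (intro continuous_on_subset[OF flux_cont]) auto
    moreover have "continuous_on {y1..y2} G" unfolding G_def[abs_def] using y by (intro continuous_intros) auto
    ultimately show "continuous_on {y1..y2} (\<lambda>t. G t * flux N t)" by (intro continuous_on_mult)
  qed
  have hi: "(\<lambda>_. (y2 - y1) * C) integrable_on {y1..y2}" by auto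
  have le: "norm (G t * flux N t) \<le> (y2 - y1) * C" if "t \<in> {y1..y2}" for N t
    unfolding real_norm_def abs_mult using G[OF that] C y that by (intro mult_mono) auto
  have conv: "(\<lambda>N. G t * flux N t) \<longlonglongrightarrow> G t * limflux t" if "t \<in> {y1..y2}" for t
    using that y by (intro tendsto_mult tendsto_const flux_tendsto) auto
  note dc = dominated_convergence[OF i hi le conv]
  show "(\<lambda>y. (y - y1) * (y2 - y) / (y2 - y1) * limflux y) integrable_on {y1..y2}"
    using dc(1) unfolding G_def .
  obtain B m where B: "0 \<le> B" "\<And>N. m < N \<Longrightarrow> integral {y1..y2} (\<lambda>t. G t * flux N t)
      \<le> (\<Sum>n\<in>X. F (a n, b n)) + mass N y2 + B / (real N - real m) * (y2 - y1)\<^sup>2"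
    using flux_integral_le y unfolding G_def by blast
  have "integral {y1..y2} (\<lambda>t. G t * limflux t) \<le> (\<Sum>n\<in>X. F (a n, b n)) + \<epsilon> + 0 * (y2 - y1)\<^sup>2"
  proof (rule LIMSEQ_le[OF dc(2)])
    have "(\<lambda>N. B / (real N - real m)) \<longlonglongrightarrow> 0" by real_asymp
    thus "(\<lambda>N. (\<Sum>n\<in>X. F (a n, b n)) + \<epsilon> + B / (real N - real m) * (y2 - y1)\<^sup>2)
      \<longlonglongrightarrow> (\<Sum>n\<in>X. F (a n, b n)) + \<epsilon> + 0 * (y2 - y1)\<^sup>2"
      by (intro tendsto_add tendsto_mult tendsto_const)
    show "\<exists>N0. \<forall>N\<ge>N0. integral {y1..y2} (\<lambda>t. G t * flux N t)
       \<le> (\<Sum>n\<in>X. F (a n, b n)) + \<epsilon> + B / (real N - real m) * (y2 - y1)\<^sup>2"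
    proof (intro exI[of _ "Suc m"] allI impI)
      fix N assume "Suc m \<le> N"
      hence "m < N" by simp
      from B(2)[OF this] \<epsilon>[of N]
      show "integral {y1..y2} (\<lambda>t. G t * flux N t) \<le> (\<Sum>n\<in>X. F (a n, b n)) + \<epsilon> + B / (real N - real m) * (y2 - y1)\<^sup>2"
        by linarith
    qed
  qed
  thus "integral {y1..y2} (\<lambda>y. (y - y1) * (y2 - y) / (y2 - y1) * limflux y) \<le> (\<Sum>n\<in>X. F (a n, b n)) + \<epsilon>"
    unfolding G_def by simp
qed

lemma limflux_integral:
  "(\<lambda>y. y * limflux y) absolutely_integrable_on {0..}"
  "integral {0..} (\<lambda>y. y * limflux y) = (\<Sum>m\<in>X. \<Sum>n\<in>X. a m * b n * Jcoef (n - m))"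
proof -
  have eq: "y * limflux y = (\<Sum>m\<in>X. \<Sum>n\<in>X. a m * b n * (2 * y * ker_flux (of_int (n - m)) y))" for y
    unfolding limflux_def by (simp add: sum_distrib_left mult_ac del: of_int_diff)
  have ai: "(\<lambda>y. a m * b n * (2 * y * ker_flux (of_int (n - m)) y)) absolutely_integrable_on {0..}" for m n
    using absolutely_integrable_scaleR_left[OF ker_flux_integral(1)[of "n - m"], of "a m * b n"] by simp
  show "(\<lambda>y. y * limflux y) absolutely_integrable_on {0..}"
    unfolding eq by (intro absolutely_integrable_sum fin ai)
  have i: "(\<lambda>y. a m * b n * (2 * y * ker_flux (of_int (n - m)) y)) integrable_on {0..}" for m n
    using ai[of m n] by (simp add: absolutely_integrable_on_def)
  have "integral {0..} (\<lambda>y. y * limflux y) = (\<Sum>m\<in>X. \<Sum>n\<in>X. integral {0..} (\<lambda>y. a m * b n * (2 * y * ker_flux (of_int (n - m)) y)))"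
    unfolding eq by (subst integral_sum, rule fin, intro integrable_sum fin i, intro sum.cong refl integral_sum fin i)
  thus "integral {0..} (\<lambda>y. y * limflux y) = (\<Sum>m\<in>X. \<Sum>n\<in>X. a m * b n * Jcoef (n - m))"
    unfolding integral_mult_right ker_flux_integral(2) .
qed

text \<open>Second limit: as \<open>y1\<close> tends to 0 and \<open>y2\<close> to infinity, the
  Green function tends to \<open>y\<close> and stays below it, so dominated convergence recovers the
  pairing, while the mass at the top is at most \<open>\<epsilon>\<close>.\<close>

lemma bilinear_le_bellman: "(\<Sum>m\<in>X. \<Sum>n\<in>X. a m * b n * Jcoef (n - m)) \<le> (\<Sum>n\<in>X. F (a n, b n))"
proof (rule field_le_epsilon)
  fix \<epsilon> :: real assume "0 < \<epsilon>"
  from mass_vanishes[OF this] obtain Y where Y: "1 \<le> Y" "\<And>y N. Y \<le> y \<Longrightarrow> mass N y \<le> \<epsilon>" by blast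
  \<comment> \<open>The shift by 2 keeps \<open>y1 k\<close> below 1, hence below
    \<open>y2 k\<close> for every \<open>k\<close>.\<close>
  define y1 where "y1 k = 1 / (real k + 2)" for k
  define y2 where "y2 k = Y + real k" for k
  have y: "0 < y1 k" "y1 k < 1" "1 \<le> y2 k" "y1 k < y2 k" for k
  proof -
    show "0 < y1 k" "y1 k < 1" "1 \<le> y2 k" using Y(1) by (auto simp: y1_def y2_def)
    thus "y1 k < y2 k" by linarith
  qed
  define g where "g k t = (if t \<in> {y1 k..y2 k} then (t - y1 k) * (y2 k - t) / (y2 k - y1 k) * limflux t else 0)" for k t
  have gi: "g k integrable_on {0..}" "integral {0..} (g k) \<le> (\<Sum>n\<in>X. F (a n, b n)) + \<epsilon>" for k
  proof -
    have s: "{y1 k..y2 k} \<inter> {0..} = {y1 k..y2 k}" using y(1)[of k] by auto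
    have "mass N (y2 k) \<le> \<epsilon>" for N using Y(2) by (simp add: y2_def)
    note l = limflux_le[OF y(1,4) this]
    show "g k integrable_on {0..}" unfolding g_def[abs_def] integrable_restrict_Int s by (rule l(1))
    show "integral {0..} (g k) \<le> (\<Sum>n\<in>X. F (a n, b n)) + \<epsilon>" unfolding g_def[abs_def] integral_restrict_Int s by (rule l(2))
  qed
  have "(\<lambda>k. integral {0..} (g k)) \<longlonglongrightarrow> integral {0..} (\<lambda>y. y * limflux y)"
  proof (rule dominated_convergence(2)[OF gi(1)])
    show "(\<lambda>t. norm (t * limflux t)) integrable_on {0..}"
      using limflux_integral(1) by (simp add: absolutely_integrable_on_def)
    show "norm (g k t) \<le> norm (t * limflux t)" if "t \<in> {0..}" for k t
    proof (cases "t \<in> {y1 k..y2 k}")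
      case True
      have "0 \<le> (t - y1 k) * ((y2 k - t) / (y2 k - y1 k))" using True y(4)[of k] by auto
      moreover have "(t - y1 k) * ((y2 k - t) / (y2 k - y1 k)) \<le> t * 1"
        using True y(1,4)[of k] by (intro mult_mono) auto
      ultimately have "\<bar>(t - y1 k) * ((y2 k - t) / (y2 k - y1 k))\<bar> \<le> \<bar>t\<bar>" by linarith
      hence "\<bar>(t - y1 k) * ((y2 k - t) / (y2 k - y1 k))\<bar> * \<bar>limflux t\<bar> \<le> \<bar>t\<bar> * \<bar>limflux t\<bar>"
        by (rule mult_right_mono) simp
      thus ?thesis using True unfolding g_def by (simp add: abs_mult)
    qed (auto simp: g_def)
    show "(\<lambda>k. g k t) \<longlonglongrightarrow> t * limflux t" if "t \<in> {0..}" for t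
    proof (cases "t = 0")
      case True
      have "g k t = 0" for k using y(1)[of k] True by (simp add: g_def)
      thus ?thesis using True by simp
    next
      case False
      hence t: "0 < t" using that by simp
      have "(\<lambda>k. (t - y1 k) * ((y2 k - t) / (y2 k - y1 k)) * limflux t) \<longlonglongrightarrow> (t - 0) * 1 * limflux t"
      proof (intro tendsto_mult tendsto_diff tendsto_const)
        show "y1 \<longlonglongrightarrow> 0" unfolding y1_def[abs_def] by real_asymp
        show "(\<lambda>k. (y2 k - t) / (y2 k - y1 k)) \<longlonglongrightarrow> 1" unfolding y2_def y1_def by real_asymp
      qed
      moreover have "eventually (\<lambda>k. (t - y1 k) * ((y2 k - t) / (y2 k - y1 k)) * limflux t = g k t) sequentially"
      proof -
        have "eventually (\<lambda>k. y1 k < t) sequentially" unfolding y1_def using t by real_asymp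
        moreover have "eventually (\<lambda>k. t < y2 k) sequentially" unfolding y2_def by real_asymp
        ultimately show ?thesis by eventually_elim (auto simp: g_def)
      qed
      ultimately show ?thesis by (simp add: Lim_transform_eventually)
    qed
  qed
  hence "integral {0..} (\<lambda>y. y * limflux y) \<le> (\<Sum>n\<in>X. F (a n, b n)) + \<epsilon>"
    using gi(2) by (intro LIMSEQ_le_const2) auto
  thus "(\<Sum>m\<in>X. \<Sum>n\<in>X. a m * b n * Jcoef (n - m)) \<le> (\<Sum>n\<in>X. F (a n, b n)) + \<epsilon>"
    unfolding limflux_integral(2) .
qed

end

subsection \<open>The norm bound\<close>

text \<open>The scalings \<open>1 / (T * \<alpha> powr (1 / p))\<close> and
  \<open>1 / \<beta> powr (1 / q)\<close> normalize the right side to \<open>1 / p + 1 / q\<close>.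
  If one of \<open>\<alpha>\<close>, \<open>\<beta>\<close> is 0, letting its scaling grow forces
  \<open>Q \<le> 0\<close>.\<close>

lemma homogenize:
  fixes \<alpha> \<beta> p q T Q :: real
  assumes p: "1 < p" and q: "1 < q" and pq: "1 / p + 1 / q = 1" and T: "0 < T"
    and nn: "0 \<le> \<alpha>" "0 \<le> \<beta>"
    and le: "\<And>s t. 0 < s \<Longrightarrow> 0 < t \<Longrightarrow> s * t * Q \<le> T powr p * (s powr p * \<alpha>) / p + t powr q * \<beta> / q"
  shows "Q \<le> T * \<alpha> powr (1 / p) * \<beta> powr (1 / q)"
proof -
  have unbounded: "Q \<le> 0" if "\<And>s. 0 < s \<Longrightarrow> s * Q \<le> C" for C
  proof (rule ccontr)
    assume "\<not> Q \<le> 0"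
    hence Q: "0 < Q" by simp
    have "(\<bar>C\<bar> + 1) / Q * Q \<le> C" using Q by (intro that divide_pos_pos) auto
    thus False using Q by simp
  qed
  show ?thesis
  proof (cases "\<alpha> = 0 \<or> \<beta> = 0")
    case True
    have "Q \<le> 0"
    proof (cases "\<alpha> = 0")
      case True
      show ?thesis by (rule unbounded[of "\<beta> / q"]) (use le[of _ 1] True in simp)
    next
      case False
      hence "\<beta> = 0" using \<open>\<alpha> = 0 \<or> \<beta> = 0\<close> by simp
      thus ?thesis by (intro unbounded[of "T powr p * \<alpha> / p"]) (use le[of 1] in simp)
    qed
    moreover have "T * \<alpha> powr (1 / p) * \<beta> powr (1 / q) = 0" using True by auto
    ultimately show ?thesis by (simp only:)
  next
    case False
    hence pos: "0 < \<alpha>" "0 < \<beta>" using nn by auto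
    define A where "A = \<alpha> powr (1 / p)" define B where "B = \<beta> powr (1 / q)"
    have AB: "0 < A" "0 < B" using pos by (simp_all add: A_def B_def)
    have Ap: "A powr p = \<alpha>" "B powr q = \<beta>" using pos p q by (simp_all add: A_def B_def powr_powr)
    have "1 / (T * A) * (1 / B) * Q \<le> T powr p * ((1 / (T * A)) powr p * \<alpha>) / p + (1 / B) powr q * \<beta> / q"
      using AB T by (intro le) auto
    also have "\<dots> = 1 / p + 1 / q"
      using AB T pos unfolding powr_divide powr_mult by (simp add: powr_divide powr_mult Ap)
    finally have "Q / (T * A * B) \<le> 1" unfolding pq by simp
    thus ?thesis using AB T unfolding A_def[symmetric] B_def[symmetric] by (simp add: divide_le_eq)
  qed
qed

text \<open>Young's inequality term by term, homogenized with \<open>T = 1\<close>.\<close>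

lemma Holder_sum:
  fixes a b :: "'i \<Rightarrow> real"
  assumes p: "1 < p" and q: "1 < q" and pq: "1 / p + 1 / q = 1"
  shows "(\<Sum>i\<in>X. a i * b i) \<le> (\<Sum>i\<in>X. \<bar>a i\<bar> powr p) powr (1 / p) * (\<Sum>i\<in>X. \<bar>b i\<bar> powr q) powr (1 / q)"
proof -
  have "(\<Sum>i\<in>X. a i * b i) \<le> 1 * (\<Sum>i\<in>X. \<bar>a i\<bar> powr p) powr (1 / p) * (\<Sum>i\<in>X. \<bar>b i\<bar> powr q) powr (1 / q)"
  proof (rule homogenize[OF p q pq])
    fix s t :: real assume st: "0 < s" "0 < t"
    have "s * t * (\<Sum>i\<in>X. a i * b i) = (\<Sum>i\<in>X. (s * a i) * (t * b i))"
      by (simp add: sum_distrib_left mult_ac)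
    also have "\<dots> \<le> (\<Sum>i\<in>X. \<bar>s * a i\<bar> powr p / p + \<bar>t * b i\<bar> powr q / q)"
    proof (rule sum_mono)
      fix i
      have "(s * a i) * (t * b i) \<le> \<bar>s * a i\<bar> * \<bar>t * b i\<bar>" by (metis abs_ge_self abs_mult)
      also have "\<dots> \<le> \<bar>s * a i\<bar> powr p / p + \<bar>t * b i\<bar> powr q / q"
        using Youngs_inequality[OF p q pq, of "\<bar>s * a i\<bar>" "\<bar>t * b i\<bar>"] by simp
      finally show "(s * a i) * (t * b i) \<le> \<bar>s * a i\<bar> powr p / p + \<bar>t * b i\<bar> powr q / q" .
    qed
    also have "\<dots> = 1 powr p * (s powr p * (\<Sum>i\<in>X. \<bar>a i\<bar> powr p)) / p + t powr q * (\<Sum>i\<in>X. \<bar>b i\<bar> powr q) / q"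
      using st by (simp add: abs_mult powr_mult sum.distrib sum_distrib_left sum_divide_distrib)
    finally show "s * t * (\<Sum>i\<in>X. a i * b i) \<le> 1 powr p * (s powr p * (\<Sum>i\<in>X. \<bar>a i\<bar> powr p)) / p + t powr q * (\<Sum>i\<in>X. \<bar>b i\<bar> powr q) / q" .
  qed (auto intro: sum_nonneg)
  thus ?thesis by simp
qed

text \<open>Combine the Bellman bound on the pairing with \<open>F_le\<close> and let the smoothing
  \<open>e\<close> tend to 0.\<close>

lemma bilinear_le_sum:
  fixes a b :: "int \<Rightarrow> real"
  assumes p: "1 < p" "p \<le> 2" and pq: "1 / p + 1 / q = 1" and fin: "finite X"
  shows "(\<Sum>m\<in>X. \<Sum>n\<in>X. a m * b n * Jcoef (n - m))
    \<le> pichT p powr p * (\<Sum>n\<in>X. \<bar>a n\<bar> powr p) / p + (\<Sum>n\<in>X. \<bar>b n\<bar> powr q) / q"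
proof -
  define S where "S e = (\<Sum>n\<in>X. pichT p powr p * ((a n)\<^sup>2 + e\<^sup>2) powr (p / 2) / p + \<bar>b n\<bar> powr q / q)" for e
  have le: "(\<Sum>m\<in>X. \<Sum>n\<in>X. a m * b n * Jcoef (n - m)) \<le> S e" if "0 < e" for e
  proof -
    interpret potential p e using p that by unfold_locales
    interpret s: bellman_sequences F F1 F2 F11 F12 F22 X a b using fin by unfold_locales
    have "(\<Sum>m\<in>X. \<Sum>n\<in>X. a m * b n * Jcoef (n - m)) \<le> (\<Sum>n\<in>X. F (a n, b n))" by (rule s.bilinear_le_bellman)
    also have "\<dots> \<le> S e" unfolding S_def using F_le[OF pq, of "(a _, b _)"] by (intro sum_mono) simp
    finally show ?thesis .
  qed
  have "(\<lambda>k. S (1 / (real k + 1))) \<longlonglongrightarrow> (\<Sum>n\<in>X. pichT p powr p * ((a n)\<^sup>2 + 0\<^sup>2) powr (p / 2) / p + \<bar>b n\<bar> powr q / q)"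
    unfolding S_def
  proof (intro tendsto_sum tendsto_add tendsto_const tendsto_divide tendsto_mult)
    fix n
    have e: "(\<lambda>k. 1 / (real k + 1)) \<longlonglongrightarrow> 0" by real_asymp
    show "(\<lambda>k. ((a n)\<^sup>2 + (1 / (real k + 1))\<^sup>2) powr (p / 2)) \<longlonglongrightarrow> ((a n)\<^sup>2 + 0\<^sup>2) powr (p / 2)"
      using p by (intro tendsto_powr2 tendsto_add tendsto_power tendsto_const e) auto
  qed (use p in auto)
  hence "(\<Sum>m\<in>X. \<Sum>n\<in>X. a m * b n * Jcoef (n - m)) \<le> (\<Sum>n\<in>X. pichT p powr p * ((a n)\<^sup>2 + 0\<^sup>2) powr (p / 2) / p + \<bar>b n\<bar> powr q / q)"
    by (rule LIMSEQ_le_const) (auto intro!: le)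
  moreover have "((a n)\<^sup>2 + 0\<^sup>2) powr (p / 2) = \<bar>a n\<bar> powr p" for n
  proof -
    have "((a n)\<^sup>2 + 0\<^sup>2) = \<bar>a n\<bar> powr 2" by (cases "a n = 0") (simp_all add: powr_numeral)
    thus ?thesis by (simp only: powr_powr) simp
  qed
  ultimately have "(\<Sum>m\<in>X. \<Sum>n\<in>X. a m * b n * Jcoef (n - m))
     \<le> (\<Sum>n\<in>X. pichT p powr p * \<bar>a n\<bar> powr p / p + \<bar>b n\<bar> powr q / q)" by (simp only:)
  thus ?thesis by (simp add: sum.distrib sum_distrib_left sum_divide_distrib)
qed

lemma bilinear_le_norms_low:
  fixes a b :: "int \<Rightarrow> real"
  assumes p: "1 < p" "p \<le> 2" and q: "1 < q" and pq: "1 / p + 1 / q = 1" and fin: "finite X"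
  shows "(\<Sum>m\<in>X. \<Sum>n\<in>X. a m * b n * Jcoef (n - m))
    \<le> pichT p * (\<Sum>n\<in>X. \<bar>a n\<bar> powr p) powr (1 / p) * (\<Sum>n\<in>X. \<bar>b n\<bar> powr q) powr (1 / q)"
proof (rule homogenize[OF p(1) q pq pich_angle(5)[OF p]])
  fix s t :: real assume st: "0 < s" "0 < t"
  have "s * t * (\<Sum>m\<in>X. \<Sum>n\<in>X. a m * b n * Jcoef (n - m)) = (\<Sum>m\<in>X. \<Sum>n\<in>X. (s * a m) * (t * b n) * Jcoef (n - m))"
    by (simp add: sum_distrib_left mult_ac)
  also have "\<dots> \<le> pichT p powr p * (\<Sum>n\<in>X. \<bar>s * a n\<bar> powr p) / p + (\<Sum>n\<in>X. \<bar>t * b n\<bar> powr q) / q"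
    by (rule bilinear_le_sum[OF p pq fin])
  also have "\<dots> = pichT p powr p * (s powr p * (\<Sum>n\<in>X. \<bar>a n\<bar> powr p)) / p + t powr q * (\<Sum>n\<in>X. \<bar>b n\<bar> powr q) / q"
    using st by (simp add: abs_mult powr_mult sum_distrib_left)
  finally show "s * t * (\<Sum>m\<in>X. \<Sum>n\<in>X. a m * b n * Jcoef (n - m))
    \<le> pichT p powr p * (s powr p * (\<Sum>n\<in>X. \<bar>a n\<bar> powr p)) / p + t powr q * (\<Sum>n\<in>X. \<bar>b n\<bar> powr q) / q" .
qed (auto intro: sum_nonneg)

lemma Jcoef_minus: "Jcoef (- n) = - Jcoef n"
  by (simp add: Jcoef_def)

text \<open>The angles \<open>pi / (2 * p)\<close> and \<open>pi / (2 * q)\<close> are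
  complementary, so the cotangent at the larger exponent is the tangent at the smaller one.\<close>

lemma conjugate_exponent:
  fixes p :: real
  assumes "1 < p"
  shows "1 < p / (p - 1)" "1 / p + 1 / (p / (p - 1)) = 1"
    "p \<le> 2 \<Longrightarrow> cot (pi / (2 * pstar p)) = pichT p"
    "2 \<le> p \<Longrightarrow> cot (pi / (2 * pstar p)) = pichT (p / (p - 1))" "2 \<le> p \<Longrightarrow> p / (p - 1) \<le> 2"
    "0 < cot (pi / (2 * pstar p))"
proof -
  show q: "1 < p / (p - 1)" and pq: "1 / p + 1 / (p / (p - 1)) = 1" and q2: "2 \<le> p \<Longrightarrow> p / (p - 1) \<le> 2"
    using assms by (auto simp: field_simps)
  have ct: "cot (pi / (2 * (p / (p - 1)))) = pichT p"
  proof -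
    have "pi / (2 * (p / (p - 1))) = pi / 2 - pi / (2 * p)" using assms by (simp add: field_simps)
    thus ?thesis using tan_cot'[of "pi / (2 * (p / (p - 1)))"] by (simp add: pichT_def)
  qed
  have ct': "cot (pi / (2 * p)) = pichT (p / (p - 1))"
  proof -
    have "pi / (2 * (p / (p - 1))) = pi / 2 - pi / (2 * p)" using assms by (simp add: field_simps)
    thus ?thesis using tan_cot'[of "pi / (2 * p)"] by (simp add: pichT_def)
  qed
  have "p \<le> p / (p - 1)" if "p \<le> 2"
  proof -
    have "p * (p - 1) \<le> p * 1" using that assms by (intro mult_left_mono) auto
    thus ?thesis using assms by (simp add: field_simps)
  qed
  hence "p \<le> 2 \<Longrightarrow> pstar p = p / (p - 1)" by (simp add: pstar_def)
  moreover have "p / (p - 1) \<le> p" if "2 \<le> p"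
  proof -
    have "p * 1 \<le> p * (p - 1)" using that assms by (intro mult_left_mono) auto
    thus ?thesis using assms by (simp add: field_simps)
  qed
  hence "2 \<le> p \<Longrightarrow> pstar p = p" by (simp add: pstar_def)
  ultimately show l: "p \<le> 2 \<Longrightarrow> cot (pi / (2 * pstar p)) = pichT p" and g: "2 \<le> p \<Longrightarrow> cot (pi / (2 * pstar p)) = pichT (p / (p - 1))"
    using ct ct' by auto
  show "0 < cot (pi / (2 * pstar p))"
    using l g q q2 assms pich_angle(5)[of p] pich_angle(5)[of "p / (p - 1)"] by (cases "p \<le> 2") auto
qed

text \<open>For \<open>p \<ge> 2\<close> the kernel is antisymmetric, so \<open>a\<close> and
  \<open>b\<close> can be exchanged up to a sign and the case of the conjugate exponent
  applies.\<close>

lemma bilinear_le_norms: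
  fixes a b :: "int \<Rightarrow> real"
  assumes p: "1 < p" and fin: "finite X"
  defines "q \<equiv> p / (p - 1)"
  shows "(\<Sum>m\<in>X. \<Sum>n\<in>X. a m * b n * Jcoef (n - m))
    \<le> cot (pi / (2 * pstar p)) * (\<Sum>n\<in>X. \<bar>a n\<bar> powr p) powr (1 / p) * (\<Sum>n\<in>X. \<bar>b n\<bar> powr q) powr (1 / q)"
proof (cases "p \<le> 2")
  case True
  show ?thesis unfolding conjugate_exponent(3)[OF p True] q_def
    by (rule bilinear_le_norms_low[OF p True conjugate_exponent(1,2)[OF p] fin])
next
  case False
  hence p2: "2 \<le> p" by simp
  note c = conjugate_exponent[OF p, folded q_def]
  have "(\<Sum>m\<in>X. \<Sum>n\<in>X. a m * b n * Jcoef (n - m)) = (\<Sum>n\<in>X. \<Sum>m\<in>X. a m * b n * Jcoef (n - m))"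
    by (rule sum.swap)
  also have "\<dots> = (\<Sum>n\<in>X. \<Sum>m\<in>X. b n * (- a m) * Jcoef (m - n))"
  proof (intro sum.cong refl)
    fix m n
    have "Jcoef (n - m) = - Jcoef (m - n)" using Jcoef_minus[of "m - n"] by simp
    thus "a m * b n * Jcoef (n - m) = b n * (- a m) * Jcoef (m - n)" by simp
  qed
  also have "\<dots> \<le> pichT q * (\<Sum>n\<in>X. \<bar>b n\<bar> powr q) powr (1 / q) * (\<Sum>m\<in>X. \<bar>- a m\<bar> powr p) powr (1 / p)"
    by (rule bilinear_le_norms_low[OF c(1) c(5)[OF p2] p _ fin]) (use c(2) in simp)
  finally show ?thesis unfolding c(4)[OF p2] by (simp add: mult_ac)
qed

section \<open>From finite sums to the operator on the sequence space\<close>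

text \<open>The integral in \<open>Jcoef\<close> lies between 0 and a constant independent of
  \<open>k\<close>. The lower bound serves sharpness, the upper one absolute convergence.\<close>

lemma Jcoef_bounds:
  "0 < k \<Longrightarrow> 1 / (pi * of_int k) \<le> Jcoef k"
  "\<exists>C. \<forall>k. \<bar>Jcoef k\<bar> \<le> C / \<bar>of_int k\<bar>"
proof -
  define D where "D = 64 * integral {0..} majorant"
  have I: "0 \<le> integral {0..} (Jint (of_int k))" "integral {0..} (Jint (of_int k)) \<le> D" if "k \<noteq> 0" for k :: int
  proof -
    have k: "1 \<le> \<bar>real_of_int k\<bar>" using that by auto
    have i: "Jint (of_int k) integrable_on {0..}"
      using absolutely_integrable_majorized[OF Jint_measurable, of "of_int k" 64] Jint_le[OF k]
      by (auto simp: absolutely_integrable_on_def)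
    show "0 \<le> integral {0..} (Jint (of_int k))" using Jint_le[OF k] by (intro integral_nonneg i) auto
    have "integral {0..} (Jint (of_int k)) \<le> integral {0..} (\<lambda>t. 64 * majorant t)"
      using Jint_le[OF k] by (intro integral_le i integrable_on_mult_right majorant_integrable) auto
    thus "integral {0..} (Jint (of_int k)) \<le> D" by (simp add: D_def)
  qed
  have J: "Jcoef k = 1 / (pi * of_int k) * (1 + integral {0..} (Jint (of_int k)))" if "k \<noteq> 0" for k :: int
    using that unfolding Jcoef_def Jint_def[abs_def] by simp
  show "1 / (pi * of_int k) \<le> Jcoef k" if "0 < k"
  proof -
    have "1 / (pi * of_int k) * 1 \<le> 1 / (pi * of_int k) * (1 + integral {0..} (Jint (of_int k)))"
      using that I(1)[of k] by (intro mult_left_mono) auto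
    thus ?thesis using J[of k] that by simp
  qed
  have "\<bar>Jcoef k\<bar> \<le> ((1 + D) / pi) / \<bar>of_int k\<bar>" for k
  proof (cases "k = 0")
    case False
    have "\<bar>Jcoef k\<bar> = 1 / (pi * \<bar>of_int k\<bar>) * (1 + integral {0..} (Jint (of_int k)))"
      using I(1)[OF False] unfolding J[OF False] by (simp add: abs_mult)
    also have "\<dots> \<le> 1 / (pi * \<bar>of_int k\<bar>) * (1 + D)" using I(2)[OF False] by (intro mult_left_mono) auto
    finally show ?thesis by simp
  qed (simp add: Jcoef_def)
  thus "\<exists>C. \<forall>k. \<bar>Jcoef k\<bar> \<le> C / \<bar>of_int k\<bar>" by blast
qed

lemma Jcoef_in_lp:
  assumes q: "1 < q"
  shows "(\<lambda>k. \<bar>Jcoef k\<bar> powr q) summable_on UNIV"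
proof -
  obtain C where C: "\<And>k. \<bar>Jcoef k\<bar> \<le> C / \<bar>of_int k\<bar>" using Jcoef_bounds(2) by blast
  have C0: "0 \<le> C" using C[of 1] by simp
  have nat: "(\<lambda>n. C powr q * real n powr (- q)) summable_on UNIV"
    using q C0 by (subst summable_on_UNIV_nonneg_real_iff) (auto intro!: summable_mult simp: summable_real_powr_iff)
  have le: "\<bar>Jcoef k\<bar> powr q \<le> C powr q * real (nat \<bar>k\<bar>) powr (- q)" for k
  proof -
    have "\<bar>Jcoef k\<bar> powr q \<le> (C / \<bar>of_int k\<bar>) powr q" using C[of k] q by (intro powr_mono2) auto
    also have "\<dots> = C powr q * real (nat \<bar>k\<bar>) powr (- q)"
      by (simp add: powr_divide powr_minus_divide)
    finally show ?thesis .
  qed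
  have half: "(\<lambda>n. \<bar>Jcoef (int n)\<bar> powr q) summable_on UNIV" "(\<lambda>n. \<bar>Jcoef (- int n)\<bar> powr q) summable_on UNIV"
  proof -
    show "(\<lambda>n. \<bar>Jcoef (int n)\<bar> powr q) summable_on UNIV"
      by (rule summable_on_comparison_test[OF nat]) (use le[of "int _"] in auto)
    thus "(\<lambda>n. \<bar>Jcoef (- int n)\<bar> powr q) summable_on UNIV" by (simp add: Jcoef_minus)
  qed
  have "(\<lambda>k. \<bar>Jcoef k\<bar> powr q) summable_on (range int \<union> range (\<lambda>n. - int n))"
    using half by (intro summable_on_union) (auto simp: summable_on_reindex inj_on_def o_def)
  moreover have "range int \<union> range (\<lambda>n. - int n) = UNIV"
  proof -
    have "k \<in> range int \<union> range (\<lambda>n. - int n)" for k by (cases k rule: int_cases2) auto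
    thus ?thesis by blast
  qed
  ultimately show ?thesis by simp
qed

text \<open>Young's inequality, with the kernel in the space of the conjugate exponent.\<close>

lemma Jop_abs_summable:
  assumes p: "1 < p" and a: "in_lp p a"
  shows "(\<lambda>m. \<bar>Jcoef m * a (n - m)\<bar>) summable_on UNIV"
proof -
  define q where "q = p / (p - 1)"
  note c = conjugate_exponent[OF p, folded q_def]
  have "(\<lambda>m. \<bar>a (n - m)\<bar> powr p) summable_on UNIV"
  proof -
    have "bij_betw (\<lambda>m. n - m) UNIV UNIV" by (rule bij_betw_byWitness[where f' = "\<lambda>m. n - m"]) auto
    from summable_on_reindex_bij_betw[OF this, of "\<lambda>m. \<bar>a m\<bar> powr p"] a show ?thesis
      by (simp add: in_lp_def)
  qed
  hence s: "(\<lambda>m. 1 / q * \<bar>Jcoef m\<bar> powr q + 1 / p * \<bar>a (n - m)\<bar> powr p) summable_on UNIV"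
    by (intro summable_on_add summable_on_cmult_right Jcoef_in_lp[OF c(1)])
  show ?thesis
  proof (rule summable_on_comparison_test[OF s])
    fix m
    have "\<bar>a (n - m)\<bar> * \<bar>Jcoef m\<bar> \<le> \<bar>a (n - m)\<bar> powr p / p + \<bar>Jcoef m\<bar> powr q / q"
      using Youngs_inequality[OF p c(1,2)] by simp
    thus "\<bar>Jcoef m * a (n - m)\<bar> \<le> 1 / q * \<bar>Jcoef m\<bar> powr q + 1 / p * \<bar>a (n - m)\<bar> powr p"
      by (simp add: abs_mult mult.commute)
  qed auto
qed

lemma Jop_eq:
  assumes p: "1 < p" and a: "in_lp p a"
  shows "(\<lambda>k. a k * Jcoef (n - k)) summable_on UNIV" "Jop a n = (\<Sum>\<^sub>\<infinity>k. a k * Jcoef (n - k))"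
proof -
  have b: "bij_betw (\<lambda>m. n - m) UNIV UNIV" by (rule bij_betw_byWitness[where f' = "\<lambda>m. n - m"]) auto
  have "(\<lambda>m. Jcoef m * a (n - m)) summable_on UNIV"
    by (rule abs_summable_summable) (use Jop_abs_summable[OF p a, of n] in simp)
  thus "(\<lambda>k. a k * Jcoef (n - k)) summable_on UNIV"
    using summable_on_reindex_bij_betw[OF b, of "\<lambda>k. a k * Jcoef (n - k)"] by (simp add: mult.commute)
  show "Jop a n = (\<Sum>\<^sub>\<infinity>k. a k * Jcoef (n - k))"
    using infsum_reindex_bij_betw[OF b, of "\<lambda>k. a k * Jcoef (n - k)"] by (simp add: Jop_def mult.commute)
qed

lemma lp_norm_nonneg: "0 \<le> lp_norm p a" by (simp add: lp_norm_def)

lemma finite_sum_le_lp_norm: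
  assumes "0 < p" "in_lp p a" "finite X"
  shows "(\<Sum>n\<in>X. \<bar>a n\<bar> powr p) powr (1 / p) \<le> lp_norm p a"
  unfolding lp_norm_def using assms
  by (intro powr_mono2 finite_sum_le_infsum sum_nonneg) (auto simp: in_lp_def)

text \<open>\<open>b\<close> stays finite, so the pairing is a sum over the index of
  \<open>a\<close> alone; its finite partial sums are pairings with truncations of \<open>a\<close>,
  whose norms do not exceed that of \<open>a\<close>.\<close>

lemma pairing_le:
  assumes p: "1 < p" and a: "in_lp p a" and fin: "finite Y"
  defines "q \<equiv> p / (p - 1)"
  shows "(\<Sum>n\<in>Y. b n * Jop a n)
    \<le> cot (pi / (2 * pstar p)) * lp_norm p a * (\<Sum>n\<in>Y. \<bar>b n\<bar> powr q) powr (1 / q)"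
proof -
  define C where "C = cot (pi / (2 * pstar p))"
  define B where "B = (\<Sum>n\<in>Y. \<bar>b n\<bar> powr q) powr (1 / q)"
  have C: "0 < C" unfolding C_def by (rule conjugate_exponent(6)[OF p])
  have q: "1 < q" unfolding q_def by (rule conjugate_exponent(1)[OF p])
  have hs: "((\<lambda>k. \<Sum>n\<in>Y. b n * (a k * Jcoef (n - k))) has_sum (\<Sum>n\<in>Y. b n * Jop a n)) UNIV"
    using fin
  proof (induction Y)
    case (insert n Y)
    have "((\<lambda>k. b n * (a k * Jcoef (n - k))) has_sum b n * Jop a n) UNIV"
      using Jop_eq[OF p a, of n] by (intro has_sum_cmult_right) (simp add: has_sum_infsum)
    from has_sum_add[OF this insert.IH] show ?case using insert.hyps by simp
  qed simp
  have "(\<Sum>n\<in>Y. b n * Jop a n) \<le> C * lp_norm p a * B"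
  proof (rule has_sum_le_finite_sums[OF hs])
    fix K :: "int set" assume K: "finite K"
    define X where "X = K \<union> Y"
    have X: "finite X" "K \<subseteq> X" "Y \<subseteq> X" using K fin by (auto simp: X_def)
    define a' where "a' k = (if k \<in> K then a k else 0)" for k
    define b' where "b' n = (if n \<in> Y then b n else 0)" for n
    have "(\<Sum>k\<in>K. \<Sum>n\<in>Y. b n * (a k * Jcoef (n - k))) = (\<Sum>m\<in>X. \<Sum>n\<in>X. a' m * b' n * Jcoef (n - m))"
    proof -
      have "(\<Sum>m\<in>X. \<Sum>n\<in>X. a' m * b' n * Jcoef (n - m)) = (\<Sum>m\<in>X. \<Sum>n\<in>Y. a' m * b n * Jcoef (n - m))"
        using X fin K by (intro sum.cong[OF refl] sum.mono_neutral_cong_right) (auto simp: b'_def)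
      also have "\<dots> = (\<Sum>m\<in>K. \<Sum>n\<in>Y. a m * b n * Jcoef (n - m))"
        using X K fin by (intro sum.mono_neutral_cong_right) (auto simp: a'_def)
      finally show ?thesis by (simp add: mult_ac)
    qed
    also have "\<dots> \<le> C * (\<Sum>n\<in>X. \<bar>a' n\<bar> powr p) powr (1 / p) * (\<Sum>n\<in>X. \<bar>b' n\<bar> powr q) powr (1 / q)"
      unfolding C_def q_def by (rule bilinear_le_norms[OF p X(1)])
    also have "(\<Sum>n\<in>X. \<bar>a' n\<bar> powr p) = (\<Sum>n\<in>K. \<bar>a n\<bar> powr p)"
      using X K p by (intro sum.mono_neutral_cong_right) (auto simp: a'_def)
    also have "(\<Sum>n\<in>X. \<bar>b' n\<bar> powr q) = (\<Sum>n\<in>Y. \<bar>b n\<bar> powr q)"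
      using X fin q by (intro sum.mono_neutral_cong_right) (auto simp: b'_def)
    also have "C * (\<Sum>n\<in>K. \<bar>a n\<bar> powr p) powr (1 / p) * (\<Sum>n\<in>Y. \<bar>b n\<bar> powr q) powr (1 / q) \<le> C * lp_norm p a * B"
      unfolding B_def using finite_sum_le_lp_norm[OF _ a K] p C by (intro mult_right_mono mult_left_mono) auto
    finally show "(\<Sum>k\<in>K. \<Sum>n\<in>Y. b n * (a k * Jcoef (n - k))) \<le> C * lp_norm p a * B" .
  qed
  thus ?thesis by (simp add: C_def B_def)
qed

lemma Jop_finite_sum_le:
  assumes p: "1 < p" and a: "in_lp p a" and fin: "finite Y"
  shows "(\<Sum>n\<in>Y. \<bar>Jop a n\<bar> powr p) \<le> (cot (pi / (2 * pstar p)) * lp_norm p a) powr p"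
proof -
  define q where "q = p / (p - 1)"
  define M where "M = cot (pi / (2 * pstar p)) * lp_norm p a"
  have M: "0 \<le> M" unfolding M_def using conjugate_exponent(6)[OF p] lp_norm_nonneg[of p a] by simp
  note c = conjugate_exponent[OF p, folded q_def]
  define S where "S = (\<Sum>n\<in>Y. \<bar>Jop a n\<bar> powr p)"
  have S0: "0 \<le> S" unfolding S_def by (intro sum_nonneg) auto
  \<comment> \<open>The equality case of Hoelder's inequality: \<open>b n * Jop a n\<close> and
    \<open>\<bar>b n\<bar> powr q\<close> both equal
    \<open>\<bar>Jop a n\<bar> powr p\<close>.\<close>
  define b where "b n = sgn (Jop a n) * \<bar>Jop a n\<bar> powr (p - 1)" for n
  have 1: "b n * Jop a n = \<bar>Jop a n\<bar> powr p" for n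
  proof (cases "Jop a n = 0")
    case False
    have "b n * Jop a n = \<bar>Jop a n\<bar> powr (p - 1) * \<bar>Jop a n\<bar> powr 1"
    proof -
      have "sgn (Jop a n) * Jop a n = \<bar>Jop a n\<bar>" by (simp add: sgn_if)
      hence "\<bar>Jop a n\<bar> powr (p - 1) * (sgn (Jop a n) * Jop a n) = \<bar>Jop a n\<bar> powr (p - 1) * \<bar>Jop a n\<bar> powr 1"
        by simp
      thus ?thesis by (simp add: b_def mult_ac)
    qed
    also have "\<dots> = \<bar>Jop a n\<bar> powr (p - 1 + 1)" by (rule powr_add[symmetric])
    finally show ?thesis by simp
  qed (simp add: b_def)
  have 2: "\<bar>b n\<bar> powr q = \<bar>Jop a n\<bar> powr p" for n
  proof -
    have "\<bar>b n\<bar> = \<bar>Jop a n\<bar> powr (p - 1)" by (cases "Jop a n" "0::real" rule: linorder_cases) (auto simp: b_def abs_mult)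
    thus ?thesis using p by (simp add: powr_powr q_def)
  qed
  have "S \<le> M * S powr (1 / q)"
    using pairing_le[OF p a fin, of b] unfolding 1 q_def[symmetric] 2 S_def[symmetric] M_def by simp
  show ?thesis unfolding S_def[symmetric] M_def[symmetric]
  proof (cases "S = 0")
    case False
    hence S: "0 < S" using S0 by simp
    have "S = S powr (1 / p) * S powr (1 / q)" using S c(2) by (simp flip: powr_add)
    hence "S powr (1 / p) * S powr (1 / q) \<le> M * S powr (1 / q)" using \<open>S \<le> M * S powr (1 / q)\<close> by simp
    hence "S powr (1 / p) \<le> M" using S by simp
    hence "(S powr (1 / p)) powr p \<le> M powr p" using p by (intro powr_mono2) auto
    thus "S \<le> M powr p" using S p by (simp add: powr_powr)
  qed simp
qed

lemma Jop_bounded: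
  assumes p: "1 < p" and a: "in_lp p a"
  shows "in_lp p (Jop a)" "lp_norm p (Jop a) \<le> cot (pi / (2 * pstar p)) * lp_norm p a"
proof -
  define M where "M = cot (pi / (2 * pstar p)) * lp_norm p a"
  have M: "0 \<le> M" unfolding M_def using conjugate_exponent(6)[OF p] lp_norm_nonneg[of p a] by simp
  show s: "in_lp p (Jop a)" unfolding in_lp_def
    by (rule nonneg_bounded_partial_sums_imp_summable_on[where C = "M powr p"])
      (auto simp: M_def intro!: eventually_finite_subsets_at_top_weakI Jop_finite_sum_le[OF p a])
  have "(\<Sum>\<^sub>\<infinity>n. \<bar>Jop a n\<bar> powr p) \<le> M powr p"
    using s unfolding in_lp_def by (rule infsum_le_finite_sums) (simp add: M_def Jop_finite_sum_le[OF p a])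
  hence "lp_norm p (Jop a) \<le> (M powr p) powr (1 / p)" unfolding lp_norm_def
    using p by (intro powr_mono2 infsum_nonneg) auto
  thus "lp_norm p (Jop a) \<le> cot (pi / (2 * pstar p)) * lp_norm p a" using p M by (simp add: powr_powr M_def)
qed

subsection \<open>Sharpness\<close>

text \<open>Divergence of the total weight makes every initial block negligible.\<close>

lemma weighted_Cesaro:
  fixes w x :: "nat \<Rightarrow> real"
  assumes w: "\<And>n. 0 \<le> w n" and W: "filterlim (\<lambda>n. \<Sum>k<n. w k) at_top sequentially"
    and x: "x \<longlonglongrightarrow> L"
  shows "(\<lambda>n. (\<Sum>k<n. w k * x k) / (\<Sum>k<n. w k)) \<longlonglongrightarrow> L"
proof (rule LIMSEQ_I)
  fix r :: real assume r: "0 < r"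
  define W where "W n = (\<Sum>k<n. w k)" for n
  obtain N where N: "\<And>n. N \<le> n \<Longrightarrow> \<bar>x n - L\<bar> < r / 2"
    using LIMSEQ_D[OF x, of "r / 2"] r by auto
  define C where "C = (\<Sum>k<N. w k * \<bar>x k - L\<bar>)"
  have C: "0 \<le> C" unfolding C_def using w by (intro sum_nonneg mult_nonneg_nonneg) auto
  from W have "eventually (\<lambda>n. 2 * C / r + 1 \<le> W n) sequentially" unfolding W_def by (simp add: filterlim_at_top)
  then obtain M where M: "\<And>n. M \<le> n \<Longrightarrow> 2 * C / r + 1 \<le> W n" by (auto simp: eventually_sequentially)
  show "\<exists>no. \<forall>n\<ge>no. norm ((\<Sum>k<n. w k * x k) / (\<Sum>k<n. w k) - L) < r"
  proof (intro exI[of _ "max M N"] allI impI)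
    fix n assume n: "max M N \<le> n"
    have "0 \<le> 2 * C / r" using C r by simp
    hence Wn: "2 * C / r + 1 \<le> W n" "0 < W n" using M[of n] n by auto
    have "\<bar>\<Sum>k<n. w k * (x k - L)\<bar> \<le> (\<Sum>k<n. \<bar>w k * (x k - L)\<bar>)" by (rule sum_abs)
    also have "\<dots> = (\<Sum>k<n. w k * \<bar>x k - L\<bar>)" using w by (simp add: abs_mult)
    also have "\<dots> = C + (\<Sum>k=N..<n. w k * \<bar>x k - L\<bar>)"
      unfolding C_def using n by (subst sum.atLeastLessThan_concat[of 0 N n, symmetric, unfolded atLeast0LessThan]) auto
    also have "(\<Sum>k=N..<n. w k * \<bar>x k - L\<bar>) \<le> (\<Sum>k=N..<n. w k * (r / 2))"
      using w N by (intro sum_mono mult_left_mono) (auto intro: less_imp_le)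
    also have "\<dots> \<le> (\<Sum>k<n. w k * (r / 2))"
      using w r by (intro sum_mono2) auto
    also have "\<dots> = W n * (r / 2)" by (simp add: W_def sum_distrib_right)
    finally have "\<bar>\<Sum>k<n. w k * (x k - L)\<bar> \<le> C + W n * (r / 2)" by simp
    also have "C < W n * (r / 2)"
    proof -
      have "2 * C / r < W n" using Wn by simp
      thus ?thesis using r by (simp add: field_simps)
    qed
    finally have 1: "\<bar>\<Sum>k<n. w k * (x k - L)\<bar> < r * W n" by simp
    have "(\<Sum>k<n. w k * (x k - L)) = (\<Sum>k<n. w k * x k) - L * W n"
      by (simp add: W_def right_diff_distrib sum_subtractf sum_distrib_left mult.commute)
    hence "(\<Sum>k<n. w k * x k) / W n - L = (\<Sum>k<n. w k * (x k - L)) / W n" using Wn by (simp add: field_simps)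
    thus "norm ((\<Sum>k<n. w k * x k) / (\<Sum>k<n. w k) - L) < r"
      unfolding W_def[symmetric] using 1 Wn(2) by (simp add: divide_less_eq)
  qed
qed

text \<open>Riemann sums of \<open>t powr s\<close> on \<open>[0, 1]\<close>, with an integrable
  singularity at 0 when \<open>s < 0\<close>. As in the Stolz-Cesaro theorem, the weights are the
  increments of \<open>(k + 1) powr (s + 1)\<close>, so the singularity needs no separate
  estimate.\<close>

lemma power_sum_asymptotics:
  fixes s :: real
  assumes "-1 < s"
  shows "(\<lambda>n. (\<Sum>m=1..<n. (real m / real n) powr s) / real n) \<longlonglongrightarrow> 1 / (s + 1)"
proof -
  define w where "w k = real (k + 2) powr (s + 1) - real (k + 1) powr (s + 1)" for k
  define x where "x k = real (k + 1) powr s / w k" for k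
  have w: "0 < w k" for k unfolding w_def using assms by (simp add: powr_less_mono2)
  have W: "(\<Sum>k<n. w k) = real (n + 1) powr (s + 1) - 1" for n
    by (induction n) (simp_all add: w_def)
  have "filterlim (\<lambda>n. real (n + 1) powr (s + 1) - 1) at_top sequentially" using assms by real_asymp
  hence "(\<lambda>n. (\<Sum>k<n. w k * x k) / (\<Sum>k<n. w k)) \<longlonglongrightarrow> 1 / (s + 1)"
  proof (intro weighted_Cesaro)
    show "x \<longlonglongrightarrow> 1 / (s + 1)" unfolding x_def w_def using assms by real_asymp (simp add: divide_inverse)
  qed (use w in \<open>auto simp: W less_imp_le\<close>)
  moreover have "(\<Sum>k<n. w k * x k) = (\<Sum>k<n. real (k + 1) powr s)" for n
    using w by (simp add: x_def less_imp_neq[symmetric])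
  ultimately have 1: "(\<lambda>n. (\<Sum>k<n. real (k + 1) powr s) / (real (n + 1) powr (s + 1) - 1)) \<longlonglongrightarrow> 1 / (s + 1)"
    by (simp only: W)
  have 2: "(\<lambda>n. (real (n + 1) powr (s + 1) - 1) / real (n + 1) powr (s + 1)) \<longlonglongrightarrow> 1"
    using assms by real_asymp
  have 3: "(\<lambda>n. (\<Sum>k<n. real (k + 1) powr s) / real (n + 1) powr (s + 1)) \<longlonglongrightarrow> 1 / (s + 1)"
  proof (rule Lim_transform_eventually)
    show "(\<lambda>n. (\<Sum>k<n. real (k + 1) powr s) / (real (n + 1) powr (s + 1) - 1) * ((real (n + 1) powr (s + 1) - 1) / real (n + 1) powr (s + 1)))
      \<longlonglongrightarrow> 1 / (s + 1)"
      using tendsto_mult[OF 1 2] by simp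
    show "eventually (\<lambda>n. (\<Sum>k<n. real (k + 1) powr s) / (real (n + 1) powr (s + 1) - 1) * ((real (n + 1) powr (s + 1) - 1) / real (n + 1) powr (s + 1))
       = (\<Sum>k<n. real (k + 1) powr s) / real (n + 1) powr (s + 1)) sequentially"
      using eventually_gt_at_top[of 0]
    proof eventually_elim
      case (elim n)
      have "1 powr (s + 1) < real (n + 1) powr (s + 1)" using elim assms by (intro powr_less_mono2) auto
      thus ?case by simp
    qed
  qed
  have "(\<Sum>m=1..<Suc n. (real m / real (Suc n)) powr s) / real (Suc n) = (\<Sum>k<n. real (k + 1) powr s) / real (n + 1) powr (s + 1)" for n
  proof -
    have "(\<Sum>m=1..<Suc n. (real m / real (Suc n)) powr s) = (\<Sum>k<n. (real (k + 1) / real (Suc n)) powr s)"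
      by (rule sum.reindex_bij_witness[of _ Suc "\<lambda>m. m - 1"]) auto
    also have "\<dots> = (\<Sum>k<n. real (k + 1) powr s) / real (n + 1) powr s"
      by (simp add: powr_divide sum_divide_distrib)
    finally show ?thesis by (simp add: powr_add)
  qed
  hence "(\<lambda>n. (\<Sum>m=1..<Suc n. (real m / real (Suc n)) powr s) / real (Suc n)) \<longlonglongrightarrow> 1 / (s + 1)" using 3 by simp
  thus ?thesis by (rule LIMSEQ_imp_Suc)
qed

text \<open>The kernel \<open>1 / (n - m) + 1 / (n + m)\<close>, symmetrized against the weights \<open>n powr (g - 1) * m powr (- g)\<close>.\<close>

definition symkern :: "real \<Rightarrow> nat \<Rightarrow> nat \<Rightarrow> real" where
  "symkern g n m = 2 * ((real n / real m) powr g - (real m / real n) powr g) / ((real n)\<^sup>2 - (real m)\<^sup>2)"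

text \<open>With \<open>t = m / n\<close> the kernel is
  \<open>2 * (t powr (- g) - t powr g) / (n^2 * (1 - t^2))\<close>; the left side cuts off the
  geometric series of \<open>1 / (1 - t^2)\<close>.\<close>

lemma symkern_ge:
  assumes "0 < m" "m < n" "0 < g"
  shows "(\<Sum>k<K. 2 * ((real m / real n) powr (2 * real k - g) - (real m / real n) powr (2 * real k + g))) / (real n)\<^sup>2 \<le> symkern g n m"
proof -
  define t where "t = real m / real n"
  have t: "0 < t" "t < 1" using assms by (auto simp: t_def)
  have t2: "t\<^sup>2 < 1" "0 < t\<^sup>2" using t by (auto simp: power_less_one_iff)
  have n: "0 < real n" using assms by simp
  have geo: "(\<Sum>k<K. (t\<^sup>2) ^ k) \<le> 1 / (1 - t\<^sup>2)"
  proof -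
    have "(\<Sum>k<K. (t\<^sup>2) ^ k) = (1 - (t\<^sup>2) ^ K) / (1 - t\<^sup>2)" using t2 by (subst geometric_sum) (auto simp: divide_simps algebra_simps)
    also have "\<dots> \<le> 1 / (1 - t\<^sup>2)" using t2 by (intro divide_right_mono) auto
    finally show ?thesis .
  qed
  have pw: "t powr (2 * real k) = (t\<^sup>2) ^ k" for k
  proof -
    have "t powr (2 * real k) = t powr real (2 * k)" by simp
    also have "\<dots> = t ^ (2 * k)" using t(1) by (rule powr_realpow)
    also have "\<dots> = (t\<^sup>2) ^ k" by (rule power_mult)
    finally show ?thesis .
  qed
  have "(\<Sum>k<K. 2 * (t powr (2 * real k - g) - t powr (2 * real k + g))) = 2 * (t powr (- g) - t powr g) * (\<Sum>k<K. (t\<^sup>2) ^ k)"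
    unfolding sum_distrib_left
  proof (intro sum.cong refl)
    fix k
    have "t powr (2 * real k - g) = (t\<^sup>2) ^ k * t powr (- g)" "t powr (2 * real k + g) = (t\<^sup>2) ^ k * t powr g"
      unfolding pw[symmetric] powr_add[symmetric] by simp_all
    thus "2 * (t powr (2 * real k - g) - t powr (2 * real k + g)) = 2 * (t powr (- g) - t powr g) * (t\<^sup>2) ^ k"
      by (simp add: algebra_simps)
  qed
  also have "\<dots> \<le> 2 * (t powr (- g) - t powr g) * (1 / (1 - t\<^sup>2))"
  proof (rule mult_left_mono[OF geo])
    have "t powr g \<le> t powr (- g)" using t assms(3) by (intro powr_mono') auto
    thus "0 \<le> 2 * (t powr (- g) - t powr g)" by simp
  qed
  finally have "(\<Sum>k<K. 2 * (t powr (2 * real k - g) - t powr (2 * real k + g))) / (real n)\<^sup>2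
    \<le> 2 * (t powr (- g) - t powr g) * (1 / (1 - t\<^sup>2)) / (real n)\<^sup>2" using n by (intro divide_right_mono) auto
  also have "\<dots> = symkern g n m"
  proof -
    have "t powr (- g) = (real n / real m) powr g"
      using assms by (simp add: t_def powr_minus powr_divide)
    moreover have "(1 - t\<^sup>2) * (real n)\<^sup>2 = (real n)\<^sup>2 - (real m)\<^sup>2"
      using n by (simp add: t_def power_divide field_simps)
    hence "1 / (1 - t\<^sup>2) / (real n)\<^sup>2 = 1 / ((real n)\<^sup>2 - (real m)\<^sup>2)" by (metis divide_divide_eq_left)
    ultimately show ?thesis unfolding symkern_def t_def[symmetric] by (metis times_divide_eq_right mult_1_right)
  qed
  finally show ?thesis unfolding t_def .
qed

text \<open>Half the pairing of the even sequence \<open>\<bar>n\<bar> powr (- g)\<close> with the odd sequence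
  \<open>sgn n * \<bar>n\<bar> powr (g - 1)\<close>, truncated to \<open>1 \<le> \<bar>n\<bar> \<le> N\<close>.\<close>

definition testpair :: "real \<Rightarrow> nat \<Rightarrow> real" where
  "testpair g N = (\<Sum>n\<in>{1..N}. \<Sum>m\<in>{1..N}. real n powr (g - 1) * real m powr (- g)
      * (Jcoef (int n - int m) + Jcoef (int n + int m)))"

text \<open>Add the terms \<open>(n, m)\<close> and \<open>(m, n)\<close>. For \<open>m < n\<close>
  the coefficient of \<open>Jcoef (n - m)\<close> becomes \<open>w n m - w m n\<close>, nonnegative
  because \<open>1 / 2 \<le> g\<close>, so the lower bound \<open>1 / (pi * k)\<close> may be used
  in both terms; the diagonal contributes nonnegatively.\<close>

lemma testpair_ge:
  assumes g: "1 / 2 \<le> g"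
  shows "(1 / pi) * (\<Sum>n\<in>{1..N}. \<Sum>m\<in>{1..<n}. symkern g n m) \<le> testpair g N"
proof -
  define w where "w n m = real n powr (g - 1) * real m powr (- g)" for n m :: nat
  define f where "f n m = w n m * (Jcoef (int n - int m) + Jcoef (int n + int m))" for n m
  have split: "(\<Sum>n\<in>{1..N}. \<Sum>m\<in>{1..N}. f n m) = (\<Sum>n\<in>{1..N}. \<Sum>m\<in>{1..<n}. f n m + f m n) + (\<Sum>n\<in>{1..N}. f n n)"
  proof (induction N)
    case (Suc N)
    have "(\<Sum>n\<in>{1..Suc N}. \<Sum>m\<in>{1..Suc N}. f n m) = (\<Sum>n\<in>{1..N}. \<Sum>m\<in>{1..Suc N}. f n m) + (\<Sum>m\<in>{1..Suc N}. f (Suc N) m)"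
      by simp
    also have "\<dots> = (\<Sum>n\<in>{1..N}. \<Sum>m\<in>{1..N}. f n m) + (\<Sum>n\<in>{1..N}. f n (Suc N)) + (\<Sum>m\<in>{1..N}. f (Suc N) m) + f (Suc N) (Suc N)"
      by (simp add: sum.distrib)
    also have "\<dots> = (\<Sum>n\<in>{1..N}. \<Sum>m\<in>{1..<n}. f n m + f m n) + (\<Sum>n\<in>{1..N}. f n n) + (\<Sum>m\<in>{1..<Suc N}. f (Suc N) m + f m (Suc N)) + f (Suc N) (Suc N)"
      unfolding Suc.IH by (simp add: sum.distrib atLeastLessThanSuc_atLeastAtMost)
    finally show ?case by simp
  qed simp
  have J: "1 / (pi * k) \<le> Jcoef (int n - int m)" if "real n - real m = k" "m < n" for n m k
    using Jcoef_bounds(1)[of "int n - int m"] that by simp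
  have J': "1 / (pi * (real n + real m)) \<le> Jcoef (int n + int m)" if "0 < n" for n m
    using Jcoef_bounds(1)[of "int n + int m"] that by simp
  have diag: "0 \<le> f n n" if "0 < n" for n
  proof -
    have "0 \<le> Jcoef (int n + int n)" by (rule order_trans[OF _ J'[OF that]]) simp
    thus ?thesis by (simp add: f_def w_def Jcoef_def[of 0])
  qed
  have off: "1 / pi * symkern g n m \<le> f n m + f m n" if m: "0 < m" "m < n" for n m
  proof -
    have d: "0 < real n - real m" "0 < real n" "0 < real m" using m by auto
    have ww: "w m n \<le> w n m"
    proof -
      have "real m powr (2 * g - 1) \<le> real n powr (2 * g - 1)" using m g by (intro powr_mono2) auto
      hence "(real m powr (- g) * real n powr (- g)) * real m powr (2 * g - 1) \<le> (real m powr (- g) * real n powr (- g)) * real n powr (2 * g - 1)"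
        by (intro mult_left_mono) auto
      moreover have "real m powr (- g) * real m powr (2 * g - 1) = real m powr (g - 1)"
        "real n powr (- g) * real n powr (2 * g - 1) = real n powr (g - 1)" by (simp_all flip: powr_add)
      ultimately show ?thesis unfolding w_def by (metis mult.assoc mult.commute)
    qed
    have "f n m + f m n = (w n m - w m n) * Jcoef (int n - int m) + (w n m + w m n) * Jcoef (int n + int m)"
      using Jcoef_minus[of "int n - int m"] by (simp add: f_def algebra_simps)
    also have "\<dots> \<ge> (w n m - w m n) * (1 / (pi * (real n - real m))) + (w n m + w m n) * (1 / (pi * (real n + real m)))"
      using ww J[OF refl m(2)] J'[of n m] m by (intro add_mono mult_left_mono) (auto simp: w_def)
    also have "(w n m - w m n) * (1 / (pi * (real n - real m))) + (w n m + w m n) * (1 / (pi * (real n + real m)))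
      = 1 / pi * (2 * (real n * w n m - real m * w m n) / ((real n)\<^sup>2 - (real m)\<^sup>2))"
    proof -
      have "(A - B) * (1 / (pi * (x - y))) + (A + B) * (1 / (pi * (x + y))) = 1 / pi * (2 * (x * A - y * B) / (x\<^sup>2 - y\<^sup>2))"
        if "x - y > 0" "x > 0" "y > 0" for A B x y :: real
      proof -
        have sq: "x\<^sup>2 - y\<^sup>2 = (x - y) * (x + y)" by (simp add: power2_eq_square algebra_simps)
        have "(A - B) / s + (A + B) / t = ((A - B) * t + (A + B) * s) / (s * t)" if "0 < s" "0 < t" for s t :: real
          using that by (simp add: field_simps)
        from this[of "x - y" "x + y"] that
        have "(A - B) / (x - y) + (A + B) / (x + y) = ((A - B) * (x + y) + (A + B) * (x - y)) / (x\<^sup>2 - y\<^sup>2)"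
          unfolding sq by simp
        also have "(A - B) * (x + y) + (A + B) * (x - y) = 2 * (x * A - y * B)" by (simp add: algebra_simps)
        finally have "1 / pi * ((A - B) / (x - y) + (A + B) / (x + y)) = 1 / pi * (2 * (x * A - y * B) / (x\<^sup>2 - y\<^sup>2))"
          by (simp only:)
        moreover have "u * (1 / (pi * s)) = 1 / pi * (u / s)" for u s by simp
        ultimately show ?thesis
          by (simp only: distrib_left[of "1 / pi" "(A - B) / (x - y)" "(A + B) / (x + y)", symmetric])
      qed
      from this[OF d] show ?thesis .
    qed
    also have "real n * w n m - real m * w m n = (real n / real m) powr g - (real m / real n) powr g"
      unfolding w_def using d by (simp add: powr_divide powr_diff powr_minus field_simps)
    finally show ?thesis unfolding symkern_def by simp
  qed
  have "(1 / pi) * (\<Sum>n\<in>{1..N}. \<Sum>m\<in>{1..<n}. symkern g n m) = (\<Sum>n\<in>{1..N}. \<Sum>m\<in>{1..<n}. 1 / pi * symkern g n m)"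
    by (simp add: sum_distrib_left)
  also have "\<dots> \<le> (\<Sum>n\<in>{1..N}. \<Sum>m\<in>{1..<n}. f n m + f m n)" using off by (intro sum_mono) auto
  also have "\<dots> \<le> (\<Sum>n\<in>{1..N}. \<Sum>m\<in>{1..<n}. f n m + f m n) + (\<Sum>n\<in>{1..N}. f n n)"
    using sum_nonneg[of "{1..N}" "\<lambda>n. f n n"] diag by simp
  also have "\<dots> = (\<Sum>n\<in>{1..N}. \<Sum>m\<in>{1..N}. f n m)" by (rule split[symmetric])
  also have "\<dots> = testpair g N" unfolding testpair_def f_def w_def ..
  finally show ?thesis .
qed

lemma harmonic_at_top: "filterlim (\<lambda>N. \<Sum>k<N. 1 / real (Suc k)) at_top sequentially"
proof -
  have "filterlim (harm :: nat \<Rightarrow> real) at_top sequentially" by (rule harm_at_top)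
  moreover have "harm = (\<lambda>N. \<Sum>k<N. 1 / real (Suc k))"
    unfolding harm_def by (intro ext sum.reindex_bij_witness[of _ Suc "\<lambda>m. m - 1"]) (auto simp: divide_inverse)
  ultimately show ?thesis by (simp only:)
qed

text \<open>The row sum of \<open>symkern\<close> over \<open>m < n\<close> is at least
  \<open>1 / n\<close> times a combination of Riemann sums tending to \<open>K\<close> terms of the
  tangent series. Harmonic averaging over \<open>n\<close> keeps this limit; only afterwards does
  \<open>K\<close> grow.\<close>

lemma sharp_constant:
  fixes g c :: real
  assumes g: "1 / 2 \<le> g" "g < 1" and c: "\<And>N. testpair g N \<le> c * (\<Sum>k<N. 1 / real (Suc k))"
  shows "tan (pi * g / 2) \<le> c"
proof -
  have K: "(\<Sum>k<K. 2 / (2 * real k + 1 - g) - 2 / (2 * real k + 1 + g)) / pi \<le> c" for K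
  proof -
    define y where "y n = (\<Sum>k<K. 2 * ((\<Sum>m=1..<n. (real m / real n) powr (2 * real k - g)) / real n
        - (\<Sum>m=1..<n. (real m / real n) powr (2 * real k + g)) / real n))" for n
    define L where "L = (\<Sum>k<K. 2 * (1 / (2 * real k - g + 1) - 1 / (2 * real k + g + 1)))"
    have "y \<longlonglongrightarrow> L" unfolding y_def[abs_def] L_def using g
      by (intro tendsto_sum tendsto_mult tendsto_const tendsto_diff power_sum_asymptotics) auto
    hence y: "(\<lambda>n. y (Suc n)) \<longlonglongrightarrow> L" by (rule LIMSEQ_Suc)
    have "(\<lambda>N. (\<Sum>k<N. 1 / real (Suc k) * y (Suc k)) / (\<Sum>k<N. 1 / real (Suc k))) \<longlonglongrightarrow> L"
      by (rule weighted_Cesaro[OF _ harmonic_at_top y]) simp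
    hence lim: "(\<lambda>N. (\<Sum>k<N. 1 / real (Suc k) * y (Suc k)) / (\<Sum>k<N. 1 / real (Suc k)) / pi) \<longlonglongrightarrow> L / pi"
      by (intro tendsto_divide tendsto_const) auto
    have "L / pi \<le> c"
    proof (rule LIMSEQ_le_const2[OF lim], intro exI[of _ 1] allI impI)
      fix N :: nat assume N: "1 \<le> N"
      have "(\<Sum>k<N. 1 / real (Suc k) * y (Suc k)) = (\<Sum>n\<in>{1..N}. 1 / real n * y n)"
        by (rule sum.reindex_bij_witness[of _ "\<lambda>m. m - 1" Suc]) auto
      also have "\<dots> \<le> (\<Sum>n\<in>{1..N}. \<Sum>m\<in>{1..<n}. symkern g n m)"
      proof (intro sum_mono)
        fix n assume n: "n \<in> {1..N}"
        have "1 / real n * y n = (\<Sum>m\<in>{1..<n}. (\<Sum>k<K. 2 * ((real m / real n) powr (2 * real k - g) - (real m / real n) powr (2 * real k + g))) / (real n)\<^sup>2)"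
        proof -
          have "1 / real n * y n = (\<Sum>k<K. \<Sum>m\<in>{1..<n}. 2 * ((real m / real n) powr (2 * real k - g) - (real m / real n) powr (2 * real k + g)) / (real n)\<^sup>2)"
            unfolding y_def sum_distrib_left
          proof (intro sum.cong refl)
            fix k
            have "1 / r * (2 * (A / r - B / r)) = 2 * (A - B) / r\<^sup>2" for r A B :: real
              by (simp add: power2_eq_square diff_divide_distrib)
            thus "1 / real n * (2 * ((\<Sum>m = 1..<n. (real m / real n) powr (2 * real k - g)) / real n - (\<Sum>m = 1..<n. (real m / real n) powr (2 * real k + g)) / real n))
             = (\<Sum>m = 1..<n. 2 * ((real m / real n) powr (2 * real k - g) - (real m / real n) powr (2 * real k + g)) / (real n)\<^sup>2)"
              by (simp add: sum_subtractf[symmetric] sum_divide_distrib sum_distrib_left)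
          qed
          also have "\<dots> = (\<Sum>m\<in>{1..<n}. \<Sum>k<K. 2 * ((real m / real n) powr (2 * real k - g) - (real m / real n) powr (2 * real k + g)) / (real n)\<^sup>2)"
            by (rule sum.swap)
          finally show ?thesis by (simp add: sum_divide_distrib)
        qed
        also have "\<dots> \<le> (\<Sum>m\<in>{1..<n}. symkern g n m)" using g by (intro sum_mono symkern_ge) auto
        finally show "1 / real n * y n \<le> (\<Sum>m\<in>{1..<n}. symkern g n m)" .
      qed
      finally have "1 / pi * (\<Sum>k<N. 1 / real (Suc k) * y (Suc k)) \<le> 1 / pi * (\<Sum>n\<in>{1..N}. \<Sum>m\<in>{1..<n}. symkern g n m)"
        by (intro mult_left_mono) auto
      also have "\<dots> \<le> c * (\<Sum>k<N. 1 / real (Suc k))" using testpair_ge[OF g(1), of N] c[of N] by linarith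
      finally have "1 / pi * (\<Sum>k<N. 1 / real (Suc k) * y (Suc k)) \<le> c * (\<Sum>k<N. 1 / real (Suc k))" .
      moreover have "0 < (\<Sum>k<N. 1 / real (Suc k))" using N by (intro sum_pos) (auto simp: lessThan_empty_iff)
      ultimately show "(\<Sum>k<N. 1 / real (Suc k) * y (Suc k)) / (\<Sum>k<N. 1 / real (Suc k)) / pi \<le> c"
        by (simp add: divide_le_eq mult_ac)
    qed
    moreover have "L = (\<Sum>k<K. 2 / (2 * real k + 1 - g) - 2 / (2 * real k + 1 + g))"
      unfolding L_def by (intro sum.cong refl) (simp add: right_diff_distrib add.commute add_diff_eq)
    ultimately show ?thesis by simp
  qed
  have "(\<lambda>K. (\<Sum>k<K. 2 / (2 * real k + 1 - g) - 2 / (2 * real k + 1 + g)) / pi) \<longlonglongrightarrow> pi * tan (pi * g / 2) / pi"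
    using tan_partial_fractions[of g] g by (intro tendsto_divide tendsto_const) (auto simp: sums_def)
  from LIMSEQ_le_const2[OF this] K show ?thesis by auto
qed

lemma in_lp_finite_support:
  assumes "finite X" "\<And>n. n \<notin> X \<Longrightarrow> a n = 0"
  shows "in_lp p a" "lp_norm p a = (\<Sum>n\<in>X. \<bar>a n\<bar> powr p) powr (1 / p)"
proof -
  have s: "(\<lambda>n. \<bar>a n\<bar> powr p) summable_on X" using assms(1) by simp
  have "(\<lambda>n. \<bar>a n\<bar> powr p) summable_on UNIV \<longleftrightarrow> (\<lambda>n. \<bar>a n\<bar> powr p) summable_on X"
    using assms(2) by (intro summable_on_cong_neutral) auto
  thus "in_lp p a" using s by (simp add: in_lp_def)
  have "(\<Sum>\<^sub>\<infinity>n. \<bar>a n\<bar> powr p) = infsum (\<lambda>n. \<bar>a n\<bar> powr p) X"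
    using assms(2) by (intro infsum_cong_neutral) auto
  thus "lp_norm p a = (\<Sum>n\<in>X. \<bar>a n\<bar> powr p) powr (1 / p)" using assms(1) by (simp add: lp_norm_def)
qed

text \<open>Hoelder turns a bound on the operator into one on the pairing, in which form the test
  sequences are evaluated.\<close>

lemma bilinear_le_of_norm_bound:
  assumes p: "1 < p" and c: "\<And>a. in_lp p a \<Longrightarrow> lp_norm p (Jop a) \<le> c * lp_norm p a"
    and fin: "finite X" and z: "\<And>n. n \<notin> X \<Longrightarrow> a n = 0"
  shows "(\<Sum>m\<in>X. \<Sum>n\<in>X. a m * b n * Jcoef (n - m))
    \<le> c * (\<Sum>n\<in>X. \<bar>a n\<bar> powr p) powr (1 / p) * (\<Sum>n\<in>X. \<bar>b n\<bar> powr (p / (p - 1))) powr (1 / (p / (p - 1)))"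
proof -
  define q where "q = p / (p - 1)"
  note e = conjugate_exponent(1,2)[OF p, folded q_def]
  have a: "in_lp p a" "lp_norm p a = (\<Sum>n\<in>X. \<bar>a n\<bar> powr p) powr (1 / p)"
    using in_lp_finite_support[OF fin, of a p] z by simp_all
  have J: "Jop a n = (\<Sum>m\<in>X. a m * Jcoef (n - m))" for n
  proof -
    have "Jop a n = (\<Sum>\<^sub>\<infinity>m. a m * Jcoef (n - m))" by (rule Jop_eq(2)[OF p a(1)])
    also have "\<dots> = infsum (\<lambda>m. a m * Jcoef (n - m)) X"
      by (rule infsum_cong_neutral) (auto simp: z)
    finally show ?thesis using fin by simp
  qed
  have "(\<Sum>m\<in>X. \<Sum>n\<in>X. a m * b n * Jcoef (n - m)) = (\<Sum>n\<in>X. Jop a n * b n)"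
    unfolding J by (subst sum.swap) (simp add: sum_distrib_left sum_distrib_right mult_ac)
  also have "\<dots> \<le> (\<Sum>n\<in>X. \<bar>Jop a n\<bar> powr p) powr (1 / p) * (\<Sum>n\<in>X. \<bar>b n\<bar> powr q) powr (1 / q)"
    by (rule Holder_sum[OF p e])
  also have "\<dots> \<le> (c * lp_norm p a) * (\<Sum>n\<in>X. \<bar>b n\<bar> powr q) powr (1 / q)"
  proof (rule mult_right_mono)
    have "(\<Sum>n\<in>X. \<bar>Jop a n\<bar> powr p) powr (1 / p) \<le> lp_norm p (Jop a)"
      using p by (intro finite_sum_le_lp_norm Jop_bounded(1)[OF p a(1)] fin) auto
    also have "\<dots> \<le> c * lp_norm p a" by (rule c[OF a(1)])
    finally show "(\<Sum>n\<in>X. \<bar>Jop a n\<bar> powr p) powr (1 / p) \<le> c * lp_norm p a" .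
  qed auto
  finally show ?thesis unfolding a(2) q_def .
qed

lemma sum_symmetric_range:
  fixes f :: "int \<Rightarrow> real"
  defines "X N \<equiv> int ` {1..N} \<union> (\<lambda>n. - int n) ` {1..N}"
  shows "(\<Sum>n\<in>X N. f n) = (\<Sum>n\<in>{1..N::nat}. f (int n) + f (- int n))"
proof -
  have "(\<Sum>n\<in>X N. f n) = (\<Sum>n\<in>int ` {1..N}. f n) + (\<Sum>n\<in>(\<lambda>n. - int n) ` {1..N}. f n)"
    unfolding X_def by (rule sum.union_disjoint) auto
  thus ?thesis by (simp add: sum.reindex inj_on_def sum.distrib)
qed

text \<open>With decay exponent \<open>1 / r\<close> either test sequence has \<open>r\<close>-th
  power sum twice the harmonic number, so the product of the two norms is again twice the harmonic
  number, against a pairing of \<open>2 * testpair\<close>. The even sequence needs decay exponent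
  at least \<open>1 / 2\<close>: it is \<open>a\<close> for \<open>p \<le> 2\<close> and, up to
  sign, \<open>b\<close> for \<open>p \<ge> 2\<close>.\<close>

lemma best_constant:
  assumes p: "1 < p" and c: "\<And>a. in_lp p a \<Longrightarrow> lp_norm p (Jop a) \<le> c * lp_norm p a"
  shows "cot (pi / (2 * pstar p)) \<le> c"
proof -
  define q where "q = p / (p - 1)"
  note e = conjugate_exponent[OF p, folded q_def]
  define X where "X N = int ` {1..N} \<union> (\<lambda>n. - int n) ` {1..N}" for N :: nat
  have fin: "finite (X N)" for N by (simp add: X_def)
  have sumX: "(\<Sum>n\<in>X N. f n) = (\<Sum>n\<in>{1..N}. f (int n) + f (- int n))" for f :: "int \<Rightarrow> real" and N
    unfolding X_def by (rule sum_symmetric_range)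
  define ev where "ev N s n = (if n \<in> X N then \<bar>real_of_int n\<bar> powr (- s) else 0)" for N s n
  define od where "od N s n = sgn (real_of_int n) * ev N s n" for N s n
  have inX: "int n \<in> X N" "- int n \<in> X N" if "n \<in> {1..N}" for n N using that by (auto simp: X_def)
  have H: "(\<Sum>n\<in>{1..N}. 1 / real n) = (\<Sum>k<N. 1 / real (Suc k))" for N
    by (rule sum.reindex_bij_witness[of _ Suc "\<lambda>m. m - 1"]) auto
  have nrm: "(\<Sum>n\<in>X N. \<bar>ev N (1 / r) n\<bar> powr r) = 2 * (\<Sum>k<N. 1 / real (Suc k))"
    "(\<Sum>n\<in>X N. \<bar>od N (1 / r) n\<bar> powr r) = 2 * (\<Sum>k<N. 1 / real (Suc k))" if "1 < r" for N r
  proof -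
    have 1: "\<bar>ev N (1 / r) (int n)\<bar> powr r = 1 / real n" "\<bar>ev N (1 / r) (- int n)\<bar> powr r = 1 / real n"
      if "n \<in> {1..N}" for n
    proof -
      have "(real n powr (- (1 / r))) powr r = real n powr (- 1)" using \<open>1 < r\<close> by (simp only: powr_powr) simp
      hence "(real n powr (- (1 / r))) powr r = 1 / real n" using that by (simp add: powr_minus_divide)
      thus "\<bar>ev N (1 / r) (int n)\<bar> powr r = 1 / real n" "\<bar>ev N (1 / r) (- int n)\<bar> powr r = 1 / real n"
        using inX[OF that] unfolding ev_def by simp_all
    qed
    have 2: "\<bar>od N (1 / r) (int n)\<bar> = \<bar>ev N (1 / r) (int n)\<bar>" "\<bar>od N (1 / r) (- int n)\<bar> = \<bar>ev N (1 / r) (- int n)\<bar>"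
      if "n \<in> {1..N}" for n
      using that by (auto simp: od_def abs_mult)
    show "(\<Sum>n\<in>X N. \<bar>ev N (1 / r) n\<bar> powr r) = 2 * (\<Sum>k<N. 1 / real (Suc k))"
      "(\<Sum>n\<in>X N. \<bar>od N (1 / r) n\<bar> powr r) = 2 * (\<Sum>k<N. 1 / real (Suc k))"
      unfolding sumX H[symmetric] sum_distrib_left using 1 2 by (auto intro!: sum.cong)
  qed
  have test: "(\<Sum>m\<in>X N. \<Sum>n\<in>X N. ev N g m * od N (1 - g) n * Jcoef (n - m)) = 2 * testpair g N" for N g
  proof -
    have E: "ev N s (int n) = real n powr (- s)" "ev N s (- int n) = real n powr (- s)"
      "od N s (int n) = real n powr (- s)" "od N s (- int n) = - (real n powr (- s))" if "n \<in> {1..N}" for n s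
      using inX[OF that] that by (auto simp: ev_def od_def)
    have "(\<Sum>m\<in>X N. \<Sum>n\<in>X N. ev N g m * od N (1 - g) n * Jcoef (n - m))
      = (\<Sum>m\<in>{1..N}. \<Sum>n\<in>{1..N}. 2 * (real n powr (g - 1) * real m powr (- g) * (Jcoef (int n - int m) + Jcoef (int n + int m))))"
      unfolding sumX sum.distrib[symmetric]
    proof (intro sum.cong refl)
      fix m n assume mn: "m \<in> {1..N}" "n \<in> {1..N}"
      have J: "Jcoef (- int n - int m) = - Jcoef (int n + int m)" "Jcoef (- int n - - int m) = - Jcoef (int n - int m)"
        "Jcoef (int n - - int m) = Jcoef (int n + int m)"
      proof -
        have "- int n - int m = - (int n + int m)" "- int n - - int m = - (int n - int m)" "int n - - int m = int n + int m"
          by linarith+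
        then show "Jcoef (- int n - int m) = - Jcoef (int n + int m)" "Jcoef (- int n - - int m) = - Jcoef (int n - int m)"
          "Jcoef (int n - - int m) = Jcoef (int n + int m)"
          by (simp_all only: Jcoef_minus)
      qed
      show "ev N g (int m) * od N (1 - g) (int n) * Jcoef (int n - int m) + ev N g (int m) * od N (1 - g) (- int n) * Jcoef (- int n - int m)
        + (ev N g (- int m) * od N (1 - g) (int n) * Jcoef (int n - - int m) + ev N g (- int m) * od N (1 - g) (- int n) * Jcoef (- int n - - int m))
        = 2 * (real n powr (g - 1) * real m powr (- g) * (Jcoef (int n - int m) + Jcoef (int n + int m)))"
        unfolding E[OF mn(1)] E[OF mn(2)] J by (simp add: algebra_simps)
    qed
    also have "\<dots> = 2 * testpair g N" unfolding testpair_def sum_distrib_left by (rule sum.swap)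
    finally show ?thesis .
  qed
  have bound: "(2 * (\<Sum>k<N. 1 / real (Suc k))) powr (1 / p) * (2 * (\<Sum>k<N. 1 / real (Suc k))) powr (1 / q)
      = 2 * (\<Sum>k<N. 1 / real (Suc k))" for N
  proof -
    have "0 \<le> (\<Sum>k<N. 1 / real (Suc k))" by (intro sum_nonneg) auto
    thus ?thesis using e(2) by (simp flip: powr_add)
  qed
  show ?thesis
  proof (cases "p \<le> 2")
    case True
    define g where "g = 1 / p"
    have g: "1 / 2 \<le> g" "g < 1" "1 - g = 1 / q" using p True e(2) by (auto simp: g_def field_simps)
    have "tan (pi * g / 2) \<le> c"
    proof (rule sharp_constant[OF g(1,2)])
      fix N
      have "2 * testpair g N \<le> c * (\<Sum>n\<in>X N. \<bar>ev N g n\<bar> powr p) powr (1 / p) * (\<Sum>n\<in>X N. \<bar>od N (1 - g) n\<bar> powr q) powr (1 / q)"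
        unfolding test[symmetric] q_def by (rule bilinear_le_of_norm_bound[OF p c fin]) (auto simp: ev_def)
      also have "\<dots> = c * (2 * (\<Sum>k<N. 1 / real (Suc k)))"
        unfolding g(3) unfolding g_def nrm(1)[OF p] nrm(2)[OF e(1)] mult.assoc bound ..
      finally show "testpair g N \<le> c * (\<Sum>k<N. 1 / real (Suc k))" by simp
    qed
    thus ?thesis unfolding e(3)[OF True] pichT_def g_def by (simp add: mult.commute)
  next
    case False
    hence p2: "2 \<le> p" by simp
    define g where "g = 1 / q"
    have g: "1 / 2 \<le> g" "g < 1" "1 - g = 1 / p" using e(1,2) e(5)[OF p2] by (auto simp: g_def field_simps)
    have "tan (pi * g / 2) \<le> c"
    proof (rule sharp_constant[OF g(1,2)])
      fix N
      \<comment> \<open>The odd sequence now plays \<open>a\<close> and minus the even one plays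
        \<open>b\<close>; the sign comes from the antisymmetry of \<open>Jcoef\<close>.\<close>
      have "2 * testpair g N = (\<Sum>n\<in>X N. \<Sum>m\<in>X N. ev N g m * od N (1 - g) n * Jcoef (n - m))"
        unfolding test[symmetric] by (rule sum.swap)
      also have "\<dots> = (\<Sum>n\<in>X N. \<Sum>m\<in>X N. od N (1 - g) n * (- ev N g m) * Jcoef (m - n))"
      proof (intro sum.cong refl)
        fix m n
        have "Jcoef (n - m) = - Jcoef (m - n)" using Jcoef_minus[of "m - n"] by simp
        thus "ev N g m * od N (1 - g) n * Jcoef (n - m) = od N (1 - g) n * (- ev N g m) * Jcoef (m - n)" by simp
      qed
      also have "\<dots> \<le> c * (\<Sum>n\<in>X N. \<bar>od N (1 - g) n\<bar> powr p) powr (1 / p) * (\<Sum>n\<in>X N. \<bar>- ev N g n\<bar> powr q) powr (1 / q)"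
        unfolding q_def by (rule bilinear_le_of_norm_bound[OF p c fin]) (auto simp: od_def ev_def)
      also have "\<dots> = c * (2 * (\<Sum>k<N. 1 / real (Suc k)))"
        unfolding g(3) abs_minus_cancel unfolding g_def nrm(2)[OF p] nrm(1)[OF e(1)] mult.assoc bound ..
      finally show "testpair g N \<le> c * (\<Sum>k<N. 1 / real (Suc k))" by simp
    qed
    thus ?thesis unfolding e(4)[OF p2] pichT_def g_def by (simp add: mult.commute)
  qed
qed

theorem theorem1p2:
  fixes p :: real
  assumes "1 < p"
  shows "(\<forall>a. in_lp p a \<longrightarrow>
            (\<forall>n. (\<lambda>m. \<bar>Jcoef m * a (n - m)\<bar>) summable_on UNIV) \<and>
            in_lp p (Jop a) \<and>
            lp_norm p (Jop a) \<le> cot (pi / (2 * pstar p)) * lp_norm p a)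
       \<and> (\<forall>c::real. (\<forall>a. in_lp p a \<longrightarrow> lp_norm p (Jop a) \<le> c * lp_norm p a)
            \<longrightarrow> cot (pi / (2 * pstar p)) \<le> c)"
  using Jop_abs_summable[OF assms] Jop_bounded[OF assms] best_constant[OF assms] by blast

end
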